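(* Let $\mathcal{K}$ be a $\mathcal{DL}\langle 4LQS^R\rangle(\mathbf{D})$-knowledge base. Then one can construct a $4LQS^R$-formula $\varphi_{\mathcal{K}}$ such that $\varphi_{\mathcal{K}}$ is satisfiable if and only if $\mathcal{K}$ is consistent.
   Context: \textbf{The set-theoretic language $4LQS$.} There are four pairwise disjoint collections of variables: $\mathcal{V}_0$ (sort 0: $x,y,z,\dots$), $\mathcal{V}_1$ (sort 1: $X^1,Y^1,\dots$), $\mathcal{V}_2$ (sort 2: $X^2,Y^2,\dots$), $\mathcal{V}_3$ (sort 3: $X^3,Y^3,\dots$), and pair terms $\langle x,y\rangle$ with $x,y\in\mathcal{V}_0$. Quantifier-free atomic formulae: level 0: $x=y$, $x\in X^1$, $\langle x,y\rangle = X^2$, $\langle x,y\rangle\in X^3$; level 1: $X^1=Y^1$, $X^1\in X^2$; level 2: $X^2=Y^2$, $X^2\in X^3$ (variables of the indicated sorts). Purely universal formulae: level 1: $(\forall z_1)\dots(\forall z_n)\varphi_0$ with $z_i\in\mathcal{V}_0$ and $\varphi_0$ a propositional combination of level-0 atomic formulae; level 2: $(\forall Z^1_1)\dots(\forall Z^1_m)\varphi_1$ with $Z^1_j\in\mathcal{V}_1$ and $\varphi_1$ a propositional combination of atomic formulae of levels 0,1 and purely universal formulae of level 1; level 3: $(\forall Z^2_1)\dots(\forall Z^2_p)\varphi_2$ with $Z^2_k\in\mathcal{V}_2$ and $\varphi_2$ a propositional combination of quantifier-free atomic formulae and purely universal formulae of levels 1 and 2. $4LQS$-formulae are propositional combinations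 of atomic formulae of levels 0,1,2 and purely universal formulae of levels 1,2,3. An occurrence of a subformula is positive if it lies within an even number of negations (connectives taken to be $\neg,\wedge,\vee$), negative otherwise. An interpretation $\mathcal{M}=(D,M)$ consists of a nonempty set $D$ and an assignment with $Mx\in D$, $MX^1\in\mathrm{pow}(D)$, $MX^2\in\mathrm{pow}(\mathrm{pow}(D))$, $MX^3\in\mathrm{pow}(\mathrm{pow}(\mathrm{pow}(D)))$; pairs are Kuratowski pairs, $M\langle x,y\rangle=\{\{Mx\},\{Mx,My\}\}$. Atomic formulae are evaluated by the usual meaning of $\in$ and $=$; quantifiers of sort 0, 1, 2 range over $D$, $\mathrm{pow}(D)$, $\mathrm{pow}(\mathrm{pow}(D))$ respectively; connectives as in propositional logic. A formula is satisfiable if some interpretation satisfies it. $4LQS^R$ is the set of $4LQS$-formulae $\psi$ such that: (1) for every purely universal formula $(\forall Z^1_1)\dots(\forall Z^1_m)\varphi_1$ of level 2 occurring in $\psi$ and every purely universal formula $(\forall z_1)\dots(\forall z_n)\varphi_0$ of level 1 occurring negatively in $\varphi_1$, the formula $\neg\varphi_0\rightarrow\bigwedge_{i=1}^n\bigwedge_{j=1}^m z_i\in Z^1_j$ is valid; (2) for every purely universal formula $(\forall Z^2_1)\dots(\forall Z^2_p)\varphi_2$ of level 3 in $\psi$: every purely universal formula of level 1 occurring negatively in $\varphi_2$ and not inside a level-2 purely universal formula has the form $(\forall z_1)\dots(\forall z_n)\neg(\bigwedge_{i=1}^n\bigwedge_{j=1}^n\langle z_i,z_j\rangle=Y^2_{ij})$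 with $Y^2_{ij}\in\mathcal{V}_2$, and purely universal formulae of level 2 occur only positively in $\varphi_2$. \textbf{Datatypes.} A datatype map $\mathbf{D}=(N_D,N_C,N_F,\cdot^{\mathbf{D}})$: $N_D$ a finite set of datatypes; $N_C(d)$ a set of constants for each $d\in N_D$; $N_F(d)$ a set of facets for each $d$; $d^{\mathbf{D}}$ a nonempty set (these sets pairwise disjoint for distinct datatypes), $f^{\mathbf{D}}\subseteq d^{\mathbf{D}}$ for $f\in N_F(d)$, $e_d^{\mathbf{D}}\in d^{\mathbf{D}}$ for $e_d\in N_C(d)$. A facet expression for $d$ is a Boolean combination (via $\neg,\wedge,\vee$) of elements of $N_F(d)\cup\{\top_d,\bot_d\}$, interpreted with $\top_d^{\mathbf{D}}=d^{\mathbf{D}}$, $\bot_d^{\mathbf{D}}=\emptyset$, negation as complement in $d^{\mathbf{D}}$, $\wedge,\vee$ as $\cap,\cup$. A data range is a datatype $d$, a finite enumeration $\{e_{d_1},\dots,e_{d_n}\}$ of constants, a facet expression, or the negation of one of these. \textbf{Syntax of $\mathcal{DL}\langle 4LQS^R\rangle(\mathbf{D})$.} Given pairwise disjoint sets of abstract role names, concrete role names, concept names, and individual names: datatype terms $t::= dr\mid\neg t\mid t_1\sqcap t_2\mid t_1\sqcup t_2\mid\{e_d\}$; concept terms $C::=A\mid\top\mid\bot\mid\neg C\mid C_1\sqcup C_2\mid C_1\sqcap C_2\mid\{a\}\mid\exists R.\mathit{Self}\mid\exists R.\{a\}\mid\exists P.\{e_d\}$; abstract role terms $R::=S\mid U\mid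 R^-\mid\neg R\mid R_1\sqcup R_2\mid R_1\sqcap R_2\mid R_{C|}\mid R_{|C}\mid R_{C_1|C_2}\mid id(C)$; concrete role terms $P::=T\mid\neg P\mid P_{C|}\mid P_{|t}\mid P_{C|t}$ ($dr$ data range, $e_d\in N_C(d)$, $a$ individual, $A$ concept name, $S$ abstract role name, $U$ universal role, $T$ concrete role name). A knowledge base is $\mathcal{K}=(\mathcal{R},\mathcal{T},\mathcal{A})$ where the RBox $\mathcal{R}$ contains statements $R_1\equiv R_2$, $R_1\sqsubseteq R_2$, $R_1\dots R_n\sqsubseteq R_{n+1}$, $\mathsf{Sym}(R)$, $\mathsf{Asym}(R)$, $\mathsf{Ref}(R)$, $\mathsf{Irref}(R)$, $\mathsf{Dis}(R_1,R_2)$, $\mathsf{Tra}(R)$, $\mathsf{Fun}(R)$, $P_1\equiv P_2$, $P_1\sqsubseteq P_2$, $\mathsf{Fun}(P)$; the TBox $\mathcal{T}$ contains $C_1\equiv C_2$, $C_1\sqsubseteq C_2$, $C_1\sqsubseteq\forall R.C_2$, $\exists R.C_1\sqsubseteq C_2$, $\geq_n R.C_1\sqsubseteq C_2$, $C_1\sqsubseteq\leq_n R.C_2$, $t_1\equiv t_2$, $t_1\sqsubseteq t_2$, $C\sqsubseteq\forall P.t$, $\exists P.t\sqsubseteq C$, $\geq_n P.t\sqsubseteq C$, $C\sqsubseteq\leq_n P.t$; the ABox $\mathcal{A}$ contains $a:C$, $(a,b):R$, $(a,b):\neg R$, $a=b$, $a\neq b$, $e_d:t$, $(a,e_d):P$,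 $(a,e_d):\neg P$ (all $C$'s concept terms, $R$'s abstract role terms, $P$'s concrete role terms, $t$'s datatype terms). \textbf{Semantics.} An interpretation $\mathbf{I}=(\Delta^{\mathbf{I}},\Delta_{\mathbf{D}},\cdot^{\mathbf{I}})$ has nonempty disjoint domains with $d^{\mathbf{D}}\subseteq\Delta_{\mathbf{D}}$ for all $d\in N_D$; $A^{\mathbf{I}}\subseteq\Delta^{\mathbf{I}}$, $S^{\mathbf{I}}\subseteq\Delta^{\mathbf{I}}\times\Delta^{\mathbf{I}}$, $T^{\mathbf{I}}\subseteq\Delta^{\mathbf{I}}\times\Delta_{\mathbf{D}}$, $a^{\mathbf{I}}\in\Delta^{\mathbf{I}}$, constants and data ranges interpreted by $\cdot^{\mathbf{D}}$ ($\{e_{d_1},\dots,e_{d_n}\}$ as $\{e^{\mathbf{D}}_{d_1},\dots,e^{\mathbf{D}}_{d_n}\}$, negated data range as complement in $\Delta_{\mathbf{D}}$). Datatype terms: $\neg t$ is $\Delta_{\mathbf{D}}\setminus t^{\mathbf{D}}$, $\sqcap,\sqcup$ are $\cap,\cup$, $\{e_d\}$ is $\{e_d^{\mathbf{D}}\}$. Concepts: $\top^{\mathbf{I}}=\Delta^{\mathbf{I}}$, $\bot^{\mathbf{I}}=\emptyset$, $\neg C$ complement in $\Delta^{\mathbf{I}}$, $\sqcap,\sqcup$ as $\cap,\cup$, $\{a\}^{\mathbf{I}}=\{a^{\mathbf{I}}\}$, $(\exists R.\mathit{Self})^{\mathbf{I}}=\{x:\langle x,x\rangle\in R^{\mathbf{I}}\}$,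 $(\exists R.\{a\})^{\mathbf{I}}=\{x:\langle x,a^{\mathbf{I}}\rangle\in R^{\mathbf{I}}\}$, $(\exists P.\{e_d\})^{\mathbf{I}}=\{x:\langle x,e_d^{\mathbf{D}}\rangle\in P^{\mathbf{I}}\}$. Abstract roles: $U^{\mathbf{I}}=\Delta^{\mathbf{I}}\times\Delta^{\mathbf{I}}$, $(R^-)^{\mathbf{I}}=\{\langle y,x\rangle:\langle x,y\rangle\in R^{\mathbf{I}}\}$, $\neg R$ complement in $\Delta^{\mathbf{I}}\times\Delta^{\mathbf{I}}$, $\sqcup,\sqcap$ as $\cup,\cap$, $R_{C|}=\{\langle x,y\rangle\in R^{\mathbf{I}}:x\in C^{\mathbf{I}}\}$, $R_{|C}=\{\langle x,y\rangle\in R^{\mathbf{I}}:y\in C^{\mathbf{I}}\}$, $R_{C_1|C_2}=\{\langle x,y\rangle\in R^{\mathbf{I}}:x\in C_1^{\mathbf{I}},y\in C_2^{\mathbf{I}}\}$, $id(C)^{\mathbf{I}}=\{\langle x,x\rangle:x\in C^{\mathbf{I}}\}$. Concrete roles: $\neg P$ complement in $\Delta^{\mathbf{I}}\times\Delta_{\mathbf{D}}$, $P_{C|}=\{\langle x,y\rangle\in P^{\mathbf{I}}:x\in C^{\mathbf{I}}\}$, $P_{|t}=\{\langle x,y\rangle\in P^{\mathbf{I}}:y\in t^{\mathbf{D}}\}$, $P_{C|t}=\{\langle x,y\rangle\in P^{\mathbf{I}}:x\in C^{\mathbf{I}},y\in t^{\mathbf{D}}\}$. Restrictions: $(\forall R.C)^{\mathbf{I}}=\{x:\forall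 y(\langle x,y\rangle\in R^{\mathbf{I}}\to y\in C^{\mathbf{I}})\}$, $(\exists R.C)^{\mathbf{I}}=\{x:\exists y\in C^{\mathbf{I}},\langle x,y\rangle\in R^{\mathbf{I}}\}$, $(\leq_n R.C)^{\mathbf{I}}=\{x:|\{y\in C^{\mathbf{I}}:\langle x,y\rangle\in R^{\mathbf{I}}\}|\le n\}$, $(\geq_n R.C)^{\mathbf{I}}$ analogously with $\ge n$; the concrete versions with $P$, $t$ and $y$ ranging over $\Delta_{\mathbf{D}}$, $t^{\mathbf{D}}$ are analogous. Statements: $\equiv$ and $\sqsubseteq$ mean equality and inclusion of interpretations; $R_1\dots R_n\sqsubseteq R_{n+1}$ means $R_1^{\mathbf{I}}\circ\dots\circ R_n^{\mathbf{I}}\subseteq R_{n+1}^{\mathbf{I}}$ (relational composition); $\mathsf{Sym}(R)$: $(R^-)^{\mathbf{I}}\subseteq R^{\mathbf{I}}$; $\mathsf{Asym}(R)$: $R^{\mathbf{I}}\cap(R^-)^{\mathbf{I}}=\emptyset$; $\mathsf{Tra}(R)$: $R^{\mathbf{I}}\circ R^{\mathbf{I}}\subseteq R^{\mathbf{I}}$; $\mathsf{Dis}(R_1,R_2)$: $R_1^{\mathbf{I}}\cap R_2^{\mathbf{I}}=\emptyset$; $\mathsf{Ref}(R)$: $\langle x,x\rangle\in R^{\mathbf{I}}$ for all $x\in\Delta^{\mathbf{I}}$; $\mathsf{Irref}(R)$: no $\langle x,x\rangle\in R^{\mathbf{I}}$; $\mathsf{Fun}(R)$ / $\mathsf{Fun}(P)$: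 $\langle x,y\rangle,\langle x,z\rangle$ in the role imply $y=z$; $a:C$ iff $a^{\mathbf{I}}\in C^{\mathbf{I}}$; $(a,b):R$ iff $\langle a^{\mathbf{I}},b^{\mathbf{I}}\rangle\in R^{\mathbf{I}}$ and $(a,b):\neg R$ iff not; $a=b$, $a\neq b$ as equality/inequality of $a^{\mathbf{I}},b^{\mathbf{I}}$; $e_d:t$ iff $e_d^{\mathbf{D}}\in t^{\mathbf{D}}$; $(a,e_d):P$ iff $\langle a^{\mathbf{I}},e_d^{\mathbf{D}}\rangle\in P^{\mathbf{I}}$ and $(a,e_d):\neg P$ iff not. $\mathcal{K}$ is consistent if some interpretation satisfies every statement of $\mathcal{R}$, $\mathcal{T}$, $\mathcal{A}$. *)

theory Defs
  imports Main
begin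

section \<open>The language 4LQS\<close>

text \<open>
  The collections of variables of sort 0, 1, 2, 3 are the types \<open>'x\<close>, \<open>'y\<close>, \<open>'z\<close>, \<open>'w\<close>.
  The stratification of formulae by level is built into the types.
\<close>

datatype 'a pform =
    Atom 'a
  | Neg "'a pform"
  | And "'a pform" "'a pform"
  | Or "'a pform" "'a pform"

abbreviation Imp :: "'a pform \<Rightarrow> 'a pform \<Rightarrow> 'a pform" where
  "Imp p q \<equiv> Or (Neg p) q"

abbreviation Iff :: "'a pform \<Rightarrow> 'a pform \<Rightarrow> 'a pform" where
  "Iff p q \<equiv> And (Imp p q) (Imp q p)"

text \<open>Used on nonempty lists only.\<close>

fun bigand :: "'a pform list \<Rightarrow> 'a pform" where
  "bigand [p] = p"
| "bigand (p # q # ps) = And p (bigand (q # ps))"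

fun bigor :: "'a pform list \<Rightarrow> 'a pform" where
  "bigor [p] = p"
| "bigor (p # q # ps) = Or p (bigor (q # ps))"

datatype ('x, 'y, 'z, 'w) atom0 =
    Eq0 'x 'x            \<comment> \<open>\<open>x = y\<close>\<close>
  | In01 'x 'y           \<comment> \<open>\<open>x \<in> X\<^sup>1\<close>\<close>
  | PairEq 'x 'x 'z      \<comment> \<open>\<open>\<langle>x, y\<rangle> = X\<^sup>2\<close>\<close>
  | PairIn 'x 'x 'w      \<comment> \<open>\<open>\<langle>x, y\<rangle> \<in> X\<^sup>3\<close>\<close>

datatype ('y, 'z) atom1 = Eq1 'y 'y | In12 'y 'z

datatype ('z, 'w) atom2 = Eq2 'z 'z | In23 'z 'w

datatype ('x, 'y, 'z, 'w) univ1 =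
  All0 "'x list" "('x, 'y, 'z, 'w) atom0 pform"

datatype ('x, 'y, 'z, 'w) comp1 =
    A10 "('x, 'y, 'z, 'w) atom0"
  | A11 "('y, 'z) atom1"
  | U11 "('x, 'y, 'z, 'w) univ1"

datatype ('x, 'y, 'z, 'w) univ2 =
  All1 "'y list" "('x, 'y, 'z, 'w) comp1 pform"

datatype ('x, 'y, 'z, 'w) comp2 =
    A20 "('x, 'y, 'z, 'w) atom0"
  | A21 "('y, 'z) atom1"
  | A22 "('z, 'w) atom2"
  | U21 "('x, 'y, 'z, 'w) univ1"
  | U22 "('x, 'y, 'z, 'w) univ2"

datatype ('x, 'y, 'z, 'w) univ3 =
  All2 "'z list" "('x, 'y, 'z, 'w) comp2 pform"

datatype ('x, 'y, 'z, 'w) comp3 =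
    A30 "('x, 'y, 'z, 'w) atom0"
  | A31 "('y, 'z) atom1"
  | A32 "('z, 'w) atom2"
  | U31 "('x, 'y, 'z, 'w) univ1"
  | U32 "('x, 'y, 'z, 'w) univ2"
  | U33 "('x, 'y, 'z, 'w) univ3"

type_synonym ('x, 'y, 'z, 'w) lqs = "('x, 'y, 'z, 'w) comp3 pform"


subsection \<open>Semantics\<close>

record ('u, 'x, 'y, 'z, 'w) lqs_interp =
  dmn :: "'u set"
  v0 :: "'x \<Rightarrow> 'u"
  v1 :: "'y \<Rightarrow> 'u set"
  v2 :: "'z \<Rightarrow> 'u set set"
  v3 :: "'w \<Rightarrow> 'u set set set"

definition is_lqs_interp :: "('u, 'x, 'y, 'z, 'w) lqs_interp \<Rightarrow> bool" where
  "is_lqs_interp M \<longleftrightarrow> dmn M \<noteq> {} \<and>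
     (\<forall>x. v0 M x \<in> dmn M) \<and>
     (\<forall>X. v1 M X \<in> Pow (dmn M)) \<and>
     (\<forall>X. v2 M X \<in> Pow (Pow (dmn M))) \<and>
     (\<forall>X. v3 M X \<in> Pow (Pow (Pow (dmn M))))"

definition kpair :: "'u \<Rightarrow> 'u \<Rightarrow> 'u set set" where
  "kpair a b = {{a}, {a, b}}"

primrec psat :: "('a \<Rightarrow> bool) \<Rightarrow> 'a pform \<Rightarrow> bool" where
  "psat s (Atom a) = s a"
| "psat s (Neg p) = (\<not> psat s p)"
| "psat s (And p q) = (psat s p \<and> psat s q)"
| "psat s (Or p q) = (psat s p \<or> psat s q)"

primrec sat_atom0 :: "('u, 'x, 'y, 'z, 'w) lqs_interp \<Rightarrow> ('x, 'y, 'z, 'w) atom0 \<Rightarrow> bool" where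
  "sat_atom0 M (Eq0 x y) = (v0 M x = v0 M y)"
| "sat_atom0 M (In01 x X) = (v0 M x \<in> v1 M X)"
| "sat_atom0 M (PairEq x y X) = (kpair (v0 M x) (v0 M y) = v2 M X)"
| "sat_atom0 M (PairIn x y X) = (kpair (v0 M x) (v0 M y) \<in> v3 M X)"

primrec sat_atom1 :: "('u, 'x, 'y, 'z, 'w) lqs_interp \<Rightarrow> ('y, 'z) atom1 \<Rightarrow> bool" where
  "sat_atom1 M (Eq1 X Y) = (v1 M X = v1 M Y)"
| "sat_atom1 M (In12 X Y) = (v1 M X \<in> v2 M Y)"

primrec sat_atom2 :: "('u, 'x, 'y, 'z, 'w) lqs_interp \<Rightarrow> ('z, 'w) atom2 \<Rightarrow> bool" where
  "sat_atom2 M (Eq2 X Y) = (v2 M X = v2 M Y)"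
| "sat_atom2 M (In23 X Y) = (v2 M X \<in> v3 M Y)"

primrec all0 :: "'x list \<Rightarrow> (('u, 'x, 'y, 'z, 'w) lqs_interp \<Rightarrow> bool)
    \<Rightarrow> ('u, 'x, 'y, 'z, 'w) lqs_interp \<Rightarrow> bool" where
  "all0 [] Q M = Q M"
| "all0 (z # zs) Q M = (\<forall>u\<in>dmn M. all0 zs Q (M\<lparr>v0 := (v0 M)(z := u)\<rparr>))"

primrec all1 :: "'y list \<Rightarrow> (('u, 'x, 'y, 'z, 'w) lqs_interp \<Rightarrow> bool)
    \<Rightarrow> ('u, 'x, 'y, 'z, 'w) lqs_interp \<Rightarrow> bool" where
  "all1 [] Q M = Q M"
| "all1 (Z # Zs) Q M = (\<forall>u\<in>Pow (dmn M). all1 Zs Q (M\<lparr>v1 := (v1 M)(Z := u)\<rparr>))"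

primrec all2 :: "'z list \<Rightarrow> (('u, 'x, 'y, 'z, 'w) lqs_interp \<Rightarrow> bool)
    \<Rightarrow> ('u, 'x, 'y, 'z, 'w) lqs_interp \<Rightarrow> bool" where
  "all2 [] Q M = Q M"
| "all2 (Z # Zs) Q M = (\<forall>u\<in>Pow (Pow (dmn M)). all2 Zs Q (M\<lparr>v2 := (v2 M)(Z := u)\<rparr>))"

primrec sat_univ1 :: "('u, 'x, 'y, 'z, 'w) lqs_interp \<Rightarrow> ('x, 'y, 'z, 'w) univ1 \<Rightarrow> bool" where
  "sat_univ1 M (All0 zs p) = all0 zs (\<lambda>M'. psat (sat_atom0 M') p) M"

primrec sat_comp1 :: "('u, 'x, 'y, 'z, 'w) lqs_interp \<Rightarrow> ('x, 'y, 'z, 'w) comp1 \<Rightarrow> bool" where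
  "sat_comp1 M (A10 a) = sat_atom0 M a"
| "sat_comp1 M (A11 a) = sat_atom1 M a"
| "sat_comp1 M (U11 q) = sat_univ1 M q"

primrec sat_univ2 :: "('u, 'x, 'y, 'z, 'w) lqs_interp \<Rightarrow> ('x, 'y, 'z, 'w) univ2 \<Rightarrow> bool" where
  "sat_univ2 M (All1 Zs p) = all1 Zs (\<lambda>M'. psat (sat_comp1 M') p) M"

primrec sat_comp2 :: "('u, 'x, 'y, 'z, 'w) lqs_interp \<Rightarrow> ('x, 'y, 'z, 'w) comp2 \<Rightarrow> bool" where
  "sat_comp2 M (A20 a) = sat_atom0 M a"
| "sat_comp2 M (A21 a) = sat_atom1 M a"
| "sat_comp2 M (A22 a) = sat_atom2 M a"
| "sat_comp2 M (U21 q) = sat_univ1 M q"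
| "sat_comp2 M (U22 q) = sat_univ2 M q"

primrec sat_univ3 :: "('u, 'x, 'y, 'z, 'w) lqs_interp \<Rightarrow> ('x, 'y, 'z, 'w) univ3 \<Rightarrow> bool" where
  "sat_univ3 M (All2 Zs p) = all2 Zs (\<lambda>M'. psat (sat_comp2 M') p) M"

primrec sat_comp3 :: "('u, 'x, 'y, 'z, 'w) lqs_interp \<Rightarrow> ('x, 'y, 'z, 'w) comp3 \<Rightarrow> bool" where
  "sat_comp3 M (A30 a) = sat_atom0 M a"
| "sat_comp3 M (A31 a) = sat_atom1 M a"
| "sat_comp3 M (A32 a) = sat_atom2 M a"
| "sat_comp3 M (U31 q) = sat_univ1 M q"
| "sat_comp3 M (U32 q) = sat_univ2 M q"
| "sat_comp3 M (U33 q) = sat_univ3 M q"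

text \<open>
  Domains of interpretations are sets over an arbitrary type \<open>'u\<close>, which is a parameter of
  satisfiability and validity.
\<close>

definition satisfiable :: "'u itself \<Rightarrow> ('x, 'y, 'z, 'w) lqs \<Rightarrow> bool" where
  "satisfiable TU f \<longleftrightarrow>
     (\<exists>M :: ('u, 'x, 'y, 'z, 'w) lqs_interp. is_lqs_interp M \<and> psat (sat_comp3 M) f)"

definition valid0 :: "'u itself \<Rightarrow> ('x, 'y, 'z, 'w) atom0 pform \<Rightarrow> bool" where
  "valid0 TU p \<longleftrightarrow>
     (\<forall>M :: ('u, 'x, 'y, 'z, 'w) lqs_interp. is_lqs_interp M \<longrightarrow> psat (sat_atom0 M) p)"


subsection \<open>The fragment \<open>4LQS\<^sup>R\<close>\<close>

text \<open>\<open>occ True p\<close> and \<open>occ False p\<close>: components occurring positively, resp. negatively, in \<open>p\<close>.\<close>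

primrec occ :: "bool \<Rightarrow> 'a pform \<Rightarrow> 'a set" where
  "occ b (Atom a) = (if b then {a} else {})"
| "occ b (Neg p) = occ (\<not> b) p"
| "occ b (And p q) = occ b p \<union> occ b q"
| "occ b (Or p q) = occ b p \<union> occ b q"

text \<open>Quantifier prefixes are nonempty: purely universal formulae have at least one quantifier.\<close>

primrec wf_univ1 :: "('x, 'y, 'z, 'w) univ1 \<Rightarrow> bool" where
  "wf_univ1 (All0 zs p) = (zs \<noteq> [])"

primrec restr_univ2 :: "'u itself \<Rightarrow> ('x, 'y, 'z, 'w) univ2 \<Rightarrow> bool" where
  "restr_univ2 TU (All1 Zs p) =
     (Zs \<noteq> [] \<and>
      (\<forall>q. U11 q \<in> set_pform p \<longrightarrow> wf_univ1 q) \<and>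
      (\<forall>zs p0. U11 (All0 zs p0) \<in> occ False p \<longrightarrow>
         valid0 TU (Imp (Neg p0) (bigand [Atom (In01 z Z). z \<leftarrow> zs, Z \<leftarrow> Zs]))))"

primrec restr_univ3 :: "'u itself \<Rightarrow> ('x, 'y, 'z, 'w) univ3 \<Rightarrow> bool" where
  "restr_univ3 TU (All2 Zs p) =
     (Zs \<noteq> [] \<and>
      (\<forall>q. U21 q \<in> set_pform p \<longrightarrow> wf_univ1 q) \<and>
      (\<forall>q. U22 q \<in> set_pform p \<longrightarrow> restr_univ2 TU q) \<and>
      (\<forall>zs p0. U21 (All0 zs p0) \<in> occ False p \<longrightarrow>
         (\<exists>Y. p0 = Neg (bigand [Atom (PairEq (zs ! i) (zs ! j) (Y i j)).
                                  i \<leftarrow> [0..<length zs], j \<leftarrow> [0..<length zs]]))) \<and>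
      (\<forall>q. U22 q \<notin> occ False p))"

definition in_4LQSR :: "'u itself \<Rightarrow> ('x, 'y, 'z, 'w) lqs \<Rightarrow> bool" where
  "in_4LQSR TU f \<longleftrightarrow>
     (\<forall>q. U31 q \<in> set_pform f \<longrightarrow> wf_univ1 q) \<and>
     (\<forall>q. U32 q \<in> set_pform f \<longrightarrow> restr_univ2 TU q) \<and>
     (\<forall>q. U33 q \<in> set_pform f \<longrightarrow> restr_univ3 TU q)"


section \<open>The description logic\<close>

subsection \<open>Datatype maps\<close>

text \<open>
  Names of all kinds are drawn from one type \<open>'n\<close>; the kinds are kept apart by the positions in
  which names occur.  Constants and facets are always accompanied by their datatype.
\<close>

record ('n, 'v) datatype_map =
  ND :: "'n set"
  NC :: "'n \<Rightarrow> 'n set"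
  NF :: "'n \<Rightarrow> 'n set"
  dtI :: "'n \<Rightarrow> 'v set"
  facetI :: "'n \<Rightarrow> 'n \<Rightarrow> 'v set"
  constI :: "'n \<Rightarrow> 'n \<Rightarrow> 'v"

definition is_datatype_map :: "('n, 'v) datatype_map \<Rightarrow> bool" where
  "is_datatype_map D \<longleftrightarrow> finite (ND D) \<and>
     (\<forall>d\<in>ND D. dtI D d \<noteq> {} \<and>
        (\<forall>d'\<in>ND D. d \<noteq> d' \<longrightarrow> dtI D d \<inter> dtI D d' = {}) \<and>
        (\<forall>f\<in>NF D d. facetI D d f \<subseteq> dtI D d) \<and>
        (\<forall>e\<in>NC D d. constI D d e \<in> dtI D d))"


subsection \<open>Syntax\<close>

datatype 'n fexpr =
    FName 'n
  | FTop
  | FBot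
  | FNeg "'n fexpr"
  | FAnd "'n fexpr" "'n fexpr"
  | FOr "'n fexpr" "'n fexpr"

datatype 'n brange =
    DType 'n
  | DEnum "('n \<times> 'n) list"      \<comment> \<open>constants as pairs (datatype, constant)\<close>
  | DFacet 'n "'n fexpr"        \<comment> \<open>a facet expression for the given datatype\<close>

datatype 'n drange = DPos "'n brange" | DNeg "'n brange"

datatype 'n dterm =
    TRange "'n drange"
  | TNeg "'n dterm"
  | TAnd "'n dterm" "'n dterm"
  | TOr "'n dterm" "'n dterm"
  | TConst 'n 'n

datatype 'n concept =
    CName 'n
  | CTop
  | CBot
  | CNeg "'n concept"
  | COr "'n concept" "'n concept"
  | CAnd "'n concept" "'n concept"
  | CNom 'n                     \<comment> \<open>\<open>{a}\<close>\<close>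
  | CSelf "'n arole"
  | CExInd "'n arole" 'n        \<comment> \<open>\<open>\<exists>R.{a}\<close>\<close>
  | CExConst "'n crole" 'n 'n   \<comment> \<open>\<open>\<exists>P.{e\<^sub>d}\<close>, with arguments \<open>P\<close>, \<open>d\<close>, \<open>e\<close>\<close>
and 'n arole =
    RName 'n
  | RUniv
  | RInv "'n arole"
  | RNeg "'n arole"
  | ROr "'n arole" "'n arole"
  | RAnd "'n arole" "'n arole"
  | RDom "'n arole" "'n concept"                 \<comment> \<open>\<open>R\<^bsub>C|\<^esub>\<close>\<close>
  | RRan "'n arole" "'n concept"                 \<comment> \<open>\<open>R\<^bsub>|C\<^esub>\<close>\<close>
  | RDomRan "'n arole" "'n concept" "'n concept" \<comment> \<open>\<open>R\<^bsub>C1|C2\<^esub>\<close>\<close>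
  | RId "'n concept"
and 'n crole =
    PName 'n
  | PNeg "'n crole"
  | PDom "'n crole" "'n concept"
  | PRan "'n crole" "'n dterm"
  | PDomRan "'n crole" "'n concept" "'n dterm"

datatype 'n rstmt =
    REqv "'n arole" "'n arole"
  | RSub "'n arole" "'n arole"
  | RChain "'n arole" "'n arole list" "'n arole" \<comment> \<open>\<open>R\<^sub>1 R\<^sub>2 \<dots> R\<^sub>n \<sqsubseteq> R\<close> as \<open>RChain R\<^sub>1 [R\<^sub>2, \<dots>, R\<^sub>n] R\<close>\<close>
  | RSym "'n arole"
  | RAsym "'n arole"
  | RRef "'n arole"
  | RIrref "'n arole"
  | RDis "'n arole" "'n arole"
  | RTra "'n arole"
  | RFun "'n arole"
  | PEqv "'n crole" "'n crole"
  | PSub "'n crole" "'n crole"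
  | PFun "'n crole"

datatype 'n tstmt =
    CEqv "'n concept" "'n concept"
  | CSub "'n concept" "'n concept"
  | CSubAll "'n concept" "'n arole" "'n concept"
  | ExSub "'n arole" "'n concept" "'n concept"
  | AtLeastSub nat "'n arole" "'n concept" "'n concept"
  | SubAtMost "'n concept" nat "'n arole" "'n concept"
  | TEqv "'n dterm" "'n dterm"
  | TSub "'n dterm" "'n dterm"
  | CSubAllP "'n concept" "'n crole" "'n dterm"
  | ExPSub "'n crole" "'n dterm" "'n concept"
  | AtLeastPSub nat "'n crole" "'n dterm" "'n concept"
  | SubAtMostP "'n concept" nat "'n crole" "'n dterm"

datatype 'n astmt =
    AConc 'n "'n concept"
  | ARole 'n 'n "'n arole"
  | ANRole 'n 'n "'n arole"
  | AEq 'n 'n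
  | ANeq 'n 'n
  | ATerm 'n 'n "'n dterm"       \<comment> \<open>\<open>e\<^sub>d : t\<close>, with arguments \<open>d\<close>, \<open>e\<close>, \<open>t\<close>\<close>
  | ACRole 'n 'n 'n "'n crole"   \<comment> \<open>\<open>(a, e\<^sub>d) : P\<close>, with arguments \<open>a\<close>, \<open>d\<close>, \<open>e\<close>, \<open>P\<close>\<close>
  | ANCRole 'n 'n 'n "'n crole"

text \<open>The boxes are finite sets of statements, represented by lists.\<close>

record 'n kb =
  rbox :: "'n rstmt list"
  tbox :: "'n tstmt list"
  abox :: "'n astmt list"


subsection \<open>Symbols occurring in a knowledge base\<close>

datatype 'n dpred = Dt 'n | Fc 'n 'n

datatype 'n sym =
    SInd 'n
  | SConcept 'n
  | SARole 'n
  | SCRole 'n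
  | SPred "'n dpred"
  | SConst 'n 'n

primrec sy_fexpr :: "'n \<Rightarrow> 'n fexpr \<Rightarrow> 'n sym list" where
  "sy_fexpr d (FName f) = [SPred (Fc d f)]"
| "sy_fexpr d FTop = []"
| "sy_fexpr d FBot = []"
| "sy_fexpr d (FNeg p) = sy_fexpr d p"
| "sy_fexpr d (FAnd p q) = sy_fexpr d p @ sy_fexpr d q"
| "sy_fexpr d (FOr p q) = sy_fexpr d p @ sy_fexpr d q"

definition sy_const :: "'n \<Rightarrow> 'n \<Rightarrow> 'n sym list" where
  "sy_const d e = [SPred (Dt d), SConst d e]"

primrec sy_brange :: "'n brange \<Rightarrow> 'n sym list" where
  "sy_brange (DType d) = [SPred (Dt d)]"
| "sy_brange (DEnum es) = concat (map (\<lambda>(d, e). sy_const d e) es)"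
| "sy_brange (DFacet d p) = SPred (Dt d) # sy_fexpr d p"

primrec sy_drange :: "'n drange \<Rightarrow> 'n sym list" where
  "sy_drange (DPos r) = sy_brange r"
| "sy_drange (DNeg r) = sy_brange r"

primrec sy_dterm :: "'n dterm \<Rightarrow> 'n sym list" where
  "sy_dterm (TRange r) = sy_drange r"
| "sy_dterm (TNeg t) = sy_dterm t"
| "sy_dterm (TAnd t u) = sy_dterm t @ sy_dterm u"
| "sy_dterm (TOr t u) = sy_dterm t @ sy_dterm u"
| "sy_dterm (TConst d e) = sy_const d e"

primrec sy_concept :: "'n concept \<Rightarrow> 'n sym list"
  and sy_arole :: "'n arole \<Rightarrow> 'n sym list"
  and sy_crole :: "'n crole \<Rightarrow> 'n sym list" where
  "sy_concept (CName A) = [SConcept A]"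
| "sy_concept CTop = []"
| "sy_concept CBot = []"
| "sy_concept (CNeg C) = sy_concept C"
| "sy_concept (COr C1 C2) = sy_concept C1 @ sy_concept C2"
| "sy_concept (CAnd C1 C2) = sy_concept C1 @ sy_concept C2"
| "sy_concept (CNom a) = [SInd a]"
| "sy_concept (CSelf R) = sy_arole R"
| "sy_concept (CExInd R a) = SInd a # sy_arole R"
| "sy_concept (CExConst P d e) = sy_const d e @ sy_crole P"
| "sy_arole (RName S) = [SARole S]"
| "sy_arole RUniv = []"
| "sy_arole (RInv R) = sy_arole R"
| "sy_arole (RNeg R) = sy_arole R"
| "sy_arole (ROr R1 R2) = sy_arole R1 @ sy_arole R2"
| "sy_arole (RAnd R1 R2) = sy_arole R1 @ sy_arole R2"
| "sy_arole (RDom R C) = sy_arole R @ sy_concept C"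
| "sy_arole (RRan R C) = sy_arole R @ sy_concept C"
| "sy_arole (RDomRan R C1 C2) = sy_arole R @ sy_concept C1 @ sy_concept C2"
| "sy_arole (RId C) = sy_concept C"
| "sy_crole (PName T) = [SCRole T]"
| "sy_crole (PNeg P) = sy_crole P"
| "sy_crole (PDom P C) = sy_crole P @ sy_concept C"
| "sy_crole (PRan P t) = sy_crole P @ sy_dterm t"
| "sy_crole (PDomRan P C t) = sy_crole P @ sy_concept C @ sy_dterm t"

primrec sy_rstmt :: "'n rstmt \<Rightarrow> 'n sym list" where
  "sy_rstmt (REqv R1 R2) = sy_arole R1 @ sy_arole R2"
| "sy_rstmt (RSub R1 R2) = sy_arole R1 @ sy_arole R2"
| "sy_rstmt (RChain R1 Rs R) = concat (map sy_arole (R # R1 # Rs))"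
| "sy_rstmt (RSym R) = sy_arole R"
| "sy_rstmt (RAsym R) = sy_arole R"
| "sy_rstmt (RRef R) = sy_arole R"
| "sy_rstmt (RIrref R) = sy_arole R"
| "sy_rstmt (RDis R1 R2) = sy_arole R1 @ sy_arole R2"
| "sy_rstmt (RTra R) = sy_arole R"
| "sy_rstmt (RFun R) = sy_arole R"
| "sy_rstmt (PEqv P1 P2) = sy_crole P1 @ sy_crole P2"
| "sy_rstmt (PSub P1 P2) = sy_crole P1 @ sy_crole P2"
| "sy_rstmt (PFun P) = sy_crole P"

primrec sy_tstmt :: "'n tstmt \<Rightarrow> 'n sym list" where
  "sy_tstmt (CEqv C1 C2) = sy_concept C1 @ sy_concept C2"
| "sy_tstmt (CSub C1 C2) = sy_concept C1 @ sy_concept C2"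
| "sy_tstmt (CSubAll C1 R C2) = sy_concept C1 @ sy_arole R @ sy_concept C2"
| "sy_tstmt (ExSub R C1 C2) = sy_arole R @ sy_concept C1 @ sy_concept C2"
| "sy_tstmt (AtLeastSub n R C1 C2) = sy_arole R @ sy_concept C1 @ sy_concept C2"
| "sy_tstmt (SubAtMost C1 n R C2) = sy_concept C1 @ sy_arole R @ sy_concept C2"
| "sy_tstmt (TEqv t u) = sy_dterm t @ sy_dterm u"
| "sy_tstmt (TSub t u) = sy_dterm t @ sy_dterm u"
| "sy_tstmt (CSubAllP C P t) = sy_concept C @ sy_crole P @ sy_dterm t"
| "sy_tstmt (ExPSub P t C) = sy_crole P @ sy_dterm t @ sy_concept C"
| "sy_tstmt (AtLeastPSub n P t C) = sy_crole P @ sy_dterm t @ sy_concept C"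
| "sy_tstmt (SubAtMostP C n P t) = sy_concept C @ sy_crole P @ sy_dterm t"

primrec sy_astmt :: "'n astmt \<Rightarrow> 'n sym list" where
  "sy_astmt (AConc a C) = SInd a # sy_concept C"
| "sy_astmt (ARole a b R) = SInd a # SInd b # sy_arole R"
| "sy_astmt (ANRole a b R) = SInd a # SInd b # sy_arole R"
| "sy_astmt (AEq a b) = [SInd a, SInd b]"
| "sy_astmt (ANeq a b) = [SInd a, SInd b]"
| "sy_astmt (ATerm d e t) = sy_const d e @ sy_dterm t"
| "sy_astmt (ACRole a d e P) = SInd a # sy_const d e @ sy_crole P"
| "sy_astmt (ANCRole a d e P) = SInd a # sy_const d e @ sy_crole P"

definition sy_kb :: "'n kb \<Rightarrow> 'n sym list" where
  "sy_kb K = concat (map sy_rstmt (rbox K)) @ concat (map sy_tstmt (tbox K))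
             @ concat (map sy_astmt (abox K))"

text \<open>A knowledge base over \<open>D\<close> mentions only datatypes, facets and constants of \<open>D\<close>.\<close>

definition kb_over :: "('n, 'v) datatype_map \<Rightarrow> 'n kb \<Rightarrow> bool" where
  "kb_over D K \<longleftrightarrow>
     (\<forall>d. SPred (Dt d) \<in> set (sy_kb K) \<longrightarrow> d \<in> ND D) \<and>
     (\<forall>d f. SPred (Fc d f) \<in> set (sy_kb K) \<longrightarrow> d \<in> ND D \<and> f \<in> NF D d) \<and>
     (\<forall>d e. SConst d e \<in> set (sy_kb K) \<longrightarrow> d \<in> ND D \<and> e \<in> NC D d)"


subsection \<open>Semantics\<close>

text \<open>
  The abstract and the concrete domain are sets over different types, hence disjoint.
\<close>

record ('n, 'i, 'v) dl_interp =
  aDom :: "'i set"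
  dDom :: "'v set"
  conceptI :: "'n \<Rightarrow> 'i set"
  aroleI :: "'n \<Rightarrow> ('i \<times> 'i) set"
  croleI :: "'n \<Rightarrow> ('i \<times> 'v) set"
  indI :: "'n \<Rightarrow> 'i"

definition is_dl_interp :: "('n, 'v) datatype_map \<Rightarrow> ('n, 'i, 'v) dl_interp \<Rightarrow> bool" where
  "is_dl_interp D I \<longleftrightarrow> aDom I \<noteq> {} \<and> dDom I \<noteq> {} \<and>
     (\<forall>d\<in>ND D. dtI D d \<subseteq> dDom I) \<and>
     (\<forall>A. conceptI I A \<subseteq> aDom I) \<and>
     (\<forall>S. aroleI I S \<subseteq> aDom I \<times> aDom I) \<and>
     (\<forall>T. croleI I T \<subseteq> aDom I \<times> dDom I) \<and>
     (\<forall>a. indI I a \<in> aDom I)"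

primrec fexprS :: "('n, 'v) datatype_map \<Rightarrow> 'n \<Rightarrow> 'n fexpr \<Rightarrow> 'v set" where
  "fexprS D d (FName f) = facetI D d f"
| "fexprS D d FTop = dtI D d"
| "fexprS D d FBot = {}"
| "fexprS D d (FNeg p) = dtI D d - fexprS D d p"
| "fexprS D d (FAnd p q) = fexprS D d p \<inter> fexprS D d q"
| "fexprS D d (FOr p q) = fexprS D d p \<union> fexprS D d q"

primrec brangeS :: "('n, 'v) datatype_map \<Rightarrow> 'n brange \<Rightarrow> 'v set" where
  "brangeS D (DType d) = dtI D d"
| "brangeS D (DEnum es) = {constI D d e | d e. (d, e) \<in> set es}"
| "brangeS D (DFacet d p) = fexprS D d p"

primrec drangeS :: "('n, 'v) datatype_map \<Rightarrow> 'v set \<Rightarrow> 'n drange \<Rightarrow> 'v set" where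
  "drangeS D V (DPos r) = brangeS D r"
| "drangeS D V (DNeg r) = V - brangeS D r"

primrec dtermS :: "('n, 'v) datatype_map \<Rightarrow> 'v set \<Rightarrow> 'n dterm \<Rightarrow> 'v set" where
  "dtermS D V (TRange r) = drangeS D V r"
| "dtermS D V (TNeg t) = V - dtermS D V t"
| "dtermS D V (TAnd t u) = dtermS D V t \<inter> dtermS D V u"
| "dtermS D V (TOr t u) = dtermS D V t \<union> dtermS D V u"
| "dtermS D V (TConst d e) = {constI D d e}"

primrec conceptS :: "('n, 'v) datatype_map \<Rightarrow> ('n, 'i, 'v) dl_interp \<Rightarrow> 'n concept \<Rightarrow> 'i set"
  and aroleS :: "('n, 'v) datatype_map \<Rightarrow> ('n, 'i, 'v) dl_interp \<Rightarrow> 'n arole \<Rightarrow> ('i \<times> 'i) set"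
  and croleS :: "('n, 'v) datatype_map \<Rightarrow> ('n, 'i, 'v) dl_interp \<Rightarrow> 'n crole \<Rightarrow> ('i \<times> 'v) set"
where
  "conceptS D I (CName A) = conceptI I A"
| "conceptS D I CTop = aDom I"
| "conceptS D I CBot = {}"
| "conceptS D I (CNeg C) = aDom I - conceptS D I C"
| "conceptS D I (COr C1 C2) = conceptS D I C1 \<union> conceptS D I C2"
| "conceptS D I (CAnd C1 C2) = conceptS D I C1 \<inter> conceptS D I C2"
| "conceptS D I (CNom a) = {indI I a}"
| "conceptS D I (CSelf R) = {x \<in> aDom I. (x, x) \<in> aroleS D I R}"
| "conceptS D I (CExInd R a) = {x \<in> aDom I. (x, indI I a) \<in> aroleS D I R}"
| "conceptS D I (CExConst P d e) = {x \<in> aDom I. (x, constI D d e) \<in> croleS D I P}"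
| "aroleS D I (RName S) = aroleI I S"
| "aroleS D I RUniv = aDom I \<times> aDom I"
| "aroleS D I (RInv R) = (aroleS D I R)\<inverse>"
| "aroleS D I (RNeg R) = (aDom I \<times> aDom I) - aroleS D I R"
| "aroleS D I (ROr R1 R2) = aroleS D I R1 \<union> aroleS D I R2"
| "aroleS D I (RAnd R1 R2) = aroleS D I R1 \<inter> aroleS D I R2"
| "aroleS D I (RDom R C) = {(x, y) \<in> aroleS D I R. x \<in> conceptS D I C}"
| "aroleS D I (RRan R C) = {(x, y) \<in> aroleS D I R. y \<in> conceptS D I C}"
| "aroleS D I (RDomRan R C1 C2) =
     {(x, y) \<in> aroleS D I R. x \<in> conceptS D I C1 \<and> y \<in> conceptS D I C2}"
| "aroleS D I (RId C) = {(x, x) | x. x \<in> conceptS D I C}"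
| "croleS D I (PName T) = croleI I T"
| "croleS D I (PNeg P) = (aDom I \<times> dDom I) - croleS D I P"
| "croleS D I (PDom P C) = {(x, y) \<in> croleS D I P. x \<in> conceptS D I C}"
| "croleS D I (PRan P t) = {(x, y) \<in> croleS D I P. y \<in> dtermS D (dDom I) t}"
| "croleS D I (PDomRan P C t) =
     {(x, y) \<in> croleS D I P. x \<in> conceptS D I C \<and> y \<in> dtermS D (dDom I) t}"

text \<open>
  \<open>\<forall>R.C\<close>, \<open>\<exists>R.C\<close>, \<open>\<ge>\<^sub>n R.C\<close>, \<open>\<le>\<^sub>n R.C\<close> for a relation from \<open>X\<close> to \<open>'b\<close> and a set \<open>C\<close>; used for
  abstract and for concrete roles.
\<close>

definition all_restr :: "'a set \<Rightarrow> ('a \<times> 'b) set \<Rightarrow> 'b set \<Rightarrow> 'a set" where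
  "all_restr X r C = {x \<in> X. \<forall>y. (x, y) \<in> r \<longrightarrow> y \<in> C}"

definition ex_restr :: "'a set \<Rightarrow> ('a \<times> 'b) set \<Rightarrow> 'b set \<Rightarrow> 'a set" where
  "ex_restr X r C = {x \<in> X. \<exists>y\<in>C. (x, y) \<in> r}"

definition at_least :: "'a set \<Rightarrow> nat \<Rightarrow> ('a \<times> 'b) set \<Rightarrow> 'b set \<Rightarrow> 'a set" where
  "at_least X n r C =
     {x \<in> X. infinite {y \<in> C. (x, y) \<in> r} \<or> card {y \<in> C. (x, y) \<in> r} \<ge> n}"

definition at_most :: "'a set \<Rightarrow> nat \<Rightarrow> ('a \<times> 'b) set \<Rightarrow> 'b set \<Rightarrow> 'a set" where
  "at_most X n r C =
     {x \<in> X. finite {y \<in> C. (x, y) \<in> r} \<and> card {y \<in> C. (x, y) \<in> r} \<le> n}"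

definition functional :: "('a \<times> 'b) set \<Rightarrow> bool" where
  "functional r \<longleftrightarrow> (\<forall>x y z. (x, y) \<in> r \<longrightarrow> (x, z) \<in> r \<longrightarrow> y = z)"

primrec chain :: "('a \<times> 'a) set \<Rightarrow> ('a \<times> 'a) set list \<Rightarrow> ('a \<times> 'a) set" where
  "chain r [] = r"
| "chain r (s # ss) = r O chain s ss"

primrec sat_rstmt :: "('n, 'v) datatype_map \<Rightarrow> ('n, 'i, 'v) dl_interp \<Rightarrow> 'n rstmt \<Rightarrow> bool" where
  "sat_rstmt D I (REqv R1 R2) = (aroleS D I R1 = aroleS D I R2)"
| "sat_rstmt D I (RSub R1 R2) = (aroleS D I R1 \<subseteq> aroleS D I R2)"
| "sat_rstmt D I (RChain R1 Rs R) =
     (chain (aroleS D I R1) (map (aroleS D I) Rs) \<subseteq> aroleS D I R)"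
| "sat_rstmt D I (RSym R) = (aroleS D I (RInv R) \<subseteq> aroleS D I R)"
| "sat_rstmt D I (RAsym R) = (aroleS D I R \<inter> aroleS D I (RInv R) = {})"
| "sat_rstmt D I (RRef R) = (\<forall>x\<in>aDom I. (x, x) \<in> aroleS D I R)"
| "sat_rstmt D I (RIrref R) = (\<forall>x. (x, x) \<notin> aroleS D I R)"
| "sat_rstmt D I (RDis R1 R2) = (aroleS D I R1 \<inter> aroleS D I R2 = {})"
| "sat_rstmt D I (RTra R) = (aroleS D I R O aroleS D I R \<subseteq> aroleS D I R)"
| "sat_rstmt D I (RFun R) = functional (aroleS D I R)"
| "sat_rstmt D I (PEqv P1 P2) = (croleS D I P1 = croleS D I P2)"
| "sat_rstmt D I (PSub P1 P2) = (croleS D I P1 \<subseteq> croleS D I P2)"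
| "sat_rstmt D I (PFun P) = functional (croleS D I P)"

primrec sat_tstmt :: "('n, 'v) datatype_map \<Rightarrow> ('n, 'i, 'v) dl_interp \<Rightarrow> 'n tstmt \<Rightarrow> bool" where
  "sat_tstmt D I (CEqv C1 C2) = (conceptS D I C1 = conceptS D I C2)"
| "sat_tstmt D I (CSub C1 C2) = (conceptS D I C1 \<subseteq> conceptS D I C2)"
| "sat_tstmt D I (CSubAll C1 R C2) =
     (conceptS D I C1 \<subseteq> all_restr (aDom I) (aroleS D I R) (conceptS D I C2))"
| "sat_tstmt D I (ExSub R C1 C2) =
     (ex_restr (aDom I) (aroleS D I R) (conceptS D I C1) \<subseteq> conceptS D I C2)"
| "sat_tstmt D I (AtLeastSub n R C1 C2) =
     (at_least (aDom I) n (aroleS D I R) (conceptS D I C1) \<subseteq> conceptS D I C2)"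
| "sat_tstmt D I (SubAtMost C1 n R C2) =
     (conceptS D I C1 \<subseteq> at_most (aDom I) n (aroleS D I R) (conceptS D I C2))"
| "sat_tstmt D I (TEqv t u) = (dtermS D (dDom I) t = dtermS D (dDom I) u)"
| "sat_tstmt D I (TSub t u) = (dtermS D (dDom I) t \<subseteq> dtermS D (dDom I) u)"
| "sat_tstmt D I (CSubAllP C P t) =
     (conceptS D I C \<subseteq> all_restr (aDom I) (croleS D I P) (dtermS D (dDom I) t))"
| "sat_tstmt D I (ExPSub P t C) =
     (ex_restr (aDom I) (croleS D I P) (dtermS D (dDom I) t) \<subseteq> conceptS D I C)"
| "sat_tstmt D I (AtLeastPSub n P t C) =
     (at_least (aDom I) n (croleS D I P) (dtermS D (dDom I) t) \<subseteq> conceptS D I C)"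
| "sat_tstmt D I (SubAtMostP C n P t) =
     (conceptS D I C \<subseteq> at_most (aDom I) n (croleS D I P) (dtermS D (dDom I) t))"

primrec sat_astmt :: "('n, 'v) datatype_map \<Rightarrow> ('n, 'i, 'v) dl_interp \<Rightarrow> 'n astmt \<Rightarrow> bool" where
  "sat_astmt D I (AConc a C) = (indI I a \<in> conceptS D I C)"
| "sat_astmt D I (ARole a b R) = ((indI I a, indI I b) \<in> aroleS D I R)"
| "sat_astmt D I (ANRole a b R) = ((indI I a, indI I b) \<notin> aroleS D I R)"
| "sat_astmt D I (AEq a b) = (indI I a = indI I b)"
| "sat_astmt D I (ANeq a b) = (indI I a \<noteq> indI I b)"
| "sat_astmt D I (ATerm d e t) = (constI D d e \<in> dtermS D (dDom I) t)"
| "sat_astmt D I (ACRole a d e P) = ((indI I a, constI D d e) \<in> croleS D I P)"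
| "sat_astmt D I (ANCRole a d e P) = ((indI I a, constI D d e) \<notin> croleS D I P)"

text \<open>Abstract domains are sets over an arbitrary type \<open>'i\<close>, which is a parameter of consistency.\<close>

definition consistent :: "'i itself \<Rightarrow> ('n, 'v) datatype_map \<Rightarrow> 'n kb \<Rightarrow> bool" where
  "consistent TI D K \<longleftrightarrow>
     (\<exists>I :: ('n, 'i, 'v) dl_interp. is_dl_interp D I \<and>
        (\<forall>s\<in>set (rbox K). sat_rstmt D I s) \<and>
        (\<forall>s\<in>set (tbox K). sat_tstmt D I s) \<and>
        (\<forall>s\<in>set (abox K). sat_astmt D I s))"


section \<open>The formula constructed from a knowledge base\<close>

text \<open>
  Variables of the constructed formula.  \<open>XWit S j\<close> names the \<open>j\<close>-th witness of the region of the
  concrete domain given by \<open>S\<close> (see below); \<open>Q k\<close> are the quantified variables.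
\<close>

datatype 'n var0 = XInd 'n | XConst 'n 'n | XWit "'n dpred list" nat | Q nat
datatype 'n var1 = XConcept 'n | XPred "'n dpred" | XAbs | XData
datatype 'n var3 = XARole 'n | XCRole 'n

type_synonym 'n qf = "('n var0, 'n var1, nat, 'n var3) atom0 pform"
type_synonym 'n dl_formula = "('n var0, 'n var1, nat, 'n var3) lqs"

abbreviation eqf :: "'n var0 \<Rightarrow> 'n var0 \<Rightarrow> 'n qf" where
  "eqf x y \<equiv> Atom (Eq0 x y)"

abbreviation inf1 :: "'n var0 \<Rightarrow> 'n var1 \<Rightarrow> 'n qf" where
  "inf1 x X \<equiv> Atom (In01 x X)"

abbreviation pairf :: "'n var0 \<Rightarrow> 'n var0 \<Rightarrow> 'n var3 \<Rightarrow> 'n qf" where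
  "pairf x y X \<equiv> Atom (PairIn x y X)"

definition ff :: "'n var0 \<Rightarrow> 'n qf" where
  "ff x = Neg (eqf x x)"

definition qfree :: "'n qf \<Rightarrow> 'n dl_formula" where
  "qfree p = map_pform A30 p"

text \<open>Universal closure over \<open>Q 0, \<dots>, Q k\<close>.\<close>

definition allq :: "nat \<Rightarrow> 'n qf \<Rightarrow> 'n dl_formula" where
  "allq k p = Atom (U31 (All0 (map Q [0..<Suc k]) p))"

subsection \<open>Terms\<close>

primrec tr_fexpr :: "'n \<Rightarrow> 'n fexpr \<Rightarrow> 'n var0 \<Rightarrow> 'n qf" where
  "tr_fexpr d (FName f) x = inf1 x (XPred (Fc d f))"
| "tr_fexpr d FTop x = inf1 x (XPred (Dt d))"
| "tr_fexpr d FBot x = ff x"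
| "tr_fexpr d (FNeg p) x = And (inf1 x (XPred (Dt d))) (Neg (tr_fexpr d p x))"
| "tr_fexpr d (FAnd p q) x = And (tr_fexpr d p x) (tr_fexpr d q x)"
| "tr_fexpr d (FOr p q) x = Or (tr_fexpr d p x) (tr_fexpr d q x)"

primrec tr_brange :: "'n brange \<Rightarrow> 'n var0 \<Rightarrow> 'n qf" where
  "tr_brange (DType d) x = inf1 x (XPred (Dt d))"
| "tr_brange (DEnum es) x = bigor (ff x # map (\<lambda>(d, e). eqf x (XConst d e)) es)"
| "tr_brange (DFacet d p) x = tr_fexpr d p x"

primrec tr_drange :: "'n drange \<Rightarrow> 'n var0 \<Rightarrow> 'n qf" where
  "tr_drange (DPos r) x = tr_brange r x"
| "tr_drange (DNeg r) x = And (inf1 x XData) (Neg (tr_brange r x))"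

primrec tr_dterm :: "'n dterm \<Rightarrow> 'n var0 \<Rightarrow> 'n qf" where
  "tr_dterm (TRange r) x = tr_drange r x"
| "tr_dterm (TNeg t) x = And (inf1 x XData) (Neg (tr_dterm t x))"
| "tr_dterm (TAnd t u) x = And (tr_dterm t x) (tr_dterm u x)"
| "tr_dterm (TOr t u) x = Or (tr_dterm t x) (tr_dterm u x)"
| "tr_dterm (TConst d e) x = eqf x (XConst d e)"

primrec tr_concept :: "'n concept \<Rightarrow> 'n var0 \<Rightarrow> 'n qf"
  and tr_arole :: "'n arole \<Rightarrow> 'n var0 \<Rightarrow> 'n var0 \<Rightarrow> 'n qf"
  and tr_crole :: "'n crole \<Rightarrow> 'n var0 \<Rightarrow> 'n var0 \<Rightarrow> 'n qf" where
  "tr_concept (CName A) x = inf1 x (XConcept A)"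
| "tr_concept CTop x = inf1 x XAbs"
| "tr_concept CBot x = ff x"
| "tr_concept (CNeg C) x = And (inf1 x XAbs) (Neg (tr_concept C x))"
| "tr_concept (COr C1 C2) x = Or (tr_concept C1 x) (tr_concept C2 x)"
| "tr_concept (CAnd C1 C2) x = And (tr_concept C1 x) (tr_concept C2 x)"
| "tr_concept (CNom a) x = eqf x (XInd a)"
| "tr_concept (CSelf R) x = tr_arole R x x"
| "tr_concept (CExInd R a) x = tr_arole R x (XInd a)"
| "tr_concept (CExConst P d e) x = tr_crole P x (XConst d e)"
| "tr_arole (RName S) x y = pairf x y (XARole S)"
| "tr_arole RUniv x y = And (inf1 x XAbs) (inf1 y XAbs)"
| "tr_arole (RInv R) x y = tr_arole R y x"
| "tr_arole (RNeg R) x y = And (And (inf1 x XAbs) (inf1 y XAbs)) (Neg (tr_arole R x y))"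
| "tr_arole (ROr R1 R2) x y = Or (tr_arole R1 x y) (tr_arole R2 x y)"
| "tr_arole (RAnd R1 R2) x y = And (tr_arole R1 x y) (tr_arole R2 x y)"
| "tr_arole (RDom R C) x y = And (tr_arole R x y) (tr_concept C x)"
| "tr_arole (RRan R C) x y = And (tr_arole R x y) (tr_concept C y)"
| "tr_arole (RDomRan R C1 C2) x y =
     And (tr_arole R x y) (And (tr_concept C1 x) (tr_concept C2 y))"
| "tr_arole (RId C) x y = And (eqf x y) (tr_concept C x)"
| "tr_crole (PName T) x y = pairf x y (XCRole T)"
| "tr_crole (PNeg P) x y = And (And (inf1 x XAbs) (inf1 y XData)) (Neg (tr_crole P x y))"
| "tr_crole (PDom P C) x y = And (tr_crole P x y) (tr_concept C x)"
| "tr_crole (PRan P t) x y = And (tr_crole P x y) (tr_dterm t y)"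
| "tr_crole (PDomRan P C t) x y = And (tr_crole P x y) (And (tr_concept C x) (tr_dterm t y))"


subsection \<open>Statements\<close>

definition distinctf :: "'n var0 list \<Rightarrow> 'n qf list" where
  "distinctf xs = [Neg (eqf (xs ! i) (xs ! j)). j \<leftarrow> [0..<length xs], i \<leftarrow> [0..<j]]"

text \<open>\<open>Q 1, \<dots>, Q n\<close> are pairwise distinct, related to \<open>Q 0\<close> by \<open>r\<close>, and satisfy \<open>c\<close>.\<close>

definition succs :: "nat \<Rightarrow> ('n var0 \<Rightarrow> 'n var0 \<Rightarrow> 'n qf) \<Rightarrow> ('n var0 \<Rightarrow> 'n qf) \<Rightarrow> 'n qf list" where
  "succs n r c = [And (r (Q 0) (Q i)) (c (Q i)). i \<leftarrow> [1..<Suc n]] @ distinctf (map Q [1..<Suc n])"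

definition at_leastf :: "nat \<Rightarrow> ('n var0 \<Rightarrow> 'n var0 \<Rightarrow> 'n qf) \<Rightarrow> ('n var0 \<Rightarrow> 'n qf) \<Rightarrow> 'n concept
    \<Rightarrow> 'n dl_formula" where
  "at_leastf n r c C = allq n (Imp (bigand (inf1 (Q 0) XAbs # succs n r c)) (tr_concept C (Q 0)))"

definition at_mostf :: "'n concept \<Rightarrow> nat \<Rightarrow> ('n var0 \<Rightarrow> 'n var0 \<Rightarrow> 'n qf) \<Rightarrow> ('n var0 \<Rightarrow> 'n qf)
    \<Rightarrow> 'n dl_formula" where
  "at_mostf C n r c = allq (Suc n) (Neg (bigand (tr_concept C (Q 0) # succs (Suc n) r c)))"

definition functionalf :: "('n var0 \<Rightarrow> 'n var0 \<Rightarrow> 'n qf) \<Rightarrow> 'n dl_formula" where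
  "functionalf r = allq 2 (Imp (And (r (Q 0) (Q 1)) (r (Q 0) (Q 2))) (eqf (Q 1) (Q 2)))"

primrec tr_rstmt :: "'n rstmt \<Rightarrow> 'n dl_formula" where
  "tr_rstmt (REqv R1 R2) = allq 1 (Iff (tr_arole R1 (Q 0) (Q 1)) (tr_arole R2 (Q 0) (Q 1)))"
| "tr_rstmt (RSub R1 R2) = allq 1 (Imp (tr_arole R1 (Q 0) (Q 1)) (tr_arole R2 (Q 0) (Q 1)))"
| "tr_rstmt (RChain R1 Rs R) =
     allq (Suc (length Rs))
       (Imp (bigand [tr_arole ((R1 # Rs) ! i) (Q i) (Q (Suc i)). i \<leftarrow> [0..<Suc (length Rs)]])
            (tr_arole R (Q 0) (Q (Suc (length Rs)))))"
| "tr_rstmt (RSym R) = allq 1 (Imp (tr_arole (RInv R) (Q 0) (Q 1)) (tr_arole R (Q 0) (Q 1)))"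
| "tr_rstmt (RAsym R) =
     allq 1 (Neg (And (tr_arole R (Q 0) (Q 1)) (tr_arole (RInv R) (Q 0) (Q 1))))"
| "tr_rstmt (RRef R) = allq 0 (Imp (inf1 (Q 0) XAbs) (tr_arole R (Q 0) (Q 0)))"
| "tr_rstmt (RIrref R) = allq 0 (Neg (tr_arole R (Q 0) (Q 0)))"
| "tr_rstmt (RDis R1 R2) =
     allq 1 (Neg (And (tr_arole R1 (Q 0) (Q 1)) (tr_arole R2 (Q 0) (Q 1))))"
| "tr_rstmt (RTra R) =
     allq 2 (Imp (And (tr_arole R (Q 0) (Q 1)) (tr_arole R (Q 1) (Q 2))) (tr_arole R (Q 0) (Q 2)))"
| "tr_rstmt (RFun R) = functionalf (tr_arole R)"
| "tr_rstmt (PEqv P1 P2) = allq 1 (Iff (tr_crole P1 (Q 0) (Q 1)) (tr_crole P2 (Q 0) (Q 1)))"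
| "tr_rstmt (PSub P1 P2) = allq 1 (Imp (tr_crole P1 (Q 0) (Q 1)) (tr_crole P2 (Q 0) (Q 1)))"
| "tr_rstmt (PFun P) = functionalf (tr_crole P)"

primrec tr_tstmt :: "'n tstmt \<Rightarrow> 'n dl_formula" where
  "tr_tstmt (CEqv C1 C2) = allq 0 (Iff (tr_concept C1 (Q 0)) (tr_concept C2 (Q 0)))"
| "tr_tstmt (CSub C1 C2) = allq 0 (Imp (tr_concept C1 (Q 0)) (tr_concept C2 (Q 0)))"
| "tr_tstmt (CSubAll C1 R C2) =
     allq 1 (Imp (And (tr_concept C1 (Q 0)) (tr_arole R (Q 0) (Q 1))) (tr_concept C2 (Q 1)))"
| "tr_tstmt (ExSub R C1 C2) =
     allq 1 (Imp (And (tr_arole R (Q 0) (Q 1)) (tr_concept C1 (Q 1))) (tr_concept C2 (Q 0)))"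
| "tr_tstmt (AtLeastSub n R C1 C2) = at_leastf n (tr_arole R) (tr_concept C1) C2"
| "tr_tstmt (SubAtMost C1 n R C2) = at_mostf C1 n (tr_arole R) (tr_concept C2)"
| "tr_tstmt (TEqv t u) = allq 0 (Iff (tr_dterm t (Q 0)) (tr_dterm u (Q 0)))"
| "tr_tstmt (TSub t u) = allq 0 (Imp (tr_dterm t (Q 0)) (tr_dterm u (Q 0)))"
| "tr_tstmt (CSubAllP C P t) =
     allq 1 (Imp (And (tr_concept C (Q 0)) (tr_crole P (Q 0) (Q 1))) (tr_dterm t (Q 1)))"
| "tr_tstmt (ExPSub P t C) =
     allq 1 (Imp (And (tr_crole P (Q 0) (Q 1)) (tr_dterm t (Q 1))) (tr_concept C (Q 0)))"
| "tr_tstmt (AtLeastPSub n P t C) = at_leastf n (tr_crole P) (tr_dterm t) C"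
| "tr_tstmt (SubAtMostP C n P t) = at_mostf C n (tr_crole P) (tr_dterm t)"

primrec tr_astmt :: "'n astmt \<Rightarrow> 'n dl_formula" where
  "tr_astmt (AConc a C) = qfree (tr_concept C (XInd a))"
| "tr_astmt (ARole a b R) = qfree (tr_arole R (XInd a) (XInd b))"
| "tr_astmt (ANRole a b R) = qfree (Neg (tr_arole R (XInd a) (XInd b)))"
| "tr_astmt (AEq a b) = qfree (eqf (XInd a) (XInd b))"
| "tr_astmt (ANeq a b) = qfree (Neg (eqf (XInd a) (XInd b)))"
| "tr_astmt (ATerm d e t) = qfree (tr_dterm t (XConst d e))"
| "tr_astmt (ACRole a d e P) = qfree (tr_crole P (XInd a) (XConst d e))"
| "tr_astmt (ANCRole a d e P) = qfree (Neg (tr_crole P (XInd a) (XConst d e)))"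


subsection \<open>Domains and sorts of the symbols\<close>

definition domain_axioms :: "'n dl_formula list" where
  "domain_axioms =
     [Neg (allq 0 (Neg (inf1 (Q 0) XAbs))),
      Neg (allq 0 (Neg (inf1 (Q 0) XData))),
      allq 0 (Neg (And (inf1 (Q 0) XAbs) (inf1 (Q 0) XData)))]"

primrec sym_axiom :: "'n sym \<Rightarrow> 'n dl_formula" where
  "sym_axiom (SInd a) = qfree (inf1 (XInd a) XAbs)"
| "sym_axiom (SConcept A) = allq 0 (Imp (inf1 (Q 0) (XConcept A)) (inf1 (Q 0) XAbs))"
| "sym_axiom (SARole S) =
     allq 1 (Imp (pairf (Q 0) (Q 1) (XARole S)) (And (inf1 (Q 0) XAbs) (inf1 (Q 1) XAbs)))"
| "sym_axiom (SCRole T) =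
     allq 1 (Imp (pairf (Q 0) (Q 1) (XCRole T)) (And (inf1 (Q 0) XAbs) (inf1 (Q 1) XData)))"
| "sym_axiom (SPred p) = allq 0 (Imp (inf1 (Q 0) (XPred p)) (inf1 (Q 0) XData))"
| "sym_axiom (SConst d e) = qfree (inf1 (XConst d e) XData)"


subsection \<open>The datatype map\<close>

text \<open>
  Consistency is relative to the fixed datatype map \<open>D\<close>, so the formula has to record how the
  finitely many datatypes, facets and constants occurring in \<open>K\<close> are interpreted by \<open>D\<close>: which
  of them contain which constants, which constants denote the same value, and, for each of the
  regions into which these datatypes and facets divide the values of \<open>D\<close>, how many elements it
  has, up to a bound computed from \<open>K\<close>.  (For example, if \<open>\<not>T \<sqsubseteq> T\<close> and \<open>Fun(T)\<close> are the
  statements of \<open>K\<close>, then \<open>K\<close> is consistent iff \<open>D\<close> has at most one value.)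
\<close>

definition dpreds :: "'n kb \<Rightarrow> 'n dpred list" where
  "dpreds K = remdups [p. SPred p \<leftarrow> sy_kb K]"

definition kb_constants :: "'n kb \<Rightarrow> ('n \<times> 'n) list" where
  "kb_constants K = [(d, e). SConst d e \<leftarrow> sy_kb K]"

primrec dpredS :: "('n, 'v) datatype_map \<Rightarrow> 'n dpred \<Rightarrow> 'v set" where
  "dpredS D (Dt d) = dtI D d"
| "dpredS D (Fc d f) = facetI D d f"

text \<open>The values of \<open>D\<close> belonging to exactly those of the \<open>ps\<close> that are listed in \<open>S\<close>.\<close>

definition region :: "('n, 'v) datatype_map \<Rightarrow> 'n dpred list \<Rightarrow> 'n dpred list \<Rightarrow> 'v set" where
  "region D ps S = {v \<in> (\<Union>d\<in>ND D. dtI D d). \<forall>p\<in>set ps. v \<in> dpredS D p \<longleftrightarrow> p \<in> set S}"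

definition in_regionf :: "'n dpred list \<Rightarrow> 'n dpred list \<Rightarrow> 'n var0 \<Rightarrow> 'n qf" where
  "in_regionf ps S x =
     bigand (inf1 x XData #
             [if p \<in> set S then inf1 x (XPred p) else Neg (inf1 x (XPred p)). p \<leftarrow> ps])"

definition capped_card :: "nat \<Rightarrow> 'a set \<Rightarrow> nat" where
  "capped_card N A = (if finite A then min N (card A) else N)"

primrec tnum :: "'n tstmt \<Rightarrow> nat" where
  "tnum (CEqv C1 C2) = 0"
| "tnum (CSub C1 C2) = 0"
| "tnum (CSubAll C1 R C2) = 0"
| "tnum (ExSub R C1 C2) = 0"
| "tnum (AtLeastSub n R C1 C2) = n"
| "tnum (SubAtMost C1 n R C2) = n"
| "tnum (TEqv t u) = 0"
| "tnum (TSub t u) = 0"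
| "tnum (CSubAllP C P t) = 0"
| "tnum (ExPSub P t C) = 0"
| "tnum (AtLeastPSub n P t C) = n"
| "tnum (SubAtMostP C n P t) = n"

text \<open>
  With \<open>L - 1\<close> symbols in \<open>K\<close>, at most \<open>L\<close> abstract elements matter, and there are at most
  \<open>2 ^ (L * L)\<close> ways in which a value can be related to them by the concrete role names.  Any set
  of \<open>bound K\<close> values thus contains more than \<open>Suc n\<close> values that are not denoted by constants of
  \<open>K\<close> and are related to these elements in the same way, for every number \<open>n\<close> occurring in \<open>K\<close>.
\<close>

definition bound :: "'n kb \<Rightarrow> nat" where
  "bound K = (let L = Suc (length (sy_kb K)) in
     (sum_list (map tnum (tbox K)) + 2) * 2 ^ (L * L) + L)"

definition const_axioms :: "('n, 'v) datatype_map \<Rightarrow> 'n kb \<Rightarrow> 'n dl_formula list" where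
  "const_axioms D K =
     [qfree (in_regionf (dpreds K) (filter (\<lambda>p. constI D d e \<in> dpredS D p) (dpreds K)) (XConst d e)).
        (d, e) \<leftarrow> kb_constants K] @
     [qfree (if constI D d e = constI D d' e' then eqf (XConst d e) (XConst d' e')
             else Neg (eqf (XConst d e) (XConst d' e'))).
        (d, e) \<leftarrow> kb_constants K, (d', e') \<leftarrow> kb_constants K]"

definition region_axioms :: "('n, 'v) datatype_map \<Rightarrow> 'n kb \<Rightarrow> 'n dl_formula list" where
  "region_axioms D K =
     concat (map (\<lambda>S. let ws = map (XWit S) [0..<capped_card (bound K) (region D (dpreds K) S)]
                      in map qfree (map (in_regionf (dpreds K) S) ws @ distinctf ws))
                 (subseqs (dpreds K)))"

definition kb_formula :: "('n, 'v) datatype_map \<Rightarrow> 'n kb \<Rightarrow> 'n dl_formula" where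
  "kb_formula D K =
     bigand (domain_axioms @ map sym_axiom (sy_kb K) @ const_axioms D K @ region_axioms D K @
             map tr_rstmt (rbox K) @ map tr_tstmt (tbox K) @ map tr_astmt (abox K))"

end

theory Submission
  imports Defs
begin

text \<open>
  Apart from asserting that both domains are nonempty, the formula consists of quantifier-free and of
  purely universal formulae of level 1, so it passes to substructures.  A model of \<open>K\<close>, read as a
  4LQS interpretation over the disjoint union of its two domains, satisfies it, and so does the finite
  substructure given by the variables, which fits into every infinite type.

  Conversely, let \<open>M\<close> satisfy the formula.  Only the finitely many elements of \<open>M\<close> denoted by
  individuals of \<open>K\<close> (and one more, in case there are none) are kept as abstract domain, but the
  concrete domain must consist of all the values of \<open>D\<close>, of which \<open>M\<close> need not have enough copies.  In
  a region with fewer than \<open>bound K\<close> values there are enough of them.  In any other region, by the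
  pigeonhole principle, many of the witnesses in \<open>M\<close> are related to the abstract elements in the same
  way, and all values not denoted by constants are given that relation.  No global embedding
  into \<open>M\<close> results, but any number of values that a single statement can tell apart embeds, and this
  suffices for universal formulae.
\<close>


section \<open>Quantifier prefixes and partial isomorphisms\<close>

text \<open>No symbol of the formula relates two values: a true atom about a value is a membership
  in a predicate or in \<open>XData\<close>, a concrete role between an abstract element and the
  value, or an equality. So its predicates and its relation to the finitely many abstract elements
  (\<open>rtype\<close>) determine everything about a value except equality. This is why
  \<open>data_map\<close> may send many values to one witness: for each small finite set of values
  an injective \<open>h\<close> with the same types is chosen afresh, and it settles equality for
  the tuple at hand. How small depends on the number of variables of a statement, at most
  \<open>tnum s + 3\<close>; hence \<open>max_num\<close>. Role chains have arbitrarily many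
  variables, but a tuple violating a chain consists of abstract elements, all of which are kept. For
  their sake \<open>allq_transfer\<close> asks only violating tuples to be embedded. Values denoted
  by constants have prescribed images in every \<open>h\<close>, so they are set aside before the
  pigeonhole principle is applied; the last summand of \<open>bound\<close> pays for them.\<close>

lemma psat_cong: "(\<And>a. a \<in> set_pform p \<Longrightarrow> s a = t a) \<Longrightarrow> psat s p = psat t p"
  by (induction p) auto

lemma psat_map_pform: "psat s (map_pform g p) = psat (s \<circ> g) p"
  by (induction p) auto

lemma psat_qfree [simp]: "psat (sat_comp3 M) (qfree p) = psat (sat_atom0 M) p"
  unfolding qfree_def psat_map_pform by (intro psat_cong) simp

lemma psat_bigand: "ps \<noteq> [] \<Longrightarrow> psat s (bigand ps) \<longleftrightarrow> (\<forall>p\<in>set ps. psat s p)"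
  by (induction ps rule: bigand.induct) auto

lemma psat_bigor: "ps \<noteq> [] \<Longrightarrow> psat s (bigor ps) \<longleftrightarrow> (\<exists>p\<in>set ps. psat s p)"
  by (induction ps rule: bigor.induct) auto

lemma set_pform_bigand: "ps \<noteq> [] \<Longrightarrow> set_pform (bigand ps) = (\<Union>p\<in>set ps. set_pform p)"
  by (induction ps rule: bigand.induct) auto

lemma set_pform_bigor: "ps \<noteq> [] \<Longrightarrow> set_pform (bigor ps) = (\<Union>p\<in>set ps. set_pform p)"
  by (induction ps rule: bigor.induct) auto

text \<open>The recursive form changes one variable at a time. A single simultaneous assignment
  \<open>f\<close> can be composed with a map between structures, which is how formulae are
  transferred below.\<close>

lemma all0_iff:
  "distinct zs \<Longrightarrow> all0 zs P M \<longleftrightarrow>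
     (\<forall>f. (\<forall>z\<in>set zs. f z \<in> dmn M) \<longrightarrow> P (M\<lparr>v0 := override_on (v0 M) f (set zs)\<rparr>))"
proof (induction zs arbitrary: M)
  case Nil
  then show ?case by simp
next
  case (Cons z zs)
  let ?ov = "\<lambda>\<nu> f. override_on \<nu> f (set zs)"
  have IH: "all0 zs P (M\<lparr>v0 := (v0 M)(z := u)\<rparr>) \<longleftrightarrow>
     (\<forall>f. (\<forall>z\<in>set zs. f z \<in> dmn M) \<longrightarrow> P (M\<lparr>v0 := ?ov ((v0 M)(z := u)) f\<rparr>))" for u
    using Cons by simp
  have ov: "override_on (v0 M) f (set (z # zs)) = ?ov ((v0 M)(z := f z)) f" for f
    using Cons.prems by (auto simp: override_on_def fun_eq_iff)
  have ov': "?ov ((v0 M)(z := u)) f = override_on (v0 M) (f(z := u)) (set (z # zs))" for f u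
    using Cons.prems by (auto simp: override_on_def fun_eq_iff)
  show ?case
  proof
    assume "all0 (z # zs) P M"
    then show "\<forall>f. (\<forall>z\<in>set (z # zs). f z \<in> dmn M) \<longrightarrow>
        P (M\<lparr>v0 := override_on (v0 M) f (set (z # zs))\<rparr>)"
      unfolding ov by (simp add: IH)
  next
    assume *: "\<forall>f. (\<forall>z\<in>set (z # zs). f z \<in> dmn M) \<longrightarrow>
        P (M\<lparr>v0 := override_on (v0 M) f (set (z # zs))\<rparr>)"
    show "all0 (z # zs) P M"
      unfolding all0.simps IH ov'
    proof (intro ballI allI impI)
      fix u f assume "u \<in> dmn M" "\<forall>z\<in>set zs. f z \<in> dmn M"
      then show "P (M\<lparr>v0 := override_on (v0 M) (f(z := u)) (set (z # zs))\<rparr>)"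
        by (intro *[rule_format]) auto
    qed
  qed
qed

lemma psat_allq:
  fixes p :: "'n qf"
  shows "psat (sat_comp3 M) (allq k p) \<longleftrightarrow>
     (\<forall>f. (\<forall>i\<le>k. f (Q i) \<in> dmn M) \<longrightarrow>
        psat (sat_atom0 (M\<lparr>v0 := override_on (v0 M) f (Q ` {..k})\<rparr>)) p)"
proof -
  have d: "distinct (map (Q :: nat \<Rightarrow> 'n var0) [0..<Suc k])"
    by (auto simp: distinct_map inj_on_def)
  have s: "set (map (Q :: nat \<Rightarrow> 'n var0) [0..<Suc k]) = Q ` {..k}"
    by (simp only: set_map set_upt atLeast0LessThan lessThan_Suc_atMost)
  have b: "(\<forall>x\<in>Q ` {..k}. f x \<in> dmn M) \<longleftrightarrow> (\<forall>i\<le>k. f (Q i) \<in> dmn M)"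
    for f :: "'n var0 \<Rightarrow> _"
    by auto
  show ?thesis
    unfolding allq_def psat.simps sat_comp3.simps sat_univ1.simps all0_iff[OF d] s b ..
qed

primrec on1 :: "'n sym set \<Rightarrow> 'n var1 \<Rightarrow> bool" where
  "on1 Sy (XConcept A) = (SConcept A \<in> Sy)"
| "on1 Sy (XPred p) = (SPred p \<in> Sy)"
| "on1 Sy XAbs = True"
| "on1 Sy XData = True"

primrec on3 :: "'n sym set \<Rightarrow> 'n var3 \<Rightarrow> bool" where
  "on3 Sy (XARole S) = (SARole S \<in> Sy)"
| "on3 Sy (XCRole T) = (SCRole T \<in> Sy)"

text \<open>The translation never produces \<open>PairEq\<close>. Excluding it here frees partial
  isomorphisms from any condition on sort 2.\<close>

primrec atom_over :: "'n sym set \<Rightarrow> 'n var0 set \<Rightarrow> ('n var0, 'n var1, nat, 'n var3) atom0 \<Rightarrow> bool"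
where
  "atom_over Sy X (Eq0 x y) = (x \<in> X \<and> y \<in> X)"
| "atom_over Sy X (In01 x Y) = (x \<in> X \<and> on1 Sy Y)"
| "atom_over Sy X (PairEq x y Z) = False"
| "atom_over Sy X (PairIn x y W) = (x \<in> X \<and> y \<in> X \<and> on3 Sy W)"

definition over :: "'n sym set \<Rightarrow> 'n var0 set \<Rightarrow> 'n qf \<Rightarrow> bool" where
  "over Sy X p \<longleftrightarrow> (\<forall>a\<in>set_pform p. atom_over Sy X a)"

lemma over_simps [simp]:
  "over Sy X (Atom a) = atom_over Sy X a"
  "over Sy X (Neg p) = over Sy X p"
  "over Sy X (And p q) = (over Sy X p \<and> over Sy X q)"
  "over Sy X (Or p q) = (over Sy X p \<and> over Sy X q)"
  by (auto simp: over_def)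

lemma over_bigand: "ps \<noteq> [] \<Longrightarrow> over Sy X (bigand ps) \<longleftrightarrow> (\<forall>p\<in>set ps. over Sy X p)"
  by (auto simp: over_def set_pform_bigand)

lemma over_bigor: "ps \<noteq> [] \<Longrightarrow> over Sy X (bigor ps) \<longleftrightarrow> (\<forall>p\<in>set ps. over Sy X p)"
  by (auto simp: over_def set_pform_bigor)

lemma kpair_eq_iff [simp]: "kpair a b = kpair c d \<longleftrightarrow> a = c \<and> b = d"
  by (auto simp: kpair_def doubleton_eq_iff)

text \<open>The domain \<open>E\<close> may be a proper subset of \<open>dmn M1\<close>, so that
  maps defined on only a few values qualify. Injectivity accounts for equality atoms, and
  \<open>X\<close> holds the free variables, whose values must lie in \<open>E\<close> and
  correspond.\<close>

definition partial_iso :: "'n sym set \<Rightarrow> 'n var0 set \<Rightarrow> ('a, 'n var0, 'n var1, nat, 'n var3) lqs_interp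
    \<Rightarrow> ('b, 'n var0, 'n var1, nat, 'n var3) lqs_interp \<Rightarrow> 'a set \<Rightarrow> ('a \<Rightarrow> 'b) \<Rightarrow> bool" where
  "partial_iso Sy X M1 M2 E h \<longleftrightarrow>
     inj_on h E \<and> h ` E \<subseteq> dmn M2 \<and>
     (\<forall>x\<in>X. v0 M1 x \<in> E \<and> v0 M2 x = h (v0 M1 x)) \<and>
     (\<forall>u\<in>E. \<forall>Y. on1 Sy Y \<longrightarrow> (u \<in> v1 M1 Y \<longleftrightarrow> h u \<in> v1 M2 Y)) \<and>
     (\<forall>u\<in>E. \<forall>w\<in>E. \<forall>W. on3 Sy W \<longrightarrow> (kpair u w \<in> v3 M1 W \<longleftrightarrow> kpair (h u) (h w) \<in> v3 M2 W))"

lemma partial_iso_psat: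
  assumes "partial_iso Sy X M1 M2 E h" and "over Sy X p"
  shows "psat (sat_atom0 M1) p = psat (sat_atom0 M2) p"
proof (rule psat_cong)
  fix a assume "a \<in> set_pform p"
  then have "atom_over Sy X a" using assms(2) by (simp add: over_def)
  then show "sat_atom0 M1 a = sat_atom0 M2 a"
    using assms(1) by (cases a) (auto simp: partial_iso_def inj_on_eq_iff)
qed

lemma partial_iso_override:
  assumes "partial_iso Sy X M1 M2 E h" and "f ` Z \<subseteq> E"
  shows "partial_iso Sy (X \<union> Z) (M1\<lparr>v0 := override_on (v0 M1) f Z\<rparr>)
           (M2\<lparr>v0 := override_on (v0 M2) (h \<circ> f) Z\<rparr>) E h"
  using assms by (auto simp: partial_iso_def override_on_def)

text \<open>A violating tuple in \<open>M1\<close> would be carried by \<open>h\<close> to a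
  violating tuple in \<open>M2\<close>. Both \<open>E\<close> and \<open>h\<close> may depend on the
  tuple, so no global embedding is required, and only tuples that violate \<open>p\<close> have to
  be covered.\<close>

lemma allq_transfer:
  assumes M2: "psat (sat_comp3 M2) (allq k p)"
    and p: "over Sy (X \<union> Q ` {..k}) p"
    and iso: "\<And>f. (\<And>i. i \<le> k \<Longrightarrow> f (Q i) \<in> dmn M1) \<Longrightarrow>
        \<not> psat (sat_atom0 (M1\<lparr>v0 := override_on (v0 M1) f (Q ` {..k})\<rparr>)) p \<Longrightarrow>
        \<exists>E h. partial_iso Sy X M1 M2 E h \<and> f ` Q ` {..k} \<subseteq> E"
  shows "psat (sat_comp3 M1) (allq k p)"
  unfolding psat_allq
proof (intro allI impI, rule ccontr)
  fix f assume f: "\<forall>i\<le>k. f (Q i) \<in> dmn M1"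
    and neg: "\<not> psat (sat_atom0 (M1\<lparr>v0 := override_on (v0 M1) f (Q ` {..k})\<rparr>)) p"
  from iso[of f] f neg obtain E h where E: "partial_iso Sy X M1 M2 E h" "f ` Q ` {..k} \<subseteq> E"
    by blast
  have "\<forall>i\<le>k. (h \<circ> f) (Q i) \<in> dmn M2"
    using E by (auto simp: partial_iso_def)
  then have "psat (sat_atom0 (M2\<lparr>v0 := override_on (v0 M2) (h \<circ> f) (Q ` {..k})\<rparr>)) p"
    using M2 unfolding psat_allq by blast
  then show False
    using neg partial_iso_psat[OF partial_iso_override[OF E] p] by simp
qed

section \<open>The variables and symbols of the translation\<close>

definition named :: "'n sym set \<Rightarrow> 'n var0 set" where
  "named Sy = {XInd a | a. SInd a \<in> Sy} \<union> {XConst d e | d e. SConst d e \<in> Sy}"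

lemma finite_named: "finite Sy \<Longrightarrow> finite (named Sy)"
proof -
  assume "finite Sy"
  let ?g = "\<lambda>s. case s of SInd a \<Rightarrow> XInd a | SConst d e \<Rightarrow> XConst d e | _ \<Rightarrow> Q 0"
  have "named Sy \<subseteq> ?g ` Sy"
    by (force simp: named_def image_iff)
  then show ?thesis using \<open>finite Sy\<close> by (meson finite_imageI finite_subset)
qed

lemma in_named:
  "named Sy \<subseteq> X \<Longrightarrow> SInd a \<in> Sy \<Longrightarrow> XInd a \<in> X"
  "named Sy \<subseteq> X \<Longrightarrow> SConst d e \<in> Sy \<Longrightarrow> XConst d e \<in> X"
  by (auto simp: named_def)

lemma over_tr_fexpr:
  "\<lbrakk>set (sy_fexpr d p) \<subseteq> Sy; SPred (Dt d) \<in> Sy; x \<in> X\<rbrakk> \<Longrightarrow> over Sy X (tr_fexpr d p x)"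
  by (induction p) (auto simp: ff_def)

lemma over_tr_brange:
  assumes "set (sy_brange r) \<subseteq> Sy" and "named Sy \<subseteq> X" and "x \<in> X"
  shows "over Sy X (tr_brange r x)"
proof (cases r)
  case (DEnum es)
  have "XConst d e \<in> X" if "(d, e) \<in> set es" for d e
    using that assms DEnum by (force simp: sy_const_def intro: in_named(2)[of Sy])
  then show ?thesis
    using assms DEnum by (auto simp: over_bigor ff_def)
qed (use assms in \<open>auto simp: over_tr_fexpr\<close>)

lemma over_tr_drange:
  "\<lbrakk>set (sy_drange r) \<subseteq> Sy; named Sy \<subseteq> X; x \<in> X\<rbrakk> \<Longrightarrow> over Sy X (tr_drange r x)"
  by (cases r) (auto simp: over_tr_brange)

lemma over_tr_dterm:
  "\<lbrakk>set (sy_dterm t) \<subseteq> Sy; named Sy \<subseteq> X; x \<in> X\<rbrakk> \<Longrightarrow> over Sy X (tr_dterm t x)"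
  by (induction t) (auto simp: over_tr_drange sy_const_def in_named)

lemma over_tr_terms:
  "\<lbrakk>named Sy \<subseteq> X; set (sy_concept C) \<subseteq> Sy; x \<in> X\<rbrakk> \<Longrightarrow> over Sy X (tr_concept C x)"
  "\<lbrakk>named Sy \<subseteq> X; set (sy_arole R) \<subseteq> Sy; x \<in> X; y \<in> X\<rbrakk> \<Longrightarrow> over Sy X (tr_arole R x y)"
  "\<lbrakk>named Sy \<subseteq> X; set (sy_crole P) \<subseteq> Sy; x \<in> X; y \<in> X\<rbrakk> \<Longrightarrow> over Sy X (tr_crole P x y)"
proof (induction C and R and P arbitrary: x and x y and x y)
qed (auto simp: over_tr_dterm ff_def sy_const_def in_named)

text \<open>\<open>allq k\<close> binds the \<open>k + 1\<close> variables \<open>Q 0\<close>, ...,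
  \<open>Q k\<close>, so \<open>k < n\<close> means that at most \<open>n\<close> variables are
  quantified.\<close>

definition univ_over :: "'n sym set \<Rightarrow> 'n var0 set \<Rightarrow> nat \<Rightarrow> 'n dl_formula \<Rightarrow> bool" where
  "univ_over Sy X n g \<longleftrightarrow> (\<exists>p. g = qfree p \<and> over Sy X p) \<or>
     (\<exists>k<n. \<exists>p. g = allq k p \<and> over Sy (X \<union> Q ` {..k}) p)"

lemma univ_over_qfree: "over Sy X p \<Longrightarrow> univ_over Sy X n (qfree p)"
  by (auto simp: univ_over_def)

lemma univ_over_allq:
  "\<lbrakk>k < n; over Sy (X \<union> Q ` {..k}) p\<rbrakk> \<Longrightarrow> univ_over Sy X n (allq k p)"
  unfolding univ_over_def by blast

lemma Q_in_override_set: "i \<le> k \<Longrightarrow> Q i \<in> X \<union> Q ` {..k}"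
  by simp

lemmas over_intros = over_tr_terms over_tr_dterm Q_in_override_set

lemma over_succs:
  assumes "\<And>i. i \<le> n \<Longrightarrow> Q i \<in> X"
    and "\<And>x y. x \<in> X \<Longrightarrow> y \<in> X \<Longrightarrow> over Sy X (r x y)"
    and "\<And>x. x \<in> X \<Longrightarrow> over Sy X (c x)"
    and "p \<in> set (succs n r c)"
  shows "over Sy X p"
  using assms(4)
  by (auto simp: succs_def distinctf_def nth_append assms simp del: upt_Suc)

text \<open>Transitivity and functionality need three variables, the other statements at most two.
  Chains have no uniform bound and are treated separately.\<close>

lemma univ_over_tr_rstmt:
  assumes "named Sy \<subseteq> X" and "set (sy_rstmt s) \<subseteq> Sy" and "\<nexists>R1 Rs R. s = RChain R1 Rs R"
  shows "univ_over Sy X 3 (tr_rstmt s)"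
  using assms by (cases s) (auto intro!: univ_over_allq over_intros simp: functionalf_def)

lemma over_chain:
  assumes "named Sy \<subseteq> X" and "set (sy_rstmt (RChain R1 Rs R)) \<subseteq> Sy"
    and "\<And>i. i \<le> Suc (length Rs) \<Longrightarrow> Q i \<in> X"
  shows "over Sy X (Imp (bigand [tr_arole ((R1 # Rs) ! i) (Q i) (Q (Suc i)). i \<leftarrow> [0..<Suc (length Rs)]])
            (tr_arole R (Q 0) (Q (Suc (length Rs)))))"
proof -
  have "set (sy_arole ((R1 # Rs) ! i)) \<subseteq> Sy" if "i < Suc (length Rs)" for i
  proof -
    have "(R1 # Rs) ! i \<in> set (R1 # Rs)" using that by (intro nth_mem) simp
    then show ?thesis using assms(2) by auto
  qed
  then have "\<forall>i<Suc (length Rs). over Sy X (tr_arole ((R1 # Rs) ! i) (Q i) (Q (Suc i)))"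
    using assms by (intro allI impI over_tr_terms) auto
  moreover have "over Sy X (tr_arole R (Q 0) (Q (Suc (length Rs))))"
    using assms by (intro over_tr_terms) auto
  ultimately show ?thesis
    by (simp add: over_bigand del: upt_Suc)
qed

text \<open>The largest case is \<open>at_mostf\<close>: for the number \<open>n\<close> it has
  \<open>n + 2\<close> variables, the element \<open>Q 0\<close> and \<open>n + 1\<close> pairwise
  distinct successors.\<close>

lemma univ_over_tr_tstmt:
  assumes "named Sy \<subseteq> X" and "set (sy_tstmt s) \<subseteq> Sy"
  shows "univ_over Sy X (tnum s + 3) (tr_tstmt s)"
  using assms
  by (cases s) (auto intro!: univ_over_allq over_intros
      simp: over_bigand at_leastf_def at_mostf_def elim!: over_succs[rotated -1])

lemma univ_over_tr_astmt:
  assumes "named Sy \<subseteq> X" and "set (sy_astmt s) \<subseteq> Sy"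
  shows "univ_over Sy X n (tr_astmt s)"
  using assms
  by (cases s) (auto intro!: univ_over_qfree over_intros simp: sy_const_def in_named)


section \<open>Description logic interpretations as 4LQS interpretations\<close>

text \<open>The parameter \<open>wit\<close> interprets the witness variables. The result need not
  satisfy \<open>is_lqs_interp\<close>, since variables foreign to the knowledge base may leave the
  domain; \<open>finite_submodel\<close> corrects this.\<close>

definition dl_lqs :: "('n, 'v) datatype_map \<Rightarrow> ('n, 'i, 'v) dl_interp \<Rightarrow> ('n dpred list \<Rightarrow> nat \<Rightarrow> 'v)
    \<Rightarrow> ('i + 'v, 'n var0, 'n var1, nat, 'n var3) lqs_interp" where
  "dl_lqs D I wit =
     \<lparr>dmn = Inl ` aDom I \<union> Inr ` dDom I,
      v0 = (\<lambda>x. case x of XInd a \<Rightarrow> Inl (indI I a) | XConst d e \<Rightarrow> Inr (constI D d e)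
                | XWit S j \<Rightarrow> Inr (wit S j) | Q i \<Rightarrow> undefined),
      v1 = (\<lambda>Y. case Y of XConcept A \<Rightarrow> Inl ` conceptI I A | XPred p \<Rightarrow> Inr ` dpredS D p
                | XAbs \<Rightarrow> Inl ` aDom I | XData \<Rightarrow> Inr ` dDom I),
      v2 = (\<lambda>_. {}),
      v3 = (\<lambda>W. case W of XARole S \<Rightarrow> {kpair (Inl a) (Inl b) | a b. (a, b) \<in> aroleI I S}
                | XCRole T \<Rightarrow> {kpair (Inl a) (Inr v) | a v. (a, v) \<in> croleI I T})\<rparr>"

lemma dl_lqs_simps [simp]:
  "dmn (dl_lqs D I wit) = Inl ` aDom I \<union> Inr ` dDom I"
  "v0 (dl_lqs D I wit) (XInd a) = Inl (indI I a)"
  "v0 (dl_lqs D I wit) (XConst d e) = Inr (constI D d e)"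
  "v0 (dl_lqs D I wit) (XWit S j) = Inr (wit S j)"
  "v1 (dl_lqs D I wit) (XConcept A) = Inl ` conceptI I A"
  "v1 (dl_lqs D I wit) (XPred p) = Inr ` dpredS D p"
  "v1 (dl_lqs D I wit) XAbs = Inl ` aDom I"
  "v1 (dl_lqs D I wit) XData = Inr ` dDom I"
  by (auto simp: dl_lqs_def)

lemma kpair_in_dl_lqs [simp]:
  "kpair u w \<in> v3 (dl_lqs D I wit) (XARole S) \<longleftrightarrow> (\<exists>a b. u = Inl a \<and> w = Inl b \<and> (a, b) \<in> aroleI I S)"
  "kpair u w \<in> v3 (dl_lqs D I wit) (XCRole T) \<longleftrightarrow> (\<exists>a v. u = Inl a \<and> w = Inr v \<and> (a, v) \<in> croleI I T)"
  by (auto simp: dl_lqs_def)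

lemma terms_in_domain:
  fixes I :: "('n, 'i, 'v) dl_interp"
  assumes "is_dl_interp D I"
  shows "conceptS D I C \<subseteq> aDom I"
    and "aroleS D I R \<subseteq> aDom I \<times> aDom I"
    and "croleS D I P \<subseteq> aDom I \<times> dDom I"
  using assms
  by (induction C and R and P) (auto simp: is_dl_interp_def)

locale dl_model =
  fixes D :: "('n, 'v) datatype_map" and I :: "('n, 'i, 'v) dl_interp"
    and wit :: "'n dpred list \<Rightarrow> nat \<Rightarrow> 'v"
  assumes interp: "is_dl_interp D I"
begin

text \<open>The class of assignments for which translated terms mean what they should: names are
  read as in \<open>I\<close> and \<open>D\<close>, everything else is free. Assigning to variables
  \<open>Q i\<close> stays inside the class.\<close>

definition val :: "('n var0 \<Rightarrow> 'i + 'v) \<Rightarrow> bool" where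
  "val \<nu> \<longleftrightarrow> (\<forall>a. \<nu> (XInd a) = Inl (indI I a)) \<and> (\<forall>d e. \<nu> (XConst d e) = Inr (constI D d e))"

abbreviation sat0 :: "('n var0 \<Rightarrow> 'i + 'v) \<Rightarrow> 'n qf \<Rightarrow> bool" where
  "sat0 \<nu> \<equiv> psat (sat_atom0 ((dl_lqs D I wit)\<lparr>v0 := \<nu>\<rparr>))"

abbreviation sat :: "'n dl_formula \<Rightarrow> bool" where
  "sat \<equiv> psat (sat_comp3 (dl_lqs D I wit))"

lemma val_v0 [simp]: "val (v0 (dl_lqs D I wit))"
  by (simp add: val_def)

lemma val_override_on [simp]: "val \<nu> \<Longrightarrow> val (override_on \<nu> f (Q ` A))"
  by (auto simp: val_def override_on_def)

lemma sat_fexpr [simp]: "sat0 \<nu> (tr_fexpr d p x) \<longleftrightarrow> (\<exists>v. \<nu> x = Inr v \<and> v \<in> fexprS D d p)"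
  by (induction p) (auto simp: ff_def)

lemma sat_brange [simp]:
  assumes "val \<nu>"
  shows "sat0 \<nu> (tr_brange r x) \<longleftrightarrow> (\<exists>v. \<nu> x = Inr v \<and> v \<in> brangeS D r)"
proof (cases r)
  case (DEnum es)
  have "sat0 \<nu> (tr_brange r x) \<longleftrightarrow> (\<exists>(d, e)\<in>set es. \<nu> x = Inr (constI D d e))"
    using assms unfolding DEnum by (simp add: psat_bigor ff_def case_prod_unfold val_def)
  also have "\<dots> \<longleftrightarrow> (\<exists>v. \<nu> x = Inr v \<and> v \<in> brangeS D r)"
    unfolding DEnum by auto
  finally show ?thesis .
qed auto

lemma sat_drange [simp]:
  "val \<nu> \<Longrightarrow> sat0 \<nu> (tr_drange r x) \<longleftrightarrow> (\<exists>v. \<nu> x = Inr v \<and> v \<in> drangeS D (dDom I) r)"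
  by (cases r) auto

lemma sat_dterm [simp]:
  "val \<nu> \<Longrightarrow> sat0 \<nu> (tr_dterm t x) \<longleftrightarrow> (\<exists>v. \<nu> x = Inr v \<and> v \<in> dtermS D (dDom I) t)"
  by (induction t) (auto simp: val_def)

lemma sat_terms [simp]:
  "val \<nu> \<Longrightarrow> sat0 \<nu> (tr_concept C x) \<longleftrightarrow> (\<exists>a. \<nu> x = Inl a \<and> a \<in> conceptS D I C)"
  "val \<nu> \<Longrightarrow> sat0 \<nu> (tr_arole R x y) \<longleftrightarrow> (\<exists>a b. \<nu> x = Inl a \<and> \<nu> y = Inl b \<and> (a, b) \<in> aroleS D I R)"
  "val \<nu> \<Longrightarrow> sat0 \<nu> (tr_crole P x y) \<longleftrightarrow> (\<exists>a v. \<nu> x = Inl a \<and> \<nu> y = Inr v \<and> (a, v) \<in> croleS D I P)"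
proof (induction C and R and P arbitrary: x and x y and x y)
  \<comment> \<open>The semantics restricts to \<open>aDom I\<close> where the translation has no
    such guard. Roles lie inside the domain, so the two agree; likewise in the next two
    cases.\<close>
  case (CSelf R)
  then show ?case using terms_in_domain(2)[OF interp, of R] by auto
next
  case (CExInd R a)
  then show ?case using terms_in_domain(2)[OF interp, of R] by (auto simp: val_def)
next
  case (CExConst P d e)
  then show ?case using terms_in_domain(3)[OF interp, of P] by (auto simp: val_def)
qed (auto simp: ff_def val_def)

end


section \<open>Cardinalities as injections, role compositions as paths\<close>

lemma card_ge_iff_inj_on:
  "infinite A \<or> n \<le> card A \<longleftrightarrow> (\<exists>f. inj_on f {1..n} \<and> f ` {1..n} \<subseteq> A)"
proof
  assume "infinite A \<or> n \<le> card A"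
  then obtain B where "B \<subseteq> A" "finite B" "card B = n"
    by (metis infinite_arbitrarily_large obtain_subset_with_card_n)
  then obtain f where "bij_betw f {1..n} B"
    using finite_same_card_bij[of "{1..n}" B] by auto
  with \<open>B \<subseteq> A\<close> show "\<exists>f. inj_on f {1..n} \<and> f ` {1..n} \<subseteq> A"
    by (auto simp: bij_betw_def)
next
  assume "\<exists>f. inj_on f {1..n} \<and> f ` {1..n} \<subseteq> A"
  then show "infinite A \<or> n \<le> card A"
    by (metis card_atLeastAtMost card_inj_on_le diff_Suc_1)
qed

text \<open>The node \<open>g i\<close> of the path is what the variable \<open>Q i\<close> denotes
  in the translation of a chain.\<close>

lemma chain_iff:
  "(a, b) \<in> chain r rs \<longleftrightarrow>
     (\<exists>g. g 0 = a \<and> g (Suc (length rs)) = b \<and> (\<forall>i<Suc (length rs). (g i, g (Suc i)) \<in> (r # rs) ! i))"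
proof (induction rs arbitrary: r a)
  case Nil
  show ?case
  proof
    assume "(a, b) \<in> chain r []"
    then show "\<exists>g. g 0 = a \<and> g (Suc (length [])) = b \<and> (\<forall>i<Suc (length []). (g i, g (Suc i)) \<in> [r] ! i)"
      by (intro exI[of _ "case_nat a (\<lambda>_. b)"]) simp
  qed auto
next
  case (Cons s ss)
  show ?case (is "_ \<longleftrightarrow> ?R")
  proof
    assume "(a, b) \<in> chain r (s # ss)"
    then obtain c where c: "(a, c) \<in> r" "(c, b) \<in> chain s ss" by auto
    from c(2)[unfolded Cons.IH] obtain g where "g 0 = c" "g (Suc (length ss)) = b"
      "\<forall>i<Suc (length ss). (g i, g (Suc i)) \<in> (s # ss) ! i" by blast
    with c show ?R
      by (intro exI[of _ "case_nat a g"]) (auto simp: less_Suc_eq_0_disj)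
  next
    assume ?R
    then obtain g where g: "g 0 = a" "g (Suc (length (s # ss))) = b"
      "\<forall>i<Suc (length (s # ss)). (g i, g (Suc i)) \<in> (r # s # ss) ! i" by blast
    have "(g 1, b) \<in> chain s ss"
      unfolding Cons.IH using g by (intro exI[of _ "g \<circ> Suc"]) force
    moreover have "(a, g 1) \<in> r"
      using g(1) g(3)[rule_format, of 0] by simp
    ultimately show "(a, b) \<in> chain r (s # ss)" by auto
  qed
qed

lemma psat_succs:
  "(\<forall>p\<in>set (succs n r c). psat (sat_atom0 M) p) \<longleftrightarrow>
     (\<forall>i\<in>{1..n}. psat (sat_atom0 M) (r (Q 0) (Q i)) \<and> psat (sat_atom0 M) (c (Q i))) \<and>
     inj_on (\<lambda>i. v0 M (Q i)) {1..n}" (is "?L \<longleftrightarrow> ?A \<and> ?B")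
proof -
  have "?L \<longleftrightarrow> ?A \<and> (\<forall>j<n. \<forall>i<j. v0 M (Q (Suc i)) \<noteq> v0 M (Q (Suc j)))"
    by (auto simp: succs_def distinctf_def ball_Un less_Suc_eq_le simp del: upt_Suc)
  moreover have "(\<forall>j<n. \<forall>i<j. v0 M (Q (Suc i)) \<noteq> v0 M (Q (Suc j))) \<longleftrightarrow> ?B" (is "?D \<longleftrightarrow> ?B")
  proof
    assume D: ?D
    show ?B
    proof (rule linorder_inj_onI')
      fix i j assume "i \<in> {1..n}" "j \<in> {1..n}" "i < j"
      \<comment> \<open>The list in \<open>succs\<close> starts with \<open>Q 1\<close>, so
        \<open>Q i\<close> stands at index \<open>i - 1\<close>.\<close>
      then show "v0 M (Q i) \<noteq> v0 M (Q j)"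
        using D[rule_format, of "j - 1" "i - 1"] by simp
    qed
  next
    assume ?B
    then show ?D by (fastforce dest: inj_onD)
  qed
  ultimately show ?thesis by blast
qed

context dl_model
begin

lemma val_fun_upd [simp]: "val \<nu> \<Longrightarrow> val (\<nu>(Q i := u))"
  by (auto simp: val_def)

lemma override_Q: "i \<le> n \<Longrightarrow> override_on \<nu> f (Q ` {..n}) (Q i) = f (Q i)"
  by (simp add: override_on_def)

lemma ball_dmn:
  "(\<forall>u\<in>dmn (dl_lqs D I wit). P u) \<longleftrightarrow> (\<forall>a\<in>aDom I. P (Inl a)) \<and> (\<forall>v\<in>dDom I. P (Inr v))"
  by auto

text \<open>For up to three variables, explicit updates let simplification evaluate the matrix
  directly. Longer prefixes go through \<open>psat_allq\<close>.\<close>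

lemma sat_allq_small:
  "sat (allq 0 p) \<longleftrightarrow> (\<forall>u\<in>dmn (dl_lqs D I wit). sat0 ((v0 (dl_lqs D I wit))(Q 0 := u)) p)"
  "sat (allq 1 p) \<longleftrightarrow> (\<forall>u\<in>dmn (dl_lqs D I wit). \<forall>w\<in>dmn (dl_lqs D I wit).
     sat0 ((v0 (dl_lqs D I wit))(Q 0 := u, Q 1 := w)) p)"
  "sat (allq 2 p) \<longleftrightarrow> (\<forall>u\<in>dmn (dl_lqs D I wit). \<forall>w\<in>dmn (dl_lqs D I wit). \<forall>z\<in>dmn (dl_lqs D I wit).
     sat0 ((v0 (dl_lqs D I wit))(Q 0 := u, Q 1 := w, Q 2 := z)) p)"
  by (simp_all add: allq_def numeral_2_eq_2)

text \<open>The map \<iota> is \<open>Inl\<close> for abstract and \<open>Inr\<close> for concrete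
  roles, so one proof serves both.\<close>

lemma sat_functionalf:
  fixes rel :: "('i \<times> 'b) set" and \<iota> :: "'b \<Rightarrow> 'i + 'v"
  assumes r: "\<And>\<nu> x y. val \<nu> \<Longrightarrow>
      sat0 \<nu> (r x y) \<longleftrightarrow> (\<exists>a b. \<nu> x = Inl a \<and> \<nu> y = \<iota> b \<and> (a, b) \<in> rel)"
    and inj: "inj \<iota>"
    and dom: "\<And>a b. (a, b) \<in> rel \<Longrightarrow> a \<in> aDom I"
    and ran: "\<And>a b. (a, b) \<in> rel \<Longrightarrow> \<iota> b \<in> dmn (dl_lqs D I wit)"
  shows "sat (functionalf r) \<longleftrightarrow> functional rel"
proof -
  have "sat (functionalf r) \<longleftrightarrow> (\<forall>u\<in>dmn (dl_lqs D I wit). \<forall>w\<in>dmn (dl_lqs D I wit).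
      \<forall>z\<in>dmn (dl_lqs D I wit). (\<exists>a b. u = Inl a \<and> w = \<iota> b \<and> (a, b) \<in> rel) \<and>
        (\<exists>a b. u = Inl a \<and> z = \<iota> b \<and> (a, b) \<in> rel) \<longrightarrow> w = z)"
    unfolding functionalf_def sat_allq_small by (simp add: r del: dl_lqs_simps(1)) blast
  also have "\<dots> \<longleftrightarrow> functional rel"
  proof
    assume *: "\<forall>u\<in>dmn (dl_lqs D I wit). \<forall>w\<in>dmn (dl_lqs D I wit).
      \<forall>z\<in>dmn (dl_lqs D I wit). (\<exists>a b. u = Inl a \<and> w = \<iota> b \<and> (a, b) \<in> rel) \<and>
        (\<exists>a b. u = Inl a \<and> z = \<iota> b \<and> (a, b) \<in> rel) \<longrightarrow> w = z"
    show "functional rel"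
      unfolding functional_def
    proof (intro allI impI)
      fix a b b' assume ab: "(a, b) \<in> rel" "(a, b') \<in> rel"
      have "Inl a \<in> dmn (dl_lqs D I wit)" using dom ab by simp
      then have "\<iota> b = \<iota> b'" using * ran ab by metis
      then show "b = b'" using inj by (simp add: inj_eq)
    qed
  next
    assume "functional rel"
    then show "\<forall>u\<in>dmn (dl_lqs D I wit). \<forall>w\<in>dmn (dl_lqs D I wit).
      \<forall>z\<in>dmn (dl_lqs D I wit). (\<exists>a b. u = Inl a \<and> w = \<iota> b \<and> (a, b) \<in> rel) \<and>
        (\<exists>a b. u = Inl a \<and> z = \<iota> b \<and> (a, b) \<in> rel) \<longrightarrow> w = z"
      unfolding functional_def by blast
  qed
  finally show ?thesis .
qed

section \<open>Number restrictions, uniformly for abstract and concrete roles\<close>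

context
  fixes r :: "'n var0 \<Rightarrow> 'n var0 \<Rightarrow> 'n qf" and c :: "'n var0 \<Rightarrow> 'n qf"
    and rel :: "('i \<times> 'b) set" and S :: "'b set" and \<iota> :: "'b \<Rightarrow> 'i + 'v"
  assumes r: "\<And>\<nu> x y. val \<nu> \<Longrightarrow>
      sat0 \<nu> (r x y) \<longleftrightarrow> (\<exists>a b. \<nu> x = Inl a \<and> \<nu> y = \<iota> b \<and> (a, b) \<in> rel)"
    and c: "\<And>\<nu> x. val \<nu> \<Longrightarrow> sat0 \<nu> (c x) \<longleftrightarrow> (\<exists>b. \<nu> x = \<iota> b \<and> b \<in> S)"
    and inj: "inj \<iota>"
    and ran: "\<And>a b. (a, b) \<in> rel \<Longrightarrow> \<iota> b \<in> dmn (dl_lqs D I wit)"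
begin

lemma sat_succs:
  assumes "val \<nu>" and "\<nu> (Q 0) = Inl a"
  shows "(\<forall>p\<in>set (succs n r c). sat0 \<nu> p) \<longleftrightarrow>
     (\<forall>i\<in>{1..n}. \<exists>b\<in>S. \<nu> (Q i) = \<iota> b \<and> (a, b) \<in> rel) \<and> inj_on (\<lambda>i. \<nu> (Q i)) {1..n}"
  unfolding psat_succs using assms inj by (auto simp: r c inj_eq)

text \<open>Common core of both number restrictions: no element outside \<open>P\<close> has
  \<open>n\<close> distinct successors. For \<open>at_leastf\<close>, \<open>P\<close> is the
  concept on the right; for \<open>at_mostf\<close>, \<open>P\<close> is the complement of the
  concept on the left and the number is \<open>Suc n\<close>, because "at most n" negates "at least
  n + 1".\<close>

lemma sat_not_allq_succs:
  assumes p: "\<And>\<nu>. val \<nu> \<Longrightarrow> sat0 \<nu> p \<longleftrightarrow>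
      \<not> ((\<exists>a\<in>aDom I. \<nu> (Q 0) = Inl a \<and> \<not> P a) \<and> (\<forall>q\<in>set (succs n r c). sat0 \<nu> q))"
  shows "sat (allq n p) \<longleftrightarrow> at_least (aDom I) n rel S \<subseteq> {a. P a}"
proof -
  let ?A = "\<lambda>a. {y \<in> S. (a, y) \<in> rel}"
  have "\<not> sat (allq n p) \<longleftrightarrow> (\<exists>a\<in>aDom I. \<not> P a \<and> (\<exists>f. inj_on f {1..n} \<and> f ` {1..n} \<subseteq> ?A a))"
  proof
    assume "\<not> sat (allq n p)"
    then obtain f where "\<not> sat0 (override_on (v0 (dl_lqs D I wit)) f (Q ` {..n})) p"
      unfolding psat_allq by blast
    then obtain a where a: "a \<in> aDom I" "\<not> P a" and f0: "f (Q 0) = Inl a"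
      and s: "\<forall>q\<in>set (succs n r c). sat0 (override_on (v0 (dl_lqs D I wit)) f (Q ` {..n})) q"
      by (auto simp: p override_Q)
    let ?\<nu> = "override_on (v0 (dl_lqs D I wit)) f (Q ` {..n})"
    from s have s: "\<forall>i\<in>{1..n}. \<exists>b\<in>S. ?\<nu> (Q i) = \<iota> b \<and> (a, b) \<in> rel" "inj_on (\<lambda>i. ?\<nu> (Q i)) {1..n}"
      using sat_succs[of ?\<nu> a n] f0 by (simp_all add: override_Q)
    then obtain g where g: "\<And>i. i \<in> {1..n} \<Longrightarrow> g i \<in> S \<and> ?\<nu> (Q i) = \<iota> (g i) \<and> (a, g i) \<in> rel"
      by metis
    have "inj_on g {1..n}"
      using s(2) g by (metis (mono_tags, lifting) inj_on_def)
    moreover have "g ` {1..n} \<subseteq> ?A a"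
      using g by auto
    ultimately show "\<exists>a\<in>aDom I. \<not> P a \<and> (\<exists>f. inj_on f {1..n} \<and> f ` {1..n} \<subseteq> ?A a)"
      using a by blast
  next
    assume "\<exists>a\<in>aDom I. \<not> P a \<and> (\<exists>f. inj_on f {1..n} \<and> f ` {1..n} \<subseteq> ?A a)"
    then obtain a g where a: "a \<in> aDom I" "\<not> P a" and g: "inj_on g {1..n}" "g ` {1..n} \<subseteq> ?A a"
      by blast
    \<comment> \<open>\<open>Q 0\<close> denotes the element and \<open>Q i\<close> its
      \<open>i\<close>-th successor; the value at other variables is arbitrary, as only the
      \<open>Q i\<close> are overridden.\<close>
    define f :: "'n var0 \<Rightarrow> 'i + 'v" where "f = (\<lambda>x. case x of Q i \<Rightarrow> if i = 0 then Inl a else \<iota> (g i) | _ \<Rightarrow> Inl a)"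
    let ?\<nu> = "override_on (v0 (dl_lqs D I wit)) f (Q ` {..n})"
    have fQ: "f (Q i) = (if i = 0 then Inl a else \<iota> (g i))" for i
      by (simp add: f_def)
    have "\<forall>i\<le>n. f (Q i) \<in> dmn (dl_lqs D I wit)"
    proof (intro allI impI)
      fix i assume "i \<le> n"
      show "f (Q i) \<in> dmn (dl_lqs D I wit)"
      proof (cases "i = 0")
        case True
        then show ?thesis using a(1) by (simp add: fQ)
      next
        case False
        then have "g i \<in> g ` {1..n}" using \<open>i \<le> n\<close> by auto
        then have "(a, g i) \<in> rel" using g(2) by blast
        then show ?thesis using ran False by (simp add: fQ)
      qed
    qed
    moreover have \<nu>: "?\<nu> (Q i) = \<iota> (g i)" if "i \<in> {1..n}" for i
      using that by (simp add: override_Q fQ)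
    have "inj_on (\<iota> \<circ> g) {1..n}"
      using g(1) inj by (meson comp_inj_on inj_on_subset subset_UNIV)
    then have "inj_on (\<lambda>i. ?\<nu> (Q i)) {1..n}"
      using \<nu> by (subst inj_on_cong[where g = "\<iota> \<circ> g"]) auto
    moreover have "\<forall>i\<in>{1..n}. \<exists>b\<in>S. ?\<nu> (Q i) = \<iota> b \<and> (a, b) \<in> rel"
      using g(2) \<nu> by blast
    moreover have "?\<nu> (Q 0) = Inl a"
      by (simp add: override_Q fQ)
    ultimately have "\<forall>i\<le>n. f (Q i) \<in> dmn (dl_lqs D I wit)" "\<not> sat0 ?\<nu> p"
      using a sat_succs[of ?\<nu> a n] p[of ?\<nu>] by auto
    then show "\<not> sat (allq n p)"
      unfolding psat_allq by blast
  qed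
  then show ?thesis
    unfolding at_least_def card_ge_iff_inj_on by blast
qed

lemma sat_at_leastf: "sat (at_leastf n r c C) \<longleftrightarrow> at_least (aDom I) n rel S \<subseteq> conceptS D I C"
proof -
  have "sat (at_leastf n r c C) \<longleftrightarrow> at_least (aDom I) n rel S \<subseteq> {a. a \<in> conceptS D I C}"
    unfolding at_leastf_def by (rule sat_not_allq_succs) (auto simp: psat_bigand)
  then show ?thesis by simp
qed

lemma sat_at_mostf: "sat (at_mostf C n r c) \<longleftrightarrow> conceptS D I C \<subseteq> at_most (aDom I) n rel S"
proof -
  \<comment> \<open>\<open>at_mostf\<close> has no \<open>XAbs\<close> guard: membership in
    \<open>C\<close> already places \<open>Q 0\<close> in the abstract domain.\<close>
  have "sat (at_mostf C n r c) \<longleftrightarrow> at_least (aDom I) (Suc n) rel S \<subseteq> {a. a \<notin> conceptS D I C}"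
    unfolding at_mostf_def using terms_in_domain(1)[OF interp, of C]
    by (intro sat_not_allq_succs) (auto simp: psat_bigand)
  also have "\<dots> \<longleftrightarrow> conceptS D I C \<subseteq> at_most (aDom I) n rel S"
    using terms_in_domain(1)[OF interp, of C]
    by (auto simp: at_least_def at_most_def subset_iff not_less_eq_eq)
  finally show ?thesis .
qed

end

lemma concept_in: "a \<in> conceptS D I C \<Longrightarrow> a \<in> aDom I"
  and arole_in: "(a, b) \<in> aroleS D I R \<Longrightarrow> a \<in> aDom I \<and> b \<in> aDom I"
  and crole_in: "(a, v) \<in> croleS D I P \<Longrightarrow> a \<in> aDom I \<and> v \<in> dDom I"
  using terms_in_domain[OF interp] by fastforce+

lemma inj_Inl_Inr: "inj (Inl :: 'i \<Rightarrow> 'i + 'v)" "inj (Inr :: 'v \<Rightarrow> 'i + 'v)"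
  by (auto simp: inj_def)

text \<open>The premises force every \<open>Q i\<close> into the left summand, since each one is an
  endpoint of some edge. Assignments satisfying the premises are thus the same as paths of abstract
  elements.\<close>

lemma sat_chain: "sat (tr_rstmt (RChain R1 Rs R)) \<longleftrightarrow> sat_rstmt D I (RChain R1 Rs R)"
proof -
  let ?k = "Suc (length Rs)"
  let ?dmn = "dmn (dl_lqs D I wit)"
  have "sat (tr_rstmt (RChain R1 Rs R)) \<longleftrightarrow> (\<forall>f :: 'n var0 \<Rightarrow> 'i + 'v. (\<forall>i\<le>?k. f (Q i) \<in> ?dmn) \<longrightarrow>
     (\<forall>i<?k. \<exists>a b. f (Q i) = Inl a \<and> f (Q (Suc i)) = Inl b \<and> (a, b) \<in> aroleS D I ((R1 # Rs) ! i)) \<longrightarrow>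
     (\<exists>a b. f (Q 0) = Inl a \<and> f (Q ?k) = Inl b \<and> (a, b) \<in> aroleS D I R))"
  proof -
    have "sat0 \<nu> (Imp (bigand [tr_arole ((R1 # Rs) ! i) (Q i) (Q (Suc i)). i \<leftarrow> [0..<?k]])
            (tr_arole R (Q 0) (Q ?k))) \<longleftrightarrow>
       ((\<forall>i<?k. \<exists>a b. f (Q i) = Inl a \<and> f (Q (Suc i)) = Inl b \<and> (a, b) \<in> aroleS D I ((R1 # Rs) ! i)) \<longrightarrow>
       (\<exists>a b. f (Q 0) = Inl a \<and> f (Q ?k) = Inl b \<and> (a, b) \<in> aroleS D I R))"
      if "val \<nu>" "\<And>i. i \<le> ?k \<Longrightarrow> \<nu> (Q i) = f (Q i)" for \<nu> f :: "'n var0 \<Rightarrow> 'i + 'v"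
    proof -
      have "sat0 \<nu> (bigand [tr_arole ((R1 # Rs) ! i) (Q i) (Q (Suc i)). i \<leftarrow> [0..<?k]]) \<longleftrightarrow>
        (\<forall>i<?k. sat0 \<nu> (tr_arole ((R1 # Rs) ! i) (Q i) (Q (Suc i))))"
        by (subst psat_bigand) (auto simp del: upt_Suc sat_terms)
      also have "\<dots> \<longleftrightarrow> (\<forall>i<?k. \<exists>a b. f (Q i) = Inl a \<and> f (Q (Suc i)) = Inl b \<and>
          (a, b) \<in> aroleS D I ((R1 # Rs) ! i))"
        using that by (simp add: less_Suc_eq_le)
      finally show ?thesis
        using that by (simp del: upt_Suc) blast
    qed
    then show ?thesis
      unfolding tr_rstmt.simps psat_allq by (simp add: override_Q del: psat.simps upt_Suc)
  qed
  also have "\<dots> \<longleftrightarrow> (\<forall>g. (\<forall>i<?k. (g i, g (Suc i)) \<in> aroleS D I ((R1 # Rs) ! i)) \<longrightarrow>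
     (g 0, g ?k) \<in> aroleS D I R)" (is "?L \<longleftrightarrow> ?R")
  proof
    assume L: ?L
    show ?R
    proof (intro allI impI)
      fix g assume g: "\<forall>i<?k. (g i, g (Suc i)) \<in> aroleS D I ((R1 # Rs) ! i)"
      let ?f = "\<lambda>x. case x of Q i \<Rightarrow> Inl (g i) | _ \<Rightarrow> undefined"
      \<comment> \<open>Node 0 is the source of edge 0 and node \<open>j + 1\<close> is the target
        of edge \<open>j\<close>; there is always at least one edge.\<close>
      have "Inl (g i) \<in> ?dmn" if "i \<le> ?k" for i
      proof (cases i)
        case 0
        then show ?thesis
          using g[rule_format, of 0] terms_in_domain(2)[OF interp] by fastforce
      next
        case (Suc j)
        then show ?thesis
          using g[rule_format, of j] that by (auto dest: arole_in)
      qed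
      then show "(g 0, g ?k) \<in> aroleS D I R"
        using L[rule_format, of ?f] g by simp
    qed
  next
    assume R: ?R
    show ?L
    proof (intro allI impI)
      fix f :: "'n var0 \<Rightarrow> 'i + 'v"
      assume f: "\<forall>i<?k. \<exists>a b. f (Q i) = Inl a \<and> f (Q (Suc i)) = Inl b \<and>
        (a, b) \<in> aroleS D I ((R1 # Rs) ! i)"
      define g where "g i = projl (f (Q i))" for i
      have g: "f (Q i) = Inl (g i)" if "i \<le> ?k" for i
      proof (cases i)
        case 0
        then show ?thesis using f[rule_format, of 0] by (auto simp: g_def)
      next
        case (Suc j)
        then show ?thesis using that f[rule_format, of j] by (auto simp: g_def)
      qed
      have "(g i, g (Suc i)) \<in> aroleS D I ((R1 # Rs) ! i)" if "i < ?k" for i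
        using f[rule_format, OF that] g[of i] g[of "Suc i"] that by auto
      then show "\<exists>a b. f (Q 0) = Inl a \<and> f (Q ?k) = Inl b \<and> (a, b) \<in> aroleS D I R"
        using R g by simp
    qed
  qed
  also have "\<dots> \<longleftrightarrow> sat_rstmt D I (RChain R1 Rs R)"
  proof -
    have "(aroleS D I R1 # map (aroleS D I) Rs) ! i = aroleS D I ((R1 # Rs) ! i)" if "i < ?k" for i
      using that nth_map[of i "R1 # Rs" "aroleS D I"] by simp
    then show ?thesis
      by (simp add: subset_iff chain_iff) blast
  qed
  finally show ?thesis .
qed

section \<open>Truth of the translated statements\<close>

lemma sat_tr_rstmt: "sat (tr_rstmt s) \<longleftrightarrow> sat_rstmt D I s"
proof (cases s)
  case (RChain R1 Rs R)
  then show ?thesis using sat_chain by simp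
next
  case (RTra R)
  have "sat_rstmt D I (RTra R) \<longleftrightarrow>
      (\<forall>a b c. (a, b) \<in> aroleS D I R \<longrightarrow> (b, c) \<in> aroleS D I R \<longrightarrow> (a, c) \<in> aroleS D I R)"
    by auto
  also have "\<dots> \<longleftrightarrow> sat (tr_rstmt s)"
    unfolding RTra by (simp add: sat_allq_small[unfolded ball_dmn]) (metis arole_in)
  finally show ?thesis using RTra by simp
next
  case (RFun R)
  have "sat (functionalf (tr_arole R)) \<longleftrightarrow> functional (aroleS D I R)"
    by (rule sat_functionalf[where \<iota> = Inl]) (auto dest: arole_in intro: inj_Inl_Inr)
  then show ?thesis using RFun by simp
next
  case (PFun P)
  have "sat (functionalf (tr_crole P)) \<longleftrightarrow> functional (croleS D I P)"
    by (rule sat_functionalf[where \<iota> = Inr]) (auto dest: crole_in intro: inj_Inl_Inr)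
  then show ?thesis using PFun by simp
next
  case (REqv R1 R2)
  then show ?thesis
    using arole_in[of _ _ R1] arole_in[of _ _ R2]
    by (simp add: sat_allq_small[unfolded ball_dmn One_nat_def] set_eq_iff subset_iff) blast
next
  case (RSub R1 R2)
  then show ?thesis
    using arole_in[of _ _ R1]
    by (simp add: sat_allq_small[unfolded ball_dmn One_nat_def] set_eq_iff subset_iff) blast
next
  case (RSym R)
  then show ?thesis
    using arole_in[of _ _ R]
    by (simp add: sat_allq_small[unfolded ball_dmn One_nat_def] set_eq_iff subset_iff) blast
next
  case (RAsym R)
  then show ?thesis
    using arole_in[of _ _ R]
    by (simp add: sat_allq_small[unfolded ball_dmn One_nat_def] set_eq_iff subset_iff) blast
next
  case (RIrref R)
  then show ?thesis
    using arole_in[of _ _ R]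
    by (simp add: sat_allq_small[unfolded ball_dmn One_nat_def] set_eq_iff subset_iff) blast
next
  case (RDis R1 R2)
  then show ?thesis
    using arole_in[of _ _ R1]
    by (simp add: sat_allq_small[unfolded ball_dmn One_nat_def] set_eq_iff subset_iff) blast
next
  case (PEqv P1 P2)
  then show ?thesis
    using crole_in[of _ _ P1] crole_in[of _ _ P2]
    by (simp add: sat_allq_small[unfolded ball_dmn One_nat_def] set_eq_iff subset_iff) blast
next
  case (PSub P1 P2)
  then show ?thesis
    using crole_in[of _ _ P1]
    by (simp add: sat_allq_small[unfolded ball_dmn One_nat_def] set_eq_iff subset_iff) blast
next
  case (RRef R)
  then show ?thesis
    by (auto simp: sat_allq_small[unfolded ball_dmn])
qed

text \<open>Where two datatype terms are compared, the semantics speaks of whole sets but the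
  quantifier ranges over the domain only. The assumption rules out constants or facets that would
  lead outside \<open>dDom I\<close>. In the other statements the role already bounds the
  values.\<close>

lemma sat_tr_tstmt:
  assumes "\<And>t u. s = TEqv t u \<or> s = TSub t u \<Longrightarrow> dtermS D (dDom I) t \<subseteq> dDom I \<and> dtermS D (dDom I) u \<subseteq> dDom I"
  shows "sat (tr_tstmt s) \<longleftrightarrow> sat_tstmt D I s"
proof (cases s)
  case (AtLeastSub n R C1 C2)
  show ?thesis unfolding AtLeastSub tr_tstmt.simps sat_tstmt.simps
    by (rule sat_at_leastf[where \<iota> = Inl]) (auto dest: arole_in intro: inj_Inl_Inr)
next
  case (SubAtMost C1 n R C2)
  show ?thesis unfolding SubAtMost tr_tstmt.simps sat_tstmt.simps
    by (rule sat_at_mostf[where \<iota> = Inl]) (auto dest: arole_in intro: inj_Inl_Inr)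
next
  case (AtLeastPSub n P t C)
  show ?thesis unfolding AtLeastPSub tr_tstmt.simps sat_tstmt.simps
    by (rule sat_at_leastf[where \<iota> = Inr]) (auto dest: crole_in intro: inj_Inl_Inr)
next
  case (SubAtMostP C n P t)
  show ?thesis unfolding SubAtMostP tr_tstmt.simps sat_tstmt.simps
    by (rule sat_at_mostf[where \<iota> = Inr]) (auto dest: crole_in intro: inj_Inl_Inr)
next
  case (TEqv t u)
  then show ?thesis using assms[of t u] by (auto simp: sat_allq_small[unfolded ball_dmn])
next
  case (TSub t u)
  then show ?thesis using assms[of t u] by (auto simp: sat_allq_small[unfolded ball_dmn])
next
  case (CEqv C1 C2)
  then show ?thesis
    using concept_in[of _ C1] concept_in[of _ C2]
    by (simp add: sat_allq_small[unfolded ball_dmn One_nat_def] set_eq_iff subset_iff) blast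
next
  case (CSub C1 C2)
  then show ?thesis
    using concept_in[of _ C1]
    by (simp add: sat_allq_small[unfolded ball_dmn One_nat_def] set_eq_iff subset_iff) blast
next
  case (CSubAll C1 R C2)
  then show ?thesis
    using concept_in[of _ C1] arole_in[of _ _ R]
    by (simp add: sat_allq_small[unfolded ball_dmn One_nat_def] set_eq_iff subset_iff all_restr_def ex_restr_def) blast
next
  case (ExSub R C1 C2)
  then show ?thesis
    using arole_in[of _ _ R]
    by (simp add: sat_allq_small[unfolded ball_dmn One_nat_def] set_eq_iff subset_iff all_restr_def ex_restr_def) blast
next
  case (CSubAllP C P t)
  then show ?thesis
    using concept_in[of _ C] crole_in[of _ _ P]
    by (simp add: sat_allq_small[unfolded ball_dmn One_nat_def] set_eq_iff subset_iff all_restr_def ex_restr_def) blast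
next
  case (ExPSub P t C)
  then show ?thesis
    using crole_in[of _ _ P]
    by (simp add: sat_allq_small[unfolded ball_dmn One_nat_def] set_eq_iff subset_iff all_restr_def ex_restr_def) blast
qed

lemma sat_tr_astmt: "sat (tr_astmt s) \<longleftrightarrow> sat_astmt D I s"
  by (cases s)
    (auto simp: sat_terms[OF val_v0, simplified] sat_dterm[OF val_v0, simplified])

end


section \<open>The axioms of the formula\<close>

lemma distinct_iff_nth_less:
  "distinct ys \<longleftrightarrow> (\<forall>j<length ys. \<forall>i<j. ys ! i \<noteq> ys ! j)"
proof
  assume L: "\<forall>j<length ys. \<forall>i<j. ys ! i \<noteq> ys ! j"
  show "distinct ys"
    unfolding distinct_conv_nth
  proof (intro allI impI)
    fix i j
    assume ij: "i < length ys" "j < length ys" "i \<noteq> j"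
    then consider "i < j" | "j < i" by linarith
    then show "ys ! i \<noteq> ys ! j"
    proof cases
      case 1
      with L ij show ?thesis by blast
    next
      case 2
      with L ij have "ys ! j \<noteq> ys ! i" by blast
      then show ?thesis by simp
    qed
  qed
next
  assume "distinct ys"
  then show "\<forall>j<length ys. \<forall>i<j. ys ! i \<noteq> ys ! j"
    by (simp add: nth_eq_iff_index_eq)
qed

lemma psat_distinctf:
  "(\<forall>p\<in>set (distinctf xs). psat (sat_atom0 M) p) \<longleftrightarrow> distinct (map (v0 M) xs)"
  by (auto simp: distinctf_def distinct_iff_nth_less simp del: distinct_map)

lemma psat_in_regionf:
  "psat (sat_atom0 M) (in_regionf ps S x) \<longleftrightarrow>
     v0 M x \<in> v1 M XData \<and> (\<forall>p\<in>set ps. v0 M x \<in> v1 M (XPred p) \<longleftrightarrow> p \<in> set S)"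
  by (simp add: in_regionf_def psat_bigand ball_Un) blast

lemma set_dpreds: "set (dpreds K) = {p. SPred p \<in> set (sy_kb K)}"
proof -
  have "set [p. SPred p \<leftarrow> ss] = {p. SPred p \<in> set ss}" for ss :: "'a sym list"
  proof (induction ss)
    case (Cons s ss)
    then show ?case by (cases s) auto
  qed simp
  then show ?thesis by (simp add: dpreds_def)
qed

lemma set_kb_constants: "set (kb_constants K) = {(d, e). SConst d e \<in> set (sy_kb K)}"
proof -
  have "set [(d, e). SConst d e \<leftarrow> ss] = {(d, e). SConst d e \<in> set ss}" for ss :: "'a sym list"
  proof (induction ss)
    case (Cons s ss)
    then show ?case by (cases s) auto
  qed simp
  then show ?thesis by (simp add: kb_constants_def)
qed

lemma psat_const_axioms:
  "(\<forall>g\<in>set (const_axioms D K). psat (sat_comp3 M) g) \<longleftrightarrow>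
     (\<forall>(d, e)\<in>set (kb_constants K). v0 M (XConst d e) \<in> v1 M XData \<and>
        (\<forall>p\<in>set (dpreds K). v0 M (XConst d e) \<in> v1 M (XPred p) \<longleftrightarrow> constI D d e \<in> dpredS D p)) \<and>
     (\<forall>(d, e)\<in>set (kb_constants K). \<forall>(d', e')\<in>set (kb_constants K).
        v0 M (XConst d e) = v0 M (XConst d' e') \<longleftrightarrow> constI D d e = constI D d' e')"
proof -
  have "(\<forall>g\<in>set (const_axioms D K). psat (sat_comp3 M) g) \<longleftrightarrow>
     (\<forall>(d, e)\<in>set (kb_constants K). psat (sat_atom0 M)
        (in_regionf (dpreds K) (filter (\<lambda>p. constI D d e \<in> dpredS D p) (dpreds K)) (XConst d e))) \<and>
     (\<forall>(d, e)\<in>set (kb_constants K). \<forall>(d', e')\<in>set (kb_constants K).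
        v0 M (XConst d e) = v0 M (XConst d' e') \<longleftrightarrow> constI D d e = constI D d' e')"
    unfolding const_axioms_def by (fastforce simp: ball_Un split: if_splits)
  then show ?thesis
    by (simp add: psat_in_regionf case_prod_unfold)
qed

lemma psat_region_axioms:
  "(\<forall>g\<in>set (region_axioms D K). psat (sat_comp3 M) g) \<longleftrightarrow>
     (\<forall>S\<in>set (subseqs (dpreds K)).
        (\<forall>j<capped_card (bound K) (region D (dpreds K) S). v0 M (XWit S j) \<in> v1 M XData \<and>
          (\<forall>p\<in>set (dpreds K). v0 M (XWit S j) \<in> v1 M (XPred p) \<longleftrightarrow> p \<in> set S)) \<and>
        inj_on (\<lambda>j. v0 M (XWit S j)) {..<capped_card (bound K) (region D (dpreds K) S)})"
proof -
  have "(\<forall>g\<in>set (region_axioms D K). psat (sat_comp3 M) g) \<longleftrightarrow>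
     (\<forall>S\<in>set (subseqs (dpreds K)).
        (\<forall>j<capped_card (bound K) (region D (dpreds K) S).
           psat (sat_atom0 M) (in_regionf (dpreds K) S (XWit S j))) \<and>
        (\<forall>p\<in>set (distinctf (map (XWit S) [0..<capped_card (bound K) (region D (dpreds K) S)])).
           psat (sat_atom0 M) p))"
    unfolding region_axioms_def Let_def by (auto simp: ball_Un)
  then show ?thesis
    by (simp add: psat_in_regionf psat_distinctf distinct_map inj_on_def atLeast0LessThan)
qed

subsection \<open>Membership in \<open>4LQS\<^sup>R\<close>\<close>

text \<open>The restrictions that define the fragment concern universal formulae of levels 2 and 3.
  Without these, membership reduces to nonempty prefixes at level 1.\<close>

definition simple :: "'n dl_formula \<Rightarrow> bool" where
  "simple g \<longleftrightarrow> (\<forall>c\<in>set_pform g. (\<exists>a. c = A30 a) \<or> (\<exists>q. c = U31 q \<and> wf_univ1 q))"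

lemma simple_simps [simp]: "simple (qfree p)" "simple (allq k p)" "simple (Neg g) = simple g"
  by (auto simp: simple_def qfree_def allq_def pform.set_map)

lemma simple_bigand: "gs \<noteq> [] \<Longrightarrow> simple (bigand gs) \<longleftrightarrow> (\<forall>g\<in>set gs. simple g)"
  by (auto simp: simple_def set_pform_bigand)

lemma simple_tr_rstmt: "simple (tr_rstmt r)"
  by (cases r) (simp_all add: functionalf_def)

lemma simple_tr_tstmt: "simple (tr_tstmt t)"
  by (cases t) (simp_all add: at_leastf_def at_mostf_def)

lemma simple_tr_astmt: "simple (tr_astmt a)"
  by (cases a) simp_all

lemma simple_sym_axiom: "simple (sym_axiom s)"
  by (cases s) simp_all

lemma kb_formula_in_4LQSR: "in_4LQSR TU (kb_formula D K)"
proof -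
  have "simple (kb_formula D K)"
    unfolding kb_formula_def
    by (subst simple_bigand)
      (auto simp: domain_axioms_def const_axioms_def region_axioms_def Let_def
        simple_tr_rstmt simple_tr_tstmt simple_tr_astmt simple_sym_axiom)
  then show ?thesis
    by (fastforce simp: in_4LQSR_def simple_def)
qed


section \<open>From consistency to satisfiability\<close>

lemma on_UNIV [simp]: "on1 UNIV Y" "on3 UNIV W"
  by (cases Y; simp) (cases W; simp)

text \<open>A copy of \<open>F\<close> is placed in the infinite type and all symbols are pulled
  back along the bijection. \<open>M\<close> is not assumed to be a proper interpretation, which
  allows \<open>dl_lqs\<close> in its place.\<close>

lemma finite_submodel:
  fixes M :: "('a, 'n var0, 'n var1, nat, 'n var3) lqs_interp"
  assumes "finite F" and "F \<noteq> {}" and "v0 M ` X \<subseteq> F" and "F \<subseteq> dmn M"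
    and "infinite (UNIV :: 'u set)"
  obtains M' :: "('u, 'n var0, 'n var1, nat, 'n var3) lqs_interp" and h
  where "is_lqs_interp M'" and "partial_iso UNIV X M' M (dmn M') h" and "h ` dmn M' = F"
proof -
  obtain B :: "'u set" where "finite B" "card B = card F"
    using infinite_arbitrarily_large[OF assms(5)] by metis
  then obtain h where h: "bij_betw h B F"
    using assms(1) finite_same_card_bij by metis
  then obtain g where g: "bij_betw g F B" "\<And>u. u \<in> F \<Longrightarrow> h (g u) = u" "\<And>b. b \<in> B \<Longrightarrow> g (h b) = b"
    using bij_betw_inv_into[of h B F] by (metis bij_betw_inv_into_left bij_betw_inv_into_right)
  obtain c where c: "c \<in> F" using assms(2) by blast
  \<comment> \<open>Variables that \<open>M\<close> sends outside \<open>F\<close> receive the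
    default \<open>c\<close>, so that \<open>M'\<close> is an interpretation. Sort 3 keeps only
    pairs, all that \<open>PairIn\<close> can detect.\<close>
  define M' :: "('u, 'n var0, 'n var1, nat, 'n var3) lqs_interp" where
    "M' = \<lparr>dmn = B, v0 = (\<lambda>x. g (if v0 M x \<in> F then v0 M x else c)), v1 = (\<lambda>Y. {b \<in> B. h b \<in> v1 M Y}),
      v2 = (\<lambda>_. {}), v3 = (\<lambda>W. {kpair b b' | b b'. b \<in> B \<and> b' \<in> B \<and> kpair (h b) (h b') \<in> v3 M W})\<rparr>"
  have gB: "g u \<in> B" if "u \<in> F" for u
    using g(1) that by (auto simp: bij_betw_def)
  have hF: "h ` B = F" "inj_on h B"
    using h by (auto simp: bij_betw_def)
  have "is_lqs_interp M'"
    using gB c hF assms(2) by (auto simp: is_lqs_interp_def M'_def kpair_def)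
  moreover have "partial_iso UNIV X M' M (dmn M') h"
    using hF assms(3,4) gB g(2) by (auto simp: partial_iso_def M'_def)
  moreover have "h ` dmn M' = F"
    using hF by (simp add: M'_def)
  ultimately show ?thesis using that by blast
qed

lemma over_in_regionf:
  "\<lbrakk>x \<in> X; \<And>p. p \<in> set ps \<Longrightarrow> SPred p \<in> Sy\<rbrakk> \<Longrightarrow> over Sy X (in_regionf ps S x)"
  by (simp add: in_regionf_def over_bigand ball_Un)

lemma over_distinctf: "\<lbrakk>set xs \<subseteq> X; p \<in> set (distinctf xs)\<rbrakk> \<Longrightarrow> over Sy X p"
  by (auto simp: distinctf_def subset_iff)

lemma univ_over_UNIV: "univ_over Sy X n g \<Longrightarrow> univ_over UNIV X n g"
proof -
  have "over UNIV X p" if "over Sy X p" for X p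
  proof -
    have "atom_over UNIV X a" if "atom_over Sy X a" for a
      using that by (cases a) auto
    then show ?thesis using that by (auto simp: over_def)
  qed
  then show "univ_over Sy X n g \<Longrightarrow> univ_over UNIV X n g"
    unfolding univ_over_def by blast
qed

lemma submodel_univ:
  assumes "partial_iso UNIV X M' M (dmn M') h" and "univ_over Sy X n g" and "psat (sat_comp3 M) g"
  shows "psat (sat_comp3 M') g"
  using univ_over_UNIV[OF assms(2)] unfolding univ_over_def
proof (elim disjE exE conjE)
  fix p assume "g = qfree p" "over UNIV X p"
  then show ?thesis using assms(3) partial_iso_psat[OF assms(1)] by simp
next
  fix k p assume "g = allq k p" "over UNIV (X \<union> Q ` {..k}) p"
  then show ?thesis
    using assms(1,3) by (auto intro!: allq_transfer[of M k p UNIV X] exI[of _ "dmn M'"] exI[of _ h])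
qed

text \<open>The domain axioms are left out: two of them are existential and do not pass to
  substructures.\<close>

abbreviation kb_axioms :: "('n, 'v) datatype_map \<Rightarrow> 'n kb \<Rightarrow> 'n dl_formula list" where
  "kb_axioms D K \<equiv> map sym_axiom (sy_kb K) @ const_axioms D K @ region_axioms D K @
     map tr_rstmt (rbox K) @ map tr_tstmt (tbox K) @ map tr_astmt (abox K)"

lemma psat_kb_formula:
  "psat s (kb_formula D K) \<longleftrightarrow>
     (\<forall>g\<in>set domain_axioms. psat s g) \<and> (\<forall>g\<in>set (kb_axioms D K). psat s g)"
  unfolding kb_formula_def
  by (subst psat_bigand) (simp add: domain_axioms_def, simp only: set_append ball_Un)

lemma capped_card_witnesses:
  "\<exists>w. inj_on w {..<capped_card N A} \<and> w ` {..<capped_card N A} \<subseteq> A"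
proof -
  have "infinite A \<or> capped_card N A \<le> card A"
    by (auto simp: capped_card_def)
  then obtain B where "B \<subseteq> A" "finite B" "card B = capped_card N A"
    by (metis infinite_arbitrarily_large obtain_subset_with_card_n)
  then obtain f where "bij_betw f {..<capped_card N A} B"
    using finite_same_card_bij[of "{..<capped_card N A}" B] by auto
  with \<open>B \<subseteq> A\<close> show ?thesis
    by (auto simp: bij_betw_def)
qed

lemma sy_kb_subset:
  "s \<in> set (rbox K) \<Longrightarrow> set (sy_rstmt s) \<subseteq> set (sy_kb K)"
  "t \<in> set (tbox K) \<Longrightarrow> set (sy_tstmt t) \<subseteq> set (sy_kb K)"
  "a \<in> set (abox K) \<Longrightarrow> set (sy_astmt a) \<subseteq> set (sy_kb K)"
  by (auto simp: sy_kb_def)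

lemma fexprS_subset:
  assumes "\<forall>p\<in>set (sy_fexpr d q). \<forall>f. p = SPred (Fc d f) \<longrightarrow> facetI D d f \<subseteq> V" and "dtI D d \<subseteq> V"
  shows "fexprS D d q \<subseteq> V"
  using assms by (induction q) auto

section \<open>A knowledge base over a fixed datatype map\<close>

locale kb_over_map =
  fixes D :: "('n, 'v) datatype_map" and K :: "'n kb"
  assumes datatype_map: "is_datatype_map D" and kb: "kb_over D K"
begin

definition values_of :: "'v set" where
  "values_of = (\<Union>d\<in>ND D. dtI D d)"

lemma dpredS_subset: "SPred p \<in> set (sy_kb K) \<Longrightarrow> dpredS D p \<subseteq> values_of"
  using datatype_map kb
  by (cases p) (fastforce simp: is_datatype_map_def kb_over_def values_of_def)+

lemma const_in_values: "SConst d e \<in> set (sy_kb K) \<Longrightarrow> constI D d e \<in> values_of"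
  using datatype_map kb by (fastforce simp: is_datatype_map_def kb_over_def values_of_def)

lemma values_subset_dDom: "is_dl_interp D I \<Longrightarrow> values_of \<subseteq> dDom I"
  by (auto simp: is_dl_interp_def values_of_def)

lemma brangeS_subset: "set (sy_brange r) \<subseteq> set (sy_kb K) \<Longrightarrow> brangeS D r \<subseteq> values_of"
proof (cases r)
  case (DFacet d q)
  assume *: "set (sy_brange r) \<subseteq> set (sy_kb K)"
  then have "fexprS D d q \<subseteq> values_of"
    using DFacet dpredS_subset[of "Dt d"] dpredS_subset[of "Fc d _"]
    by (intro fexprS_subset) auto
  then show ?thesis using DFacet by simp
next
  case (DType d)
  assume "set (sy_brange r) \<subseteq> set (sy_kb K)"
  then show ?thesis using DType dpredS_subset[of "Dt d"] by simp
next
  case (DEnum es)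
  assume *: "set (sy_brange r) \<subseteq> set (sy_kb K)"
  have "SConst d e \<in> set (sy_kb K)" if "(d, e) \<in> set es" for d e
    using that * DEnum by (force simp: sy_const_def)
  then show ?thesis using DEnum by (auto dest: const_in_values)
qed

lemma dtermS_subset:
  assumes "values_of \<subseteq> V" and "set (sy_dterm t) \<subseteq> set (sy_kb K)"
  shows "dtermS D V t \<subseteq> V"
  using assms(2)
proof (induction t)
  case (TRange r)
  then show ?case using assms(1) brangeS_subset by (cases r) force+
next
  case (TConst d e)
  then show ?case using assms(1) const_in_values[of d e] by (auto simp: sy_const_def)
qed auto

lemma sat_tr_tstmt_kb:
  assumes "is_dl_interp D I" and "s \<in> set (tbox K)"
  shows "psat (sat_comp3 (dl_lqs D I wit)) (tr_tstmt s) \<longleftrightarrow> sat_tstmt D I s"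
proof -
  interpret dl_model D I wit by unfold_locales (rule assms)
  show ?thesis
  proof (rule sat_tr_tstmt)
    fix t u assume "s = TEqv t u \<or> s = TSub t u"
    then have "set (sy_dterm t) \<subseteq> set (sy_kb K)" "set (sy_dterm u) \<subseteq> set (sy_kb K)"
      using sy_kb_subset(2)[OF assms(2)] by auto
    then show "dtermS D (dDom I) t \<subseteq> dDom I \<and> dtermS D (dDom I) u \<subseteq> dDom I"
      using dtermS_subset[OF values_subset_dDom[OF assms(1)]] by blast
  qed
qed

abbreviation cap :: "'n dpred list \<Rightarrow> nat" where
  "cap S \<equiv> capped_card (bound K) (region D (dpreds K) S)"

definition kb_vars :: "'n var0 set" where
  "kb_vars = named (set (sy_kb K)) \<union> {XWit S j | S j. S \<in> set (subseqs (dpreds K)) \<and> j < cap S}"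

text \<open>Regions may be infinite, but \<open>cap\<close> never exceeds
  \<open>bound K\<close>.\<close>

lemma finite_kb_vars: "finite kb_vars"
proof -
  have "{XWit S j | S j. S \<in> set (subseqs (dpreds K)) \<and> j < cap S} =
      (\<Union>S\<in>set (subseqs (dpreds K)). XWit S ` {..<cap S})"
    by auto
  then show ?thesis by (simp add: kb_vars_def finite_named)
qed

text \<open>Any number of variables is allowed here, because the substructure is embedded as a
  whole.\<close>

lemma kb_formula_univ:
  assumes "g \<in> set (kb_axioms D K)"
  shows "\<exists>n. univ_over (set (sy_kb K)) kb_vars n g"
proof -
  have named: "named (set (sy_kb K)) \<subseteq> kb_vars"
    by (simp add: kb_vars_def)
  consider s where "s \<in> set (sy_kb K)" "g = sym_axiom s" | "g \<in> set (const_axioms D K)"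
    | "g \<in> set (region_axioms D K)" | s where "s \<in> set (rbox K)" "g = tr_rstmt s"
    | s where "s \<in> set (tbox K)" "g = tr_tstmt s" | s where "s \<in> set (abox K)" "g = tr_astmt s"
    using assms by auto
  then show ?thesis
  proof cases
    case (1 s)
    have "univ_over (set (sy_kb K)) kb_vars 2 g"
      by (cases s) (use 1 named in \<open>auto intro!: univ_over_allq univ_over_qfree simp: in_named\<close>)
    then show ?thesis ..
  next
    case 2
    then have "univ_over (set (sy_kb K)) kb_vars 0 g"
      using named by (auto simp: const_axioms_def set_kb_constants set_dpreds in_named
          intro!: univ_over_qfree over_in_regionf)
    then show ?thesis ..
  next
    case 3
    then obtain S p where S: "S \<in> set (subseqs (dpreds K))" and g: "g = qfree p"
      and p: "p \<in> in_regionf (dpreds K) S ` XWit S ` {..<cap S} \<union>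
        set (distinctf (map (XWit S) [0..<cap S]))"
      by (auto simp: region_axioms_def Let_def)
    have "XWit S ` {..<cap S} \<subseteq> kb_vars"
      using S by (auto simp: kb_vars_def)
    then have "over (set (sy_kb K)) kb_vars p"
      using p by (auto simp: set_dpreds atLeast0LessThan intro!: over_in_regionf elim!: over_distinctf[rotated])
    then show ?thesis using g univ_over_qfree by blast
  next
    case (4 s)
    show ?thesis
    proof (cases "\<exists>R1 Rs R. s = RChain R1 Rs R")
      case True
      then obtain R1 Rs R where "s = RChain R1 Rs R" by blast
      then have "univ_over (set (sy_kb K)) kb_vars (Suc (Suc (length Rs))) g"
        using 4 named sy_kb_subset(1)[OF 4(1)] unfolding tr_rstmt.simps
        by (auto simp del: sy_rstmt.simps over_simps upt_Suc intro!: univ_over_allq over_chain)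
      then show ?thesis ..
    next
      case False
      then show ?thesis
        using 4 univ_over_tr_rstmt[OF named sy_kb_subset(1)[OF 4(1)]] by blast
    qed
  next
    case (5 s)
    then show ?thesis using univ_over_tr_tstmt[OF named sy_kb_subset(2)[OF 5(1)]] by blast
  next
    case (6 s)
    then show ?thesis using univ_over_tr_astmt[OF named sy_kb_subset(3)[OF 6(1)]] by blast
  qed
qed

lemma consistent_imp_satisfiable:
  assumes "infinite (UNIV :: 'u set)" and "consistent TYPE('i) D K"
  shows "satisfiable TYPE('u) (kb_formula D K)"
proof -
  obtain I :: "('n, 'i, 'v) dl_interp" where I: "is_dl_interp D I"
    and sat: "\<forall>s\<in>set (rbox K). sat_rstmt D I s" "\<forall>s\<in>set (tbox K). sat_tstmt D I s"
      "\<forall>s\<in>set (abox K). sat_astmt D I s"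
    using assms(2) by (auto simp: consistent_def)
  have "\<forall>S. \<exists>w. inj_on w {..<cap S} \<and> w ` {..<cap S} \<subseteq> region D (dpreds K) S"
    using capped_card_witnesses by blast
  from choice[OF this] obtain wit where
    wit: "\<And>S. inj_on (wit S) {..<cap S} \<and> wit S ` {..<cap S} \<subseteq> region D (dpreds K) S"
    by blast
  interpret dl_model D I wit by unfold_locales (rule I)
  let ?M = "dl_lqs D I wit"
  obtain a0 v0' where a0: "a0 \<in> aDom I" and v0': "v0' \<in> dDom I"
    using I by (auto simp: is_dl_interp_def)
  have vals: "values_of \<subseteq> dDom I" using values_subset_dDom[OF I] .
  have const_dDom: "constI D d e \<in> dDom I" if "SConst d e \<in> set (sy_kb K)" for d e
    using const_in_values[OF that] vals by blast
  have wit_region: "wit S j \<in> region D (dpreds K) S" if "j < cap S" for S j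
    using wit that by blast
  have wit_in: "wit S j \<in> dDom I" if "j < cap S" for S j
    using wit_region[OF that] vals by (auto simp: region_def values_of_def)
  \<comment> \<open>One element of each domain is added to the values of the variables, to satisfy
    the existential domain axioms.\<close>
  define F where "F = v0 ?M ` kb_vars \<union> {Inl a0, Inr v0'}"
  have "v0 ?M x \<in> dmn ?M" if "x \<in> kb_vars" for x
    using that I const_dDom wit_in
    by (auto simp: kb_vars_def named_def is_dl_interp_def)
  then have "F \<subseteq> dmn ?M"
    using a0 v0' by (auto simp: F_def)
  moreover have "finite F" "F \<noteq> {}" "v0 ?M ` kb_vars \<subseteq> F"
    by (auto simp: F_def finite_kb_vars)
  ultimately obtain M' :: "('u, 'n var0, 'n var1, nat, 'n var3) lqs_interp" and h
    where M': "is_lqs_interp M'" "partial_iso UNIV kb_vars M' ?M (dmn M') h" "h ` dmn M' = F"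
    using finite_submodel assms(1) by metis
  have sym: "sat (sym_axiom s)" if "s \<in> set (sy_kb K)" for s
  proof (cases s)
    case (SPred p)
    then show ?thesis using dpredS_subset[of p] that vals by (auto simp: sat_allq_small)
  next
    case (SConst d e)
    then show ?thesis using const_dDom[of d e] that by auto
  qed (use I in \<open>auto simp: is_dl_interp_def sat_allq_small[unfolded One_nat_def]\<close>)
  have const: "\<forall>g\<in>set (const_axioms D K). sat g"
    unfolding psat_const_axioms using const_dDom
    by (auto simp: set_kb_constants)
  have region: "\<forall>g\<in>set (region_axioms D K). sat g"
    unfolding psat_region_axioms
  proof (intro ballI conjI allI impI)
    fix S j assume j: "j < cap S"
    show "v0 ?M (XWit S j) \<in> v1 ?M XData"
      using wit_in[OF j] by simp
    fix p assume "p \<in> set (dpreds K)"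
    then show "v0 ?M (XWit S j) \<in> v1 ?M (XPred p) \<longleftrightarrow> p \<in> set S"
      using wit_region[OF j] by (auto simp: region_def)
  next
    fix S
    show "inj_on (\<lambda>j. v0 ?M (XWit S j)) {..<cap S}"
      using wit[of S] by (simp add: inj_on_def)
  qed
  have ax: "psat (sat_comp3 M') g"
    if "g \<in> set (kb_axioms D K)" for g
  proof -
    have "sat g"
      using that sym const region sat sat_tr_rstmt sat_tr_tstmt_kb[OF I] sat_tr_astmt by auto
    then show ?thesis
      using kb_formula_univ[OF that] submodel_univ[OF M'(2)] by blast
  qed
  have dom: "u \<in> v1 M' Y \<longleftrightarrow> h u \<in> v1 ?M Y" if "u \<in> dmn M'" for u Y
    using M'(2) that by (simp add: partial_iso_def)
  have "Inl a0 \<in> h ` dmn M'" "Inr v0' \<in> h ` dmn M'"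
    by (simp_all add: M'(3) F_def)
  then obtain u w where uw: "u \<in> dmn M'" "h u = Inl a0" "w \<in> dmn M'" "h w = Inr v0'"
    by (metis imageE)
  have u: "u \<in> v1 M' XAbs" using uw a0 dom by simp
  have w: "w \<in> v1 M' XData" using uw v0' dom by simp
  have disj: "\<not> (x \<in> v1 M' XAbs \<and> x \<in> v1 M' XData)" if "x \<in> dmn M'" for x
    using that dom by auto
  have domain: "psat (sat_comp3 M') g" if "g \<in> set domain_axioms" for g
    using that uw(1,3) u w disj by (auto simp: domain_axioms_def allq_def)
  have "psat (sat_comp3 M') (kb_formula D K)"
    unfolding psat_kb_formula using ax domain by blast
  then show ?thesis
    using M'(1) unfolding satisfiable_def by blast
qed

end


section \<open>From satisfiability to consistency\<close>

lemma inj_on_if: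
  assumes "inj_on c C" and "inj_on e A" and "e ` A \<inter> c ` C = {}"
  shows "inj_on (\<lambda>v. if v \<in> C then c v else e v) (A \<union> C)"
proof (rule inj_onI)
  fix x y assume "x \<in> A \<union> C" "y \<in> A \<union> C" "(if x \<in> C then c x else e x) = (if y \<in> C then c y else e y)"
  then show "x = y"
    using assms(3) by (auto split: if_splits dest: inj_onD[OF assms(1)] inj_onD[OF assms(2)])
qed

lemma pigeonhole_fibre:
  assumes "finite Z" and "finite T" and "T \<noteq> {}" and "\<tau> ` Z \<subseteq> T" and "N * card T \<le> card Z"
  obtains t where "N \<le> card {z \<in> Z. \<tau> z = t}"
proof -
  have "\<exists>t\<in>T. N \<le> card {z \<in> Z. \<tau> z = t}"
  proof (rule ccontr)
    assume "\<not> ?thesis"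
    then have less: "card {z \<in> Z. \<tau> z = t} < N" if "t \<in> T" for t
      using that by (simp add: not_le)
    have "Z = (\<Union>t\<in>T. {z \<in> Z. \<tau> z = t})"
      using assms(4) by auto
    then have "card Z \<le> (\<Sum>t\<in>T. card {z \<in> Z. \<tau> z = t})"
      using card_UN_le[OF assms(2), of "\<lambda>t. {z \<in> Z. \<tau> z = t}"] by simp
    also have "\<dots> < (\<Sum>t\<in>T. N)"
      using assms(2,3) less by (intro sum_strict_mono) auto
    finally show False using assms(5) by (simp add: mult.commute)
  qed
  then show ?thesis using that by blast
qed

text \<open>To be read for one region: \<open>V\<close> are its values in the datatype map,
  \<open>U\<close> its elements in the model, \<open>c\<close> places the constants, \<tau> is the
  role type. The type map \<open>g\<close> is fixed before \<open>F\<close>; only the injection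
  \<open>h\<close> depends on \<open>F\<close>. If \<open>V\<close> fits into \<open>U\<close>, one
  injection serves every \<open>F\<close>. Otherwise a single type with \<open>N\<close>
  realizations outside the constants is given to all other values.\<close>

lemma local_injections:
  fixes c :: "'v \<Rightarrow> 'u" and \<tau> :: "'u \<Rightarrow> 't"
  assumes C: "finite C" "C \<subseteq> V" "inj_on c C" "c ` C \<subseteq> U"
    and T: "finite T" "T \<noteq> {}" "\<tau> ` U \<subseteq> T" and N: "1 \<le> N"
    and size: "(finite V \<and> (\<exists>W\<subseteq>U. finite W \<and> card V \<le> card W)) \<or>
      (\<exists>W\<subseteq>U. finite W \<and> N * card T + card C \<le> card W)"
  shows "\<exists>g. \<forall>F. finite F \<longrightarrow> F \<subseteq> V \<longrightarrow> card F \<le> N \<longrightarrow>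
    (\<exists>h. inj_on h (F \<union> C) \<and> h ` (F \<union> C) \<subseteq> U \<and> (\<forall>v\<in>C. h v = c v) \<and> (\<forall>v\<in>F \<union> C. \<tau> (h v) = \<tau> (g v)))"
  using size
proof (elim disjE conjE exE)
  fix W assume V: "finite V" and W: "W \<subseteq> U" "finite W" "card V \<le> card W"
  have "card (V - C) = card V - card C"
    using C(1,2) by (rule card_Diff_subset)
  also have "\<dots> \<le> card W - card (c ` C)"
    using W(3) card_image[OF C(3)] by simp
  also have "\<dots> \<le> card (W - c ` C)"
    using C(1) by (intro diff_card_le_card_Diff) simp
  finally obtain e where e: "e ` (V - C) \<subseteq> W - c ` C" "inj_on e (V - C)"
    using V W(2) by (metis card_le_inj finite_Diff)
  define h where "h = (\<lambda>v. if v \<in> C then c v else e v)"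
  have "inj_on h (V - C \<union> C)"
    unfolding h_def using C(3) e by (intro inj_on_if) auto
  then have "inj_on h V"
    using C(2) by (simp add: Un_absorb2)
  moreover have "h ` V \<subseteq> U"
    using e(1) W(1) C(4) by (auto simp: h_def)
  moreover have hC: "\<forall>v\<in>C. h v = c v"
    by (simp add: h_def)
  ultimately have "inj_on h (F \<union> C) \<and> h ` (F \<union> C) \<subseteq> U \<and> (\<forall>v\<in>C. h v = c v)" if "F \<subseteq> V" for F
  proof -
    have "F \<union> C \<subseteq> V" using that C(2) by blast
    then show ?thesis
      using \<open>inj_on h V\<close> \<open>h ` V \<subseteq> U\<close> by (meson hC image_mono inj_on_subset subset_trans)
  qed
  then show ?thesis by (intro exI[of _ h]) blast
next
  fix W assume W: "W \<subseteq> U" "finite W" "N * card T + card C \<le> card W"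
  \<comment> \<open>Images of constants are removed first, so that the fibre found below cannot
    collide with them.\<close>
  have "N * card T \<le> card W - card (c ` C)"
    using W(3) card_image[OF C(3)] by simp
  also have "\<dots> \<le> card (W - c ` C)"
    using C(1) by (intro diff_card_le_card_Diff) simp
  finally obtain t where t: "N \<le> card {z \<in> W - c ` C. \<tau> z = t}"
    using pigeonhole_fibre[of "W - c ` C" T \<tau> N] T W(1,2) by blast
  define Z where "Z = {z \<in> W - c ` C. \<tau> z = t}"
  have Z: "finite Z" "N \<le> card Z" "Z \<subseteq> U" "Z \<inter> c ` C = {}" "\<And>z. z \<in> Z \<Longrightarrow> \<tau> z = t"
    using W t by (auto simp: Z_def)
  then obtain z0 where z0: "z0 \<in> Z"
    using N by fastforce
  \<comment> \<open>Far from injective: \<open>z0\<close> merely represents the type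
    \<open>t\<close>.\<close>
  define g where "g = (\<lambda>v. if v \<in> C then c v else z0)"
  show ?thesis
  proof (rule exI[of _ g], intro allI impI)
    fix F assume F: "finite F" "F \<subseteq> V" "card F \<le> N"
    have "card (F - C) \<le> card Z"
      using F(1,3) Z(2) by (meson card_mono Diff_subset le_trans)
    then obtain e where e: "e ` (F - C) \<subseteq> Z" "inj_on e (F - C)"
      using F(1) Z(1) by (metis card_le_inj finite_Diff)
    define h where "h = (\<lambda>v. if v \<in> C then c v else e v)"
    have "inj_on h (F - C \<union> C)"
      unfolding h_def using C(3) e Z(4) by (intro inj_on_if) auto
    then have "inj_on h (F \<union> C)" by simp
    moreover have "h ` (F \<union> C) \<subseteq> U"
      using e(1) Z(3) C(4) by (auto simp: h_def)
    moreover have "\<tau> (h v) = \<tau> (g v)" if "v \<in> F \<union> C" for v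
      using that e(1) Z(5) z0 by (auto simp: h_def g_def image_subset_iff)
    ultimately show "\<exists>h. inj_on h (F \<union> C) \<and> h ` (F \<union> C) \<subseteq> U \<and> (\<forall>v\<in>C. h v = c v) \<and>
        (\<forall>v\<in>F \<union> C. \<tau> (h v) = \<tau> (g v))"
      by (intro exI[of _ h]) (auto simp: h_def)
  qed
qed

section \<open>What a model of the formula provides\<close>

locale kb_model = kb_over_map D K for D :: "('n, 'v) datatype_map" and K :: "'n kb" +
  fixes M :: "('u, 'n var0, 'n var1, nat, 'n var3) lqs_interp"
  assumes lqs: "is_lqs_interp M" and model: "psat (sat_comp3 M) (kb_formula D K)"
begin

abbreviation Sy :: "'n sym set" where
  "Sy \<equiv> set (sy_kb K)"

lemma v1_dmn: "u \<in> v1 M Y \<Longrightarrow> u \<in> dmn M"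
  using lqs by (auto simp: is_lqs_interp_def)

lemma axiom: "g \<in> set domain_axioms \<union> set (kb_axioms D K) \<Longrightarrow> psat (sat_comp3 M) g"
  using model unfolding psat_kb_formula by blast

lemma ex_abs: "\<exists>u. u \<in> v1 M XAbs" and ex_data: "\<exists>u. u \<in> v1 M XData"
  and abs_data_disjoint: "u \<in> v1 M XAbs \<Longrightarrow> u \<notin> v1 M XData"
proof -
  have "\<forall>g\<in>set domain_axioms. psat (sat_comp3 M) g" using axiom by blast
  then show "\<exists>u. u \<in> v1 M XAbs" "\<exists>u. u \<in> v1 M XData" "u \<in> v1 M XAbs \<Longrightarrow> u \<notin> v1 M XData"
    using v1_dmn by (auto simp: domain_axioms_def allq_def)
qed

lemma sym_axiom_holds: "s \<in> Sy \<Longrightarrow> psat (sat_comp3 M) (sym_axiom s)"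
  using axiom by simp

lemma ind_abs: "SInd a \<in> Sy \<Longrightarrow> v0 M (XInd a) \<in> v1 M XAbs"
  using sym_axiom_holds by fastforce

lemma concept_abs: "\<lbrakk>SConcept A \<in> Sy; u \<in> v1 M (XConcept A)\<rbrakk> \<Longrightarrow> u \<in> v1 M XAbs"
  using sym_axiom_holds[of "SConcept A"] v1_dmn by (auto simp: allq_def)

lemma pred_data: "\<lbrakk>SPred p \<in> Sy; u \<in> v1 M (XPred p)\<rbrakk> \<Longrightarrow> u \<in> v1 M XData"
  using sym_axiom_holds[of "SPred p"] v1_dmn by (auto simp: allq_def)

lemma arole_abs:
  "\<lbrakk>SARole S \<in> Sy; u \<in> dmn M; w \<in> dmn M; kpair u w \<in> v3 M (XARole S)\<rbrakk> \<Longrightarrow>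
     u \<in> v1 M XAbs \<and> w \<in> v1 M XAbs"
  using sym_axiom_holds[of "SARole S"] by (auto simp: allq_def)

lemma crole_abs_data:
  "\<lbrakk>SCRole T \<in> Sy; u \<in> dmn M; w \<in> dmn M; kpair u w \<in> v3 M (XCRole T)\<rbrakk> \<Longrightarrow>
     u \<in> v1 M XAbs \<and> w \<in> v1 M XData"
  using sym_axiom_holds[of "SCRole T"] by (auto simp: allq_def)

lemma const_region:
  "SConst d e \<in> Sy \<Longrightarrow> v0 M (XConst d e) \<in> v1 M XData"
  "\<lbrakk>SConst d e \<in> Sy; SPred p \<in> Sy\<rbrakk> \<Longrightarrow> v0 M (XConst d e) \<in> v1 M (XPred p) \<longleftrightarrow> constI D d e \<in> dpredS D p"
  "\<lbrakk>SConst d e \<in> Sy; SConst d' e' \<in> Sy\<rbrakk> \<Longrightarrow>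
     v0 M (XConst d e) = v0 M (XConst d' e') \<longleftrightarrow> constI D d e = constI D d' e'"
proof -
  have "\<forall>g\<in>set (const_axioms D K). psat (sat_comp3 M) g" using axiom by simp
  note * = this[unfolded psat_const_axioms set_kb_constants set_dpreds]
  show "SConst d e \<in> Sy \<Longrightarrow> v0 M (XConst d e) \<in> v1 M XData"
    using * by blast
  show "\<lbrakk>SConst d e \<in> Sy; SPred p \<in> Sy\<rbrakk> \<Longrightarrow> v0 M (XConst d e) \<in> v1 M (XPred p) \<longleftrightarrow> constI D d e \<in> dpredS D p"
    using * by blast
  show "\<lbrakk>SConst d e \<in> Sy; SConst d' e' \<in> Sy\<rbrakk> \<Longrightarrow>
     v0 M (XConst d e) = v0 M (XConst d' e') \<longleftrightarrow> constI D d e = constI D d' e'"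
    using * by blast
qed

lemma region_witnesses:
  assumes "S \<in> set (subseqs (dpreds K))"
  shows "\<exists>W. finite W \<and> card W = cap S \<and>
    W \<subseteq> {u \<in> v1 M XData. \<forall>p\<in>set (dpreds K). u \<in> v1 M (XPred p) \<longleftrightarrow> p \<in> set S}"
proof -
  have "\<forall>g\<in>set (region_axioms D K). psat (sat_comp3 M) g" using axiom by simp
  then have *: "\<forall>j<cap S. v0 M (XWit S j) \<in> v1 M XData \<and>
          (\<forall>p\<in>set (dpreds K). v0 M (XWit S j) \<in> v1 M (XPred p) \<longleftrightarrow> p \<in> set S)"
    "inj_on (\<lambda>j. v0 M (XWit S j)) {..<cap S}"
    using assms unfolding psat_region_axioms by blast+
  show ?thesis
    using * card_image[OF *(2)] by (intro exI[of _ "(\<lambda>j. v0 M (XWit S j)) ` {..<cap S}"]) auto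
qed

definition abs0 :: "'u set" where
  "abs0 = insert (SOME u. u \<in> v1 M XAbs) {v0 M (XInd a) | a. SInd a \<in> Sy}"

definition croles :: "'n set" where
  "croles = {T. SCRole T \<in> Sy}"

text \<open>The atomic type of \<open>u\<close> over \<open>abs0\<close> with respect to the
  concrete role names. Being a subset of \<open>abs0 \<times> croles\<close>, it takes at most
  \<open>2 ^ (card abs0 * card croles)\<close> values.\<close>

definition rtype :: "'u \<Rightarrow> ('u \<times> 'n) set" where
  "rtype u = {(a, T). a \<in> abs0 \<and> T \<in> croles \<and> kpair a u \<in> v3 M (XCRole T)}"

definition cvals :: "'v set" where
  "cvals = {constI D d e | d e. SConst d e \<in> Sy}"

text \<open>The sum is a convenient upper bound for each single number, so \<open>max_num\<close>
  dominates \<open>tnum s + 3\<close> for every \<open>s\<close> in the TBox.\<close>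

definition max_num :: nat where
  "max_num = sum_list (map tnum (tbox K)) + 3"

lemma abs0_abs: "abs0 \<subseteq> v1 M XAbs"
  using ex_abs ind_abs by (auto simp: abs0_def intro: someI_ex)

lemma abs0_card: "finite abs0" "card abs0 \<le> Suc (length (sy_kb K))"
proof -
  let ?u = "SOME u. u \<in> v1 M XAbs"
  let ?g = "\<lambda>s. case s of SInd a \<Rightarrow> v0 M (XInd a) | _ \<Rightarrow> ?u"
  have sub: "abs0 \<subseteq> insert ?u (?g ` Sy)"
    by (force simp: abs0_def image_iff)
  then show "finite abs0" by (rule finite_subset) simp
  have "card abs0 \<le> card (insert ?u (?g ` Sy))"
    using sub by (intro card_mono) auto
  also have "\<dots> \<le> Suc (card (?g ` Sy))"
    by (simp add: card_insert_if)
  also have "card (?g ` Sy) \<le> length (sy_kb K)"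
    by (meson List.finite_set card_image_le card_length le_trans)
  finally show "card abs0 \<le> Suc (length (sy_kb K))" by simp
qed

lemma croles_card: "finite croles" "card croles \<le> length (sy_kb K)"
proof -
  have sub: "SCRole ` croles \<subseteq> Sy" and inj: "inj_on SCRole croles"
    by (auto simp: croles_def inj_on_def)
  show "finite croles"
    using sub inj by (meson List.finite_set finite_imageD finite_subset)
  have "card croles \<le> card Sy"
    using sub inj by (intro card_inj_on_le[of SCRole]) auto
  then show "card croles \<le> length (sy_kb K)"
    using card_length le_trans by blast
qed

lemma cvals_card: "finite cvals" "card cvals \<le> length (sy_kb K)"
proof -
  let ?g = "\<lambda>s. case s of SConst d e \<Rightarrow> constI D d e | _ \<Rightarrow> undefined"
  have sub: "cvals \<subseteq> ?g ` Sy"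
    by (force simp: cvals_def image_iff)
  then show "finite cvals" by (rule finite_subset) simp
  have "card cvals \<le> card (?g ` Sy)"
    using sub by (intro card_mono) auto
  also have "\<dots> \<le> length (sy_kb K)"
    by (meson List.finite_set card_image_le card_length le_trans)
  finally show "card cvals \<le> length (sy_kb K)" .
qed

text \<open>With \<open>n\<close> symbols and \<open>L = n + 1\<close> there are at most
  \<open>L\<close> abstract elements and \<open>n\<close> role names, hence at most
  \<open>2 ^ (L * n)\<close> types. The gap between \<open>L * n\<close> and \<open>L * L\<close> is
  at least 1, and the resulting factor 2 absorbs the step from \<open>max_num\<close> to twice
  \<open>?s + 2\<close>.\<close>

lemma bound_suffices: "max_num * card (Pow (abs0 \<times> croles)) + card cvals \<le> bound K"
proof -
  let ?n = "length (sy_kb K)"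
  let ?s = "sum_list (map tnum (tbox K))"
  have "card (abs0 \<times> croles) \<le> Suc ?n * ?n"
    using abs0_card croles_card by (simp add: card_cartesian_product mult_le_mono del: mult_Suc)
  then have P: "card (Pow (abs0 \<times> croles)) \<le> 2 ^ (Suc ?n * ?n)"
    using abs0_card croles_card by (simp add: card_Pow del: mult_Suc)
  have "max_num \<le> (?s + 2) * 2"
    by (simp add: max_num_def)
  then have "max_num * card (Pow (abs0 \<times> croles)) \<le> ((?s + 2) * 2) * 2 ^ (Suc ?n * ?n)"
    using P by (rule mult_le_mono)
  also have "\<dots> = (?s + 2) * 2 ^ (Suc (Suc ?n * ?n))"
    by simp
  also have "\<dots> \<le> (?s + 2) * 2 ^ (Suc ?n * Suc ?n)"
    by (intro mult_le_mono2 power_increasing) simp_all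
  finally show ?thesis
    using cvals_card by (simp add: bound_def Let_def)
qed

end


lemma (in kb_over_map) pred_values: "SPred p \<in> set (sy_kb K) \<Longrightarrow> values_of \<noteq> {}"
  using datatype_map kb
  by (cases p) (fastforce simp: is_datatype_map_def kb_over_def values_of_def)+

context kb_model
begin

text \<open>If \<open>D\<close> has no datatypes, any one value will do, as interpretations need a nonempty concrete domain.\<close>

definition dom_values :: "'v set" where
  "dom_values = (if values_of = {} then {undefined} else values_of)"

section \<open>Regions and constants in the model, and local embeddings of values\<close>

definition preds_of :: "'v \<Rightarrow> 'n dpred set" where
  "preds_of v = {p. SPred p \<in> Sy \<and> v \<in> dpredS D p}"

definition preds_at :: "'u \<Rightarrow> 'n dpred set" where
  "preds_at u = {p. SPred p \<in> Sy \<and> u \<in> v1 M (XPred p)}"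

text \<open>Independent of the choice: by the constant axioms, constants with the same value in
  \<open>D\<close> have the same value in \<open>M\<close>. The converse implication makes it
  injective.\<close>

definition cval :: "'v \<Rightarrow> 'u" where
  "cval v = (SOME u. \<exists>d e. SConst d e \<in> Sy \<and> constI D d e = v \<and> u = v0 M (XConst d e))"

lemma cval_const: "SConst d e \<in> Sy \<Longrightarrow> cval (constI D d e) = v0 M (XConst d e)"
  unfolding cval_def by (rule some_equality) (auto simp: const_region(3))

lemma cval_cvals:
  "inj_on cval cvals" "v \<in> cvals \<Longrightarrow> cval v \<in> v1 M XData" "v \<in> cvals \<Longrightarrow> preds_at (cval v) = preds_of v"
  "cvals \<subseteq> dom_values"
proof -
  show "inj_on cval cvals"
    by (auto simp: inj_on_def cvals_def cval_const const_region(3))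
  show "v \<in> cvals \<Longrightarrow> cval v \<in> v1 M XData"
    by (auto simp: cvals_def cval_const const_region(1))
  show "v \<in> cvals \<Longrightarrow> preds_at (cval v) = preds_of v"
    by (auto simp: cvals_def cval_const const_region(2) preds_at_def preds_of_def)
  show "cvals \<subseteq> dom_values"
    using const_in_values by (auto simp: cvals_def dom_values_def)
qed

text \<open>The witnesses number \<open>capped_card (bound K)\<close> of the region: if the cap is
  not reached they are as many as its values, and otherwise there are \<open>bound K\<close> of
  them.\<close>

lemma region_size:
  defines "V r \<equiv> {v \<in> dom_values. preds_of v = r}"
    and "U r \<equiv> {u \<in> v1 M XData. preds_at u = r}"
  shows "(finite (V r) \<and> (\<exists>W\<subseteq>U r. finite W \<and> card (V r) \<le> card W)) \<or>
    (\<exists>W\<subseteq>U r. finite W \<and> bound K \<le> card W)"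
proof (cases "V r = {}")
  case True
  then show ?thesis by (intro disjI1 conjI exI[of _ "{}"]) auto
next
  case ne: False
  show ?thesis
  proof (cases "values_of = {}")
    case True
    \<comment> \<open>Datatypes are nonempty, so without values no predicate occurs in
      \<open>K\<close>. The artificial value then lies in the region without predicates, and any
      element of \<open>XData\<close> can be its image.\<close>
    then have "r = {}"
      using ne pred_values by (auto simp: V_def preds_of_def)
    moreover obtain u where "u \<in> v1 M XData" using ex_data by blast
    ultimately have "{u} \<subseteq> U r"
      using True pred_values by (auto simp: U_def preds_at_def)
    moreover have "V r \<subseteq> {undefined}"
      using True by (auto simp: V_def dom_values_def)
    then have "finite (V r)" "card (V r) \<le> card {u}"
      using card_mono[of "{undefined}" "V r"] by (auto intro: finite_subset)
    ultimately show ?thesis by (intro disjI1 conjI exI[of _ "{u}"]) auto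
  next
    case False
    have "r \<in> Pow (set (dpreds K))"
      using ne by (auto simp: V_def preds_of_def set_dpreds)
    then obtain S where S: "S \<in> set (subseqs (dpreds K))" "set S = r"
      using subseqs_powset[of "dpreds K"] by (metis imageE)
    have "preds_of v = r \<longleftrightarrow> (\<forall>p\<in>set (dpreds K). v \<in> dpredS D p \<longleftrightarrow> p \<in> set S)" for v
      using S(2) \<open>r \<in> Pow _\<close> unfolding preds_of_def set_dpreds by blast
    moreover have "dom_values = (\<Union>d\<in>ND D. dtI D d)"
      using False by (simp add: dom_values_def values_of_def)
    ultimately have r: "V r = region D (dpreds K) S"
      by (simp add: V_def region_def)
    obtain W where W: "finite W" "card W = cap S"
      "W \<subseteq> {u \<in> v1 M XData. \<forall>p\<in>set (dpreds K). u \<in> v1 M (XPred p) \<longleftrightarrow> p \<in> set S}"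
      using region_witnesses[OF S(1)] by blast
    have "preds_at u = r \<longleftrightarrow> (\<forall>p\<in>set (dpreds K). u \<in> v1 M (XPred p) \<longleftrightarrow> p \<in> set S)" for u
      using S(2) \<open>r \<in> Pow _\<close> unfolding preds_at_def set_dpreds by blast
    then have "W \<subseteq> U r"
      using W(3) by (simp add: U_def)
    then show ?thesis
      using W(1,2) unfolding r[symmetric] capped_card_def
      by (metis (no_types, lifting) min_def order_refl)
  qed
qed

text \<open>The injections of the individual regions are glued along \<open>preds_of\<close>. Images
  from different regions cannot meet, because they satisfy different predicates.\<close>

lemma local_embeddings:
  "\<exists>g. \<forall>F. finite F \<longrightarrow> F \<subseteq> dom_values \<longrightarrow> card F \<le> max_num \<longrightarrow>
    (\<exists>h. inj_on h (F \<union> cvals) \<and> h ` (F \<union> cvals) \<subseteq> v1 M XData \<and> (\<forall>v\<in>cvals. h v = cval v) \<and>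
      (\<forall>v\<in>F \<union> cvals. preds_at (h v) = preds_of v \<and> rtype (h v) = rtype (g v)))"
proof -
  define V where "V r = {v \<in> dom_values. preds_of v = r}" for r
  define U where "U r = {u \<in> v1 M XData. preds_at u = r}" for r
  define C where "C r = cvals \<inter> V r" for r
  have "\<exists>g. \<forall>F. finite F \<longrightarrow> F \<subseteq> V r \<longrightarrow> card F \<le> max_num \<longrightarrow>
    (\<exists>h. inj_on h (F \<union> C r) \<and> h ` (F \<union> C r) \<subseteq> U r \<and> (\<forall>v\<in>C r. h v = cval v) \<and>
      (\<forall>v\<in>F \<union> C r. rtype (h v) = rtype (g v)))" for r
  proof (rule local_injections[where T = "Pow (abs0 \<times> croles)"])
    show "finite (C r)" "C r \<subseteq> V r" "inj_on cval (C r)" "cval ` C r \<subseteq> U r"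
      using cvals_card(1) cval_cvals by (auto simp: C_def U_def V_def intro: inj_on_subset)
    show "finite (Pow (abs0 \<times> croles))" "Pow (abs0 \<times> croles) \<noteq> {}"
      using abs0_card croles_card by auto
    show "rtype ` U r \<subseteq> Pow (abs0 \<times> croles)"
      by (auto simp: rtype_def)
    show "1 \<le> max_num"
      by (simp add: max_num_def)
    have "card (C r) \<le> card cvals"
      using cvals_card(1) by (intro card_mono) (auto simp: C_def)
    then have "max_num * card (Pow (abs0 \<times> croles)) + card (C r) \<le> bound K"
      using bound_suffices by linarith
    then show "(finite (V r) \<and> (\<exists>W\<subseteq>U r. finite W \<and> card (V r) \<le> card W)) \<or>
      (\<exists>W\<subseteq>U r. finite W \<and> max_num * card (Pow (abs0 \<times> croles)) + card (C r) \<le> card W)"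
      using region_size[of r] unfolding V_def[symmetric] U_def[symmetric] by (meson le_trans)
  qed
  then obtain G where G: "\<And>r F. finite F \<Longrightarrow> F \<subseteq> V r \<Longrightarrow> card F \<le> max_num \<Longrightarrow>
    (\<exists>h. inj_on h (F \<union> C r) \<and> h ` (F \<union> C r) \<subseteq> U r \<and> (\<forall>v\<in>C r. h v = cval v) \<and>
      (\<forall>v\<in>F \<union> C r. rtype (h v) = rtype (G r v)))"
    by metis
  show ?thesis
  proof (rule exI[of _ "\<lambda>v. G (preds_of v) v"], intro allI impI)
    fix F assume F: "finite F" "F \<subseteq> dom_values" "card F \<le> max_num"
    have "card (F \<inter> V r) \<le> max_num" for r
      using F by (meson card_mono inf_le1 le_trans)
    then have "\<forall>r. \<exists>h. inj_on h (F \<inter> V r \<union> C r) \<and> h ` (F \<inter> V r \<union> C r) \<subseteq> U r \<and>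
        (\<forall>v\<in>C r. h v = cval v) \<and> (\<forall>v\<in>F \<inter> V r \<union> C r. rtype (h v) = rtype (G r v))"
      using F(1) by (intro allI G) auto
    from choice[OF this] obtain H where *: "\<forall>r. inj_on (H r) (F \<inter> V r \<union> C r) \<and>
        H r ` (F \<inter> V r \<union> C r) \<subseteq> U r \<and> (\<forall>v\<in>C r. H r v = cval v) \<and>
        (\<forall>v\<in>F \<inter> V r \<union> C r. rtype (H r v) = rtype (G r v))"
      by (rule exE)
    have H: "inj_on (H r) (F \<inter> V r \<union> C r)" "H r ` (F \<inter> V r \<union> C r) \<subseteq> U r"
        "\<And>v. v \<in> C r \<Longrightarrow> H r v = cval v"
        "\<And>v. v \<in> F \<inter> V r \<union> C r \<Longrightarrow> rtype (H r v) = rtype (G r v)" for r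
      using *[rule_format, of r] by simp_all
    define h where "h v = H (preds_of v) v" for v
    have in_V: "v \<in> F \<inter> V (preds_of v) \<union> C (preds_of v)" if "v \<in> F \<union> cvals" for v
      using that F(2) cval_cvals(4) by (auto simp: V_def C_def)
    have in_U: "h v \<in> U (preds_of v)" if "v \<in> F \<union> cvals" for v
      using H(2) in_V[OF that] unfolding h_def by blast
    have "inj_on h (F \<union> cvals)"
    proof (rule inj_onI)
      fix x y assume xy: "x \<in> F \<union> cvals" "y \<in> F \<union> cvals" "h x = h y"
      then have "preds_of x = preds_of y"
        using in_U[of x] in_U[of y] by (simp add: U_def)
      then show "x = y"
        using H(1)[of "preds_of x"] in_V[OF xy(1)] in_V[OF xy(2)] xy(3)
        unfolding h_def by (metis inj_onD)
    qed
    moreover have "h ` (F \<union> cvals) \<subseteq> v1 M XData"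
      using in_U by (auto simp: U_def)
    moreover have "\<forall>v\<in>cvals. h v = cval v"
      using H(3) cval_cvals(4) by (auto simp: h_def C_def V_def)
    moreover have "\<forall>v\<in>F \<union> cvals. preds_at (h v) = preds_of v"
      using in_U by (simp add: U_def)
    moreover have "\<forall>v\<in>F \<union> cvals. rtype (h v) = rtype (G (preds_of v) v)"
      using H(4) in_V unfolding h_def by blast
    ultimately show "\<exists>h. inj_on h (F \<union> cvals) \<and> h ` (F \<union> cvals) \<subseteq> v1 M XData \<and> (\<forall>v\<in>cvals. h v = cval v) \<and>
      (\<forall>v\<in>F \<union> cvals. preds_at (h v) = preds_of v \<and> rtype (h v) = rtype (G (preds_of v) v))"
      by blast
  qed
qed

text \<open>Only the role type of \<open>data_map v\<close> is ever used; injectivity is left to the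
  maps \<open>h\<close>.\<close>

definition data_map :: "'v \<Rightarrow> 'u" where
  "data_map = (SOME g. \<forall>F. finite F \<longrightarrow> F \<subseteq> dom_values \<longrightarrow> card F \<le> max_num \<longrightarrow>
    (\<exists>h. inj_on h (F \<union> cvals) \<and> h ` (F \<union> cvals) \<subseteq> v1 M XData \<and> (\<forall>v\<in>cvals. h v = cval v) \<and>
      (\<forall>v\<in>F \<union> cvals. preds_at (h v) = preds_of v \<and> rtype (h v) = rtype (g v))))"

lemma data_map:
  assumes "finite F" and "F \<subseteq> dom_values" and "card F \<le> max_num"
  shows "\<exists>h. inj_on h (F \<union> cvals) \<and> h ` (F \<union> cvals) \<subseteq> v1 M XData \<and> (\<forall>v\<in>cvals. h v = cval v) \<and>
      (\<forall>v\<in>F \<union> cvals. preds_at (h v) = preds_of v \<and> rtype (h v) = rtype (data_map v))"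
  using someI_ex[OF local_embeddings, folded data_map_def, rule_format, OF assms] .

section \<open>The description logic interpretation read off from the model\<close>

context
  fixes \<alpha> :: "'u \<Rightarrow> 'i"
  assumes inj: "inj_on \<alpha> abs0"
begin

text \<open>The abstract part is copied from \<open>M\<close> along \<alpha>; the concrete part
  consists of actual values, each bearing the roles of its image under \<open>data_map\<close>.
  Individuals foreign to \<open>K\<close> share the chosen element of \<open>XAbs\<close>, which
  belongs to \<open>abs0\<close>.\<close>

definition dl_of :: "('n, 'i, 'v) dl_interp" where
  "dl_of = \<lparr>aDom = \<alpha> ` abs0, dDom = dom_values,
     conceptI = (\<lambda>A. \<alpha> ` (abs0 \<inter> v1 M (XConcept A))),
     aroleI = (\<lambda>S. {(\<alpha> a, \<alpha> b) | a b. a \<in> abs0 \<and> b \<in> abs0 \<and> kpair a b \<in> v3 M (XARole S)}),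
     croleI = (\<lambda>T. {(\<alpha> a, v) | a v. a \<in> abs0 \<and> v \<in> dom_values \<and> kpair a (data_map v) \<in> v3 M (XCRole T)}),
     indI = (\<lambda>a. \<alpha> (if SInd a \<in> Sy then v0 M (XInd a) else SOME u. u \<in> v1 M XAbs))\<rparr>"

lemma dl_of_simps [simp]:
  "aDom dl_of = \<alpha> ` abs0" "dDom dl_of = dom_values"
  "conceptI dl_of A = \<alpha> ` (abs0 \<inter> v1 M (XConcept A))"
  "SInd a \<in> Sy \<Longrightarrow> indI dl_of a = \<alpha> (v0 M (XInd a))"
  by (auto simp: dl_of_def)

lemma roles_dl_of [simp]:
  "\<lbrakk>a \<in> abs0; b \<in> abs0\<rbrakk> \<Longrightarrow> (\<alpha> a, \<alpha> b) \<in> aroleI dl_of S \<longleftrightarrow> kpair a b \<in> v3 M (XARole S)"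
  "\<lbrakk>a \<in> abs0; v \<in> dom_values\<rbrakk> \<Longrightarrow>
    (\<alpha> a, v) \<in> croleI dl_of T \<longleftrightarrow> kpair a (data_map v) \<in> v3 M (XCRole T)"
  using inj by (auto simp: dl_of_def dest: inj_onD)

lemma is_dl_interp_dl_of: "is_dl_interp D dl_of"
  by (auto simp: is_dl_interp_def dl_of_def abs0_def dom_values_def values_of_def)

text \<open>By the sort axioms, atoms applied to elements of the wrong kind are false on both sides.
  For a concrete role, \<open>dl_of\<close> consults \<open>data_map v\<close> where
  \<open>M\<close> sees the image of \<open>v\<close>; both have the same \<open>rtype\<close>, and
  this decides the atom for every element of \<open>abs0\<close>.\<close>

lemma partial_iso_dl_of:
  assumes "finite F" and "F \<subseteq> dom_values" and "card F \<le> max_num"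
  shows "\<exists>h. partial_iso Sy (named Sy) (dl_lqs D dl_of wit) M (Inl ` \<alpha> ` abs0 \<union> Inr ` (F \<union> cvals)) h"
proof -
  from data_map[OF assms] obtain k where
    "inj_on k (F \<union> cvals) \<and> k ` (F \<union> cvals) \<subseteq> v1 M XData \<and> (\<forall>v\<in>cvals. k v = cval v) \<and>
      (\<forall>v\<in>F \<union> cvals. preds_at (k v) = preds_of v \<and> rtype (k v) = rtype (data_map v))"
    by (rule exE)
  then have k: "inj_on k (F \<union> cvals)" "k ` (F \<union> cvals) \<subseteq> v1 M XData"
    "\<And>v. v \<in> cvals \<Longrightarrow> k v = cval v" "\<And>v. v \<in> F \<union> cvals \<Longrightarrow> preds_at (k v) = preds_of v"
    "\<And>v. v \<in> F \<union> cvals \<Longrightarrow> rtype (k v) = rtype (data_map v)"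
    by simp_all
  let ?M = "dl_lqs D dl_of wit"
  let ?F = "F \<union> cvals"
  let ?E = "Inl ` \<alpha> ` abs0 \<union> Inr ` ?F"
  define h where "h = case_sum (inv_into abs0 \<alpha>) k"
  have hl: "h (Inl (\<alpha> a)) = a" if "a \<in> abs0" for a
    using that inj by (simp add: h_def)
  have hr: "h (Inr v) = k v" for v
    by (simp add: h_def)
  have l: "a \<in> v1 M XAbs" "a \<notin> v1 M XData" "a \<in> dmn M" if "a \<in> abs0" for a
    using that abs0_abs abs_data_disjoint v1_dmn by blast+
  have r: "k v \<in> v1 M XData" "k v \<notin> v1 M XAbs" "k v \<in> dmn M" "v \<in> dom_values" if "v \<in> ?F" for v
  proof -
    show *: "k v \<in> v1 M XData" using k(2) that by blast
    then show "k v \<notin> v1 M XAbs" "k v \<in> dmn M" using abs_data_disjoint v1_dmn by blast+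
    show "v \<in> dom_values" using that assms(2) cval_cvals(4) by blast
  qed
  have cases_E: P if "u \<in> ?E" "\<And>a. a \<in> abs0 \<Longrightarrow> u = Inl (\<alpha> a) \<Longrightarrow> P" "\<And>v. v \<in> ?F \<Longrightarrow> u = Inr v \<Longrightarrow> P"
    for u :: "'i + 'v" and P
    using that by blast
  have "inj_on h ?E"
  proof (rule inj_onI)
    fix u w assume "u \<in> ?E" "w \<in> ?E" and eq: "h u = h w"
    then show "u = w"
      by (elim cases_E) (use l r k(1) in \<open>auto simp: hl hr dest: inj_onD\<close>)
  qed
  moreover have "h ` ?E \<subseteq> dmn M"
    using l(3) r(3) by (auto simp: hl hr)
  moreover have "v0 ?M x \<in> ?E" "v0 M x = h (v0 ?M x)" if "x \<in> named Sy" for x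
  proof -
    from that consider a where "x = XInd a" "SInd a \<in> Sy" | d e where "x = XConst d e" "SConst d e \<in> Sy"
      by (auto simp: named_def)
    then have "v0 ?M x \<in> ?E \<and> v0 M x = h (v0 ?M x)"
    proof cases
      case (1 a)
      then have "v0 M x \<in> abs0" by (auto simp: abs0_def)
      then show ?thesis using 1 by (simp add: hl)
    next
      case (2 d e)
      then have "constI D d e \<in> cvals" by (auto simp: cvals_def)
      then show ?thesis using 2 k(3) by (simp add: hr cval_const)
    qed
    then show "v0 ?M x \<in> ?E" "v0 M x = h (v0 ?M x)" by blast+
  qed
  moreover have "u \<in> v1 ?M Y \<longleftrightarrow> h u \<in> v1 M Y" if "u \<in> ?E" "on1 Sy Y" for u Y
    using that(1)
  proof (rule cases_E)
    fix a assume a: "a \<in> abs0" "u = Inl (\<alpha> a)"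
    have "\<alpha> a \<in> \<alpha> ` (abs0 \<inter> X) \<longleftrightarrow> a \<in> X" for X
      using inj a(1) by (auto dest: inj_onD)
    moreover have "a \<notin> v1 M (XPred p)" if "SPred p \<in> Sy" for p
      using that a(1) l(2) pred_data by blast
    ultimately show ?thesis
      using that(2) a l by (cases Y) (auto simp: hl inj_image_mem_iff)
  next
    fix v assume v: "v \<in> ?F" "u = Inr v"
    have "k v \<notin> v1 M (XConcept A)" if "SConcept A \<in> Sy" for A
      using that v(1) r(2) concept_abs by blast
    moreover have "v \<in> dpredS D p \<longleftrightarrow> k v \<in> v1 M (XPred p)" if "SPred p \<in> Sy" for p
      using k(4)[OF v(1)] that by (auto simp: preds_at_def preds_of_def)
    ultimately show ?thesis
      using that(2) v r by (cases Y) (auto simp: hr inj_image_mem_iff)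
  qed
  moreover have "kpair u w \<in> v3 ?M W \<longleftrightarrow> kpair (h u) (h w) \<in> v3 M W"
    if "u \<in> ?E" "w \<in> ?E" "on3 Sy W" for u w W
  proof (cases W)
    case (XARole S)
    then have S: "SARole S \<in> Sy" using that(3) by simp
    have "kpair a (k v) \<notin> v3 M (XARole S)" "kpair (k v) a \<notin> v3 M (XARole S)"
      if "a \<in> abs0" "v \<in> ?F" for a v
      using arole_abs[OF S] l(3)[OF that(1)] r(2,3)[OF that(2)] by blast+
    moreover have "kpair (k v) (k v') \<notin> v3 M (XARole S)" if "v \<in> ?F" "v' \<in> ?F" for v v'
      using arole_abs[OF S] r(3)[OF that(2)] r(2,3)[OF that(1)] by blast
    ultimately show ?thesis
      using that(1,2) unfolding XARole by (elim cases_E) (simp_all add: hl hr)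
  next
    case (XCRole T)
    then have T: "SCRole T \<in> Sy" using that(3) by simp
    have "kpair a a' \<notin> v3 M (XCRole T)" if "a \<in> abs0" "a' \<in> abs0" for a a'
      using crole_abs_data[OF T] l(3)[OF that(1)] l(2,3)[OF that(2)] by blast
    moreover have "kpair (k v) a \<notin> v3 M (XCRole T)" if "v \<in> ?F" "a \<in> abs0" for v a
      using crole_abs_data[OF T] r(2,3)[OF that(1)] l(3)[OF that(2)] by blast
    moreover have "kpair (k v) (k v') \<notin> v3 M (XCRole T)" if "v \<in> ?F" "v' \<in> ?F" for v v'
      using crole_abs_data[OF T] r(2,3)[OF that(1)] r(3)[OF that(2)] by blast
    moreover have "kpair a (data_map v) \<in> v3 M (XCRole T) \<longleftrightarrow> kpair a (k v) \<in> v3 M (XCRole T)"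
      if "a \<in> abs0" "v \<in> ?F" for a v
    proof -
      have "(a, T) \<in> rtype (data_map v) \<longleftrightarrow> (a, T) \<in> rtype (k v)"
        using k(5)[OF that(2)] by simp
      then show ?thesis using that(1) T by (simp add: rtype_def croles_def)
    qed
    ultimately show ?thesis
      using that(1,2) r(4) unfolding XCRole by (elim cases_E) (simp_all add: hl hr)
  qed
  ultimately have "partial_iso Sy (named Sy) ?M M ?E h"
    unfolding partial_iso_def by (intro conjI ballI allI impI) simp_all
  then show ?thesis by (rule exI[of _ h])
qed

lemma univ_over_dl_of:
  assumes "univ_over Sy (named Sy) max_num g" and "psat (sat_comp3 M) g"
  shows "psat (sat_comp3 (dl_lqs D dl_of wit)) g"
  using assms(1) unfolding univ_over_def
proof (elim disjE exE conjE)
  fix p assume p: "g = qfree p" "over Sy (named Sy) p"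
  \<comment> \<open>No extra values are needed: free variables denote individuals or constants,
    which are in the domain of every such map.\<close>
  obtain h where "partial_iso Sy (named Sy) (dl_lqs D dl_of wit) M (Inl ` \<alpha> ` abs0 \<union> Inr ` ({} \<union> cvals)) h"
    using partial_iso_dl_of[of "{}" wit] by auto
  then show ?thesis
    using assms(2) p partial_iso_psat by (metis psat_qfree)
next
  fix k p assume k: "k < max_num" and p: "g = allq k p" "over Sy (named Sy \<union> Q ` {..k}) p"
  show ?thesis
    unfolding p(1)
  proof (rule allq_transfer[OF assms(2)[unfolded p(1)] p(2)])
    fix f :: "'n var0 \<Rightarrow> 'i + 'v"
    assume f: "\<And>i. i \<le> k \<Longrightarrow> f (Q i) \<in> dmn (dl_lqs D dl_of wit)"
    \<comment> \<open>The values in the tuple. It has \<open>k + 1\<close> entries and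
      \<open>k < max_num\<close>, so \<open>F\<close> is small enough to be embedded.\<close>
    define F where "F = {v. Inr v \<in> f ` Q ` {..k}}"
    have sub: "Inr ` F \<subseteq> f ` Q ` {..k}" by (auto simp: F_def)
    have inj: "inj_on Inr F" by (simp add: inj_on_def)
    have fin: "finite F"
      using sub inj by (meson finite_atMost finite_imageD finite_imageI finite_subset)
    have "card F \<le> card (f ` Q ` {..k})"
      using sub inj by (intro card_inj_on_le) auto
    also have "\<dots> \<le> card {..k}"
      by (metis card_image_le finite_atMost image_image)
    finally have card: "card F \<le> max_num"
      using k by simp
    have "F \<subseteq> dom_values"
      using f by (force simp: F_def)
    then obtain h where h: "partial_iso Sy (named Sy) (dl_lqs D dl_of wit) M
        (Inl ` \<alpha> ` abs0 \<union> Inr ` (F \<union> cvals)) h"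
      using partial_iso_dl_of fin card by blast
    have "f (Q i) \<in> Inl ` \<alpha> ` abs0 \<union> Inr ` (F \<union> cvals)" if "i \<le> k" for i
    proof (cases "f (Q i)")
      case (Inl a)
      then show ?thesis using f[OF that] by auto
    next
      case (Inr v)
      then have "v \<in> F" using that by (force simp: F_def)
      then show ?thesis using Inr by simp
    qed
    then show "\<exists>E h. partial_iso Sy (named Sy) (dl_lqs D dl_of wit) M E h \<and> f ` Q ` {..k} \<subseteq> E"
      using h by blast
  qed
qed

text \<open>A chain may have more than \<open>max_num\<close> variables, but only abstract elements can violate it.\<close>

lemma chain_dl_of:
  assumes "set (sy_rstmt (RChain R1 Rs R)) \<subseteq> Sy" and "psat (sat_comp3 M) (tr_rstmt (RChain R1 Rs R))"
  shows "psat (sat_comp3 (dl_lqs D dl_of wit)) (tr_rstmt (RChain R1 Rs R))"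
proof -
  interpret dl_model D dl_of wit by unfold_locales (rule is_dl_interp_dl_of)
  let ?k = "Suc (length Rs)"
  show ?thesis
    unfolding tr_rstmt.simps
  proof (rule allq_transfer[OF assms(2)[unfolded tr_rstmt.simps]])
    show "over Sy (named Sy \<union> Q ` {..?k})
        (Imp (bigand [tr_arole ((R1 # Rs) ! i) (Q i) (Q (Suc i)). i \<leftarrow> [0..<?k]])
          (tr_arole R (Q 0) (Q ?k)))"
      using assms(1) by (intro over_chain) auto
  next
    fix f :: "'n var0 \<Rightarrow> 'i + 'v"
    assume f: "\<And>i. i \<le> ?k \<Longrightarrow> f (Q i) \<in> dmn (dl_lqs D dl_of wit)"
    let ?\<nu> = "override_on (v0 (dl_lqs D dl_of wit)) f (Q ` {..?k})"
    assume "\<not> sat0 ?\<nu>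
        (Imp (bigand [tr_arole ((R1 # Rs) ! i) (Q i) (Q (Suc i)). i \<leftarrow> [0..<?k]])
          (tr_arole R (Q 0) (Q ?k)))"
    then have "sat0 ?\<nu> (bigand [tr_arole ((R1 # Rs) ! i) (Q i) (Q (Suc i)). i \<leftarrow> [0..<?k]])"
      by (simp del: upt_Suc)
    then have "\<forall>i<?k. sat0 ?\<nu> (tr_arole ((R1 # Rs) ! i) (Q i) (Q (Suc i)))"
      by (subst (asm) psat_bigand) (simp_all del: upt_Suc sat_terms)
    then have abs: "\<forall>i<?k. \<exists>a b. f (Q i) = Inl a \<and> f (Q (Suc i)) = Inl b"
      by (auto simp: override_Q)
    have "f (Q i) \<in> Inl ` \<alpha> ` abs0" if "i \<le> ?k" for i
    proof -
      have "\<exists>a. f (Q i) = Inl a"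
        using abs that by (cases i) auto
      then show ?thesis using f[OF that] by auto
    qed
    moreover obtain h where "partial_iso Sy (named Sy) (dl_lqs D dl_of wit) M
        (Inl ` \<alpha> ` abs0 \<union> Inr ` ({} \<union> cvals)) h"
      using partial_iso_dl_of[of "{}" wit] by auto
    ultimately show "\<exists>E h. partial_iso Sy (named Sy) (dl_lqs D dl_of wit) M E h \<and> f ` Q ` {..?k} \<subseteq> E"
      by blast
  qed
qed

lemma dl_of_satisfies:
  "s \<in> set (rbox K) \<Longrightarrow> sat_rstmt D dl_of s"
  "t \<in> set (tbox K) \<Longrightarrow> sat_tstmt D dl_of t"
  "a \<in> set (abox K) \<Longrightarrow> sat_astmt D dl_of a"
proof -
  \<comment> \<open>Witness variables do not occur in translated statements, so an arbitrary
    \<open>wit\<close> will do.\<close>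
  fix wit :: "'n dpred list \<Rightarrow> nat \<Rightarrow> 'v"
  interpret dl_model D dl_of wit by unfold_locales (rule is_dl_interp_dl_of)
  have mono: "univ_over Sy (named Sy) max_num g" if "univ_over Sy (named Sy) n g" "n \<le> max_num" for n g
    using that by (auto simp: univ_over_def[of _ _ n] intro!: univ_over_qfree univ_over_allq)
  show "sat_rstmt D dl_of s" if s: "s \<in> set (rbox K)"
  proof -
    have M: "psat (sat_comp3 M) (tr_rstmt s)" using axiom s by simp
    have "sat (tr_rstmt s)"
    proof (cases "\<exists>R1 Rs R. s = RChain R1 Rs R")
      case True
      then show ?thesis using chain_dl_of sy_kb_subset(1)[OF s] M by blast
    next
      case False
      then have "univ_over Sy (named Sy) 3 (tr_rstmt s)"
        using univ_over_tr_rstmt[of Sy "named Sy" s] sy_kb_subset(1)[OF s] by blast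
      then show ?thesis
        using M by (intro univ_over_dl_of mono) (auto simp: max_num_def)
    qed
    then show ?thesis using sat_tr_rstmt by blast
  qed
  show "sat_tstmt D dl_of t" if t: "t \<in> set (tbox K)"
  proof -
    have "tnum t \<le> sum_list (map tnum (tbox K))"
      using t by (intro member_le_sum_list) simp_all
    moreover have "univ_over Sy (named Sy) (tnum t + 3) (tr_tstmt t)"
      using univ_over_tr_tstmt[of Sy "named Sy" t] sy_kb_subset(2)[OF t] by blast
    moreover have "psat (sat_comp3 M) (tr_tstmt t)" using axiom t by simp
    ultimately have "sat (tr_tstmt t)"
      by (intro univ_over_dl_of mono) (auto simp: max_num_def)
    then show ?thesis using sat_tr_tstmt_kb[OF is_dl_interp_dl_of t] by blast
  qed
  show "sat_astmt D dl_of a" if a: "a \<in> set (abox K)"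
  proof -
    have "univ_over Sy (named Sy) max_num (tr_astmt a)"
      using univ_over_tr_astmt[of Sy "named Sy" a] sy_kb_subset(3)[OF a] by blast
    moreover have "psat (sat_comp3 M) (tr_astmt a)" using axiom a by simp
    ultimately have "sat (tr_astmt a)" by (rule univ_over_dl_of)
    then show ?thesis using sat_tr_astmt by blast
  qed
qed

end

lemma consistent:
  assumes "infinite (UNIV :: 'i set)"
  shows "consistent TYPE('i) D K"
proof -
  obtain B :: "'i set" where "finite B" "card B = card abs0"
    using infinite_arbitrarily_large[OF assms] by metis
  then obtain \<alpha> :: "'u \<Rightarrow> 'i" where "inj_on \<alpha> abs0"
    using abs0_card(1) by (metis bij_betw_imp_inj_on finite_same_card_bij)
  then show ?thesis
    unfolding consistent_def
    using is_dl_interp_dl_of[of \<alpha>] dl_of_satisfies[of \<alpha>] by blast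
qed

end

text \<open>Each infinite type only has to host a finite set: \<open>'u\<close> a finite submodel,
  \<open>'i\<close> a copy of \<open>abs0\<close>. The possibly infinite concrete domain stays in
  the type \<open>'v\<close> of the datatype map.\<close>

theorem theorem1:
  fixes D :: "('n, 'v) datatype_map" and K :: "'n kb"
  assumes "is_datatype_map D"
    and "kb_over D K"
    and "infinite (UNIV :: 'u set)"
    and "infinite (UNIV :: 'i set)"
  shows "in_4LQSR TYPE('u) (kb_formula D K) \<and>
         (satisfiable TYPE('u) (kb_formula D K) \<longleftrightarrow> consistent TYPE('i) D K)"
proof -
  interpret kb_over_map D K
    using assms(1,2) by unfold_locales
  have "consistent TYPE('i) D K" if sat: "satisfiable TYPE('u) (kb_formula D K)"
  proof -
    obtain M :: "('u, 'n var0, 'n var1, nat, 'n var3) lqs_interp"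
      where "is_lqs_interp M" "psat (sat_comp3 M) (kb_formula D K)"
      using sat by (auto simp: satisfiable_def)
    then interpret kb_model D K M by unfold_locales
    show ?thesis using assms(4) by (rule consistent)
  qed
  then show ?thesis
    using kb_formula_in_4LQSR consistent_imp_satisfiable[OF assms(3)] by blast
qed

end
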